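(* (SUCI5.) Let $s=5$, $\gamma_0=0$, $\gamma_5=1$, let $\gamma_1>0$ and $\gamma_2,\gamma_3,\gamma_4$ be real, set $\alpha_{10}=\gamma_1/2$ and $\alpha_{ii}=\gamma_1/2$ for $i=1,\dots,5$. Put $$G(x)=30(1-x)(1-\gamma_2)\gamma_1^2+(50x-45+10(5-6x)\gamma_2)\gamma_1+5(4x-3)\gamma_2-15x+12,$$ and define $$\alpha_{54}=\frac{G(\gamma_3)}{60\gamma_4(\gamma_4-\gamma_3)(\gamma_4-\gamma_2)(\gamma_4-\gamma_1)},\qquad \alpha_{53}=\frac{G(\gamma_4)}{60\gamma_3(\gamma_3-\gamma_4)(\gamma_2-\gamma_3)(\gamma_1-\gamma_3)},$$ $$\alpha_{43}=\frac{\gamma_4(\gamma_4-\gamma_1)(\gamma_4-\gamma_2)(\gamma_4-\gamma_3)(15\gamma_1^3\gamma_2-15\gamma_1^3-45\gamma_1^2\gamma_2+35\gamma_1^2+30\gamma_1\gamma_2-20\gamma_1-5\gamma_2+3)}{\gamma_3(\gamma_3-\gamma_1)(\gamma_3-\gamma_2)G(\gamma_3)},$$ $$\alpha_{52}=\frac{3\gamma_1^2+6(\alpha_{53}\gamma_3+\alpha_{54}\gamma_4-1)\gamma_1-6\alpha_{53}\gamma_3^2-6\alpha_{54}\gamma_4^2+2}{6\gamma_2(\gamma_2-\gamma_1)},\qquad \alpha_{32}=\frac{15\gamma_1^4-60\gamma_1^3+60\gamma_1^2-20\gamma_1+2}{120\alpha_{43}\alpha_{54}\gamma_2(\gamma_2-\gamma_1)},$$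 $$\alpha_{42}=\frac{N_{42}}{120\alpha_{43}\alpha_{54}^2\gamma_2(\gamma_1-\gamma_2)},$$ $$\begin{aligned}N_{42}={}&15\alpha_{53}\gamma_1^4+30(\alpha_{43}\alpha_{54}-2\alpha_{53})\gamma_1^3+30(2\alpha_{53}-3\alpha_{43}\alpha_{54})\gamma_1^2\\&+20(-6\alpha_{43}^2\alpha_{54}^2\gamma_3+3\alpha_{43}\alpha_{54}-\alpha_{53})\gamma_1+120\alpha_{43}^2\alpha_{54}^2\gamma_3^2-10\alpha_{43}\alpha_{54}+2\alpha_{53},\end{aligned}$$ $$\alpha_{20}=\frac{-\gamma_1^2+3\gamma_1\gamma_2-\gamma_2^2}{2\gamma_1},\qquad \alpha_{21}=\frac{\gamma_2(\gamma_2-\gamma_1)}{2\gamma_1},$$ $$\alpha_{30}=\frac{-\gamma_1^2+(3\gamma_3-2\alpha_{32})\gamma_1+2\alpha_{32}\gamma_2-\gamma_3^2}{2\gamma_1},\qquad \alpha_{31}=\frac{-2\alpha_{32}\gamma_2-\gamma_1\gamma_3+\gamma_3^2}{2\gamma_1},$$ $$\alpha_{40}=\frac{-\gamma_1^2+(3\gamma_4-2\alpha_{42}-2\alpha_{43})\gamma_1+2\alpha_{42}\gamma_2+2\alpha_{43}\gamma_3-\gamma_4^2}{2\gamma_1},\qquad \alpha_{41}=\frac{-2\alpha_{42}\gamma_2-2\alpha_{43}\gamma_3-\gamma_1\gamma_4+\gamma_4^2}{2\gamma_1},$$ $$\alpha_{50}=\frac{-\gamma_1^2+(3-2\alpha_{52}-2\alpha_{53}-2\alpha_{54})\gamma_1+2\alpha_{52}\gamma_2+2\alpha_{53}\gamma_3+2\alpha_{54}\gamma_4-1}{2\gamma_1},$$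 $$\alpha_{51}=\frac{-2\alpha_{52}\gamma_2-2\alpha_{53}\gamma_3-2\alpha_{54}\gamma_4-\gamma_1+1}{2\gamma_1},$$ where $\gamma_1,\dots,\gamma_4$ are assumed to be such that all denominators are nonzero. Let $$R_\infty(\gamma_1)=\frac{15\gamma_1^5-150\gamma_1^4+300\gamma_1^3-200\gamma_1^2+50\gamma_1-4}{15\gamma_1^5}.$$ Then there are real numbers $a_1<b_1<a_2<b_2$, independent of the parameters, within $10^{-8}$ of $0.4930103863$, $0.7236067977$, $0.8415650255$, $0.9465367825$ respectively, such that the five-sub-step method with these parameters satisfies: (a) it is fifth-order accurate; (b) it is unconditionally stable if and only if $\gamma_1\in[a_1,b_1]\cup[a_2,b_2]$; (c) as $\omega\to\infty$ with $\Delta t>0$ and $\xi\in[0,1)$ fixed, the characteristic polynomial of $\mathbf D_{num}$ tends to $(\zeta-R_\infty(\gamma_1))^2$; and for every $\rho_\infty\in[-1,1]$ there is a solution $\gamma_1$ of $R_\infty(\gamma_1)=\rho_\infty$ lying in $[a_1,b_1]\cup[a_2,b_2]$.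
   Context: The $s$-sub-step method. For the scalar equation $\ddot u(t)+2\xi\omega\dot u(t)+\omega^2u(t)=f(t)$ with $\omega>0$, $\xi\in[0,1)$, and a step from $t_n$ to $t_{n+1}=t_n+\Delta t$ starting from $(u_n,\dot u_n)$ with $\ddot u_n=f(t_n)-2\xi\omega\dot u_n-\omega^2u_n$, the $s$-sub-step method computes, for $i=1,\dots,s$, $$\ddot u_{n+\gamma_i}+2\xi\omega\dot u_{n+\gamma_i}+\omega^2u_{n+\gamma_i}=f(t_n+\gamma_i\Delta t),\quad u_{n+\gamma_i}=u_n+\Delta t\sum_{j=0}^{i}\alpha_{ij}\dot u_{n+\gamma_j},\quad \dot u_{n+\gamma_i}=\dot u_n+\Delta t\sum_{j=0}^{i}\alpha_{ij}\ddot u_{n+\gamma_j},$$ where $\gamma_0=0$, $\gamma_s=1$, and $u_{n+\gamma_0}=u_n$ (similarly for derivatives). The numerical solution at $t_{n+1}$ is $(u_{n+1},\dot u_{n+1})=(u_{n+\gamma_s},\dot u_{n+\gamma_s})$. It has the form $(u_{n+1},\dot u_{n+1})^{\mathsf T}=\mathbf D_{num}(u_n,\dot u_n)^{\mathsf T}+\mathbf L_{num}$, where the $2\times2$ amplification matrix $\mathbf D_{num}$ depends on $\xi,\omega,\Delta t$ and the parameters, and $\mathbf L_{num}$ depends also on $f$. Exact solution operators. Take $t_n=0$ and $f(t)=\exp(t)$. The exact solution with data $(u_n,\dot u_n)$ at $t_n$ satisfies $(u(t_{n+1}),\dot u(t_{n+1}))^{\mathsf T}=\mathbf D_{exa}(u_n,\dot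 u_n)^{\mathsf T}+\mathbf L_{exa}$, where $\mathbf D_{exa}$ is the exact $2\times 2$ propagator of the homogeneous equation over time $\Delta t$ and $\mathbf L_{exa}$ is the value at time $\Delta t$ of (displacement, velocity) for the solution with load $\exp(t)$ and zero data at $t=0$. $p$th-order accuracy: for all $\omega>0$, $\xi\in[0,1)$, with load $f(t)=\exp(t)$ and $t_n=0$, one has $\mathbf D_{num}-\mathbf D_{exa}=O(\Delta t^{p+1})$ and $\mathbf L_{num}-\mathbf L_{exa}=O(\Delta t^{p+1})$ entrywise as $\Delta t\to0$. Unconditional stability: for $\xi=0$ the spectral radius of $\mathbf D_{num}$ is at most $1$ for all $\Omega=\omega\Delta t\in[0,\infty)$. *)

theory Defs
  imports Complex_Main "HOL-Library.Landau_Symbols" "Jordan_Normal_Form.Spectral_Radius"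
begin

definition state :: "real \<Rightarrow> real \<Rightarrow> real vec" where
  "state u v = vec_of_list [u, v]"

text \<open>The defining equations of one step of the \<open>s\<close>-sub-step method from \<open>tn\<close> to \<open>tn + \<Delta>t\<close>:
  \<open>u i\<close>, \<open>v i\<close>, \<open>a i\<close> are displacement, velocity and acceleration at \<open>tn + \<gamma> i * \<Delta>t\<close>.\<close>

definition sub_steps ::
  "nat \<Rightarrow> (nat \<Rightarrow> nat \<Rightarrow> real) \<Rightarrow> (nat \<Rightarrow> real) \<Rightarrow> real \<Rightarrow> real \<Rightarrow> real \<Rightarrow> (real \<Rightarrow> real) \<Rightarrow> real
    \<Rightarrow> (nat \<Rightarrow> real) \<Rightarrow> (nat \<Rightarrow> real) \<Rightarrow> (nat \<Rightarrow> real) \<Rightarrow> bool" where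
  "sub_steps s \<alpha> \<gamma> \<xi> \<omega> \<Delta>t f tn u v a \<longleftrightarrow>
     a 0 = f tn - 2 * \<xi> * \<omega> * v 0 - \<omega>\<^sup>2 * u 0 \<and>
     (\<forall>i\<in>{1..s}.
        a i + 2 * \<xi> * \<omega> * v i + \<omega>\<^sup>2 * u i = f (tn + \<gamma> i * \<Delta>t) \<and>
        u i = u 0 + \<Delta>t * (\<Sum>j=0..i. \<alpha> i j * v j) \<and>
        v i = v 0 + \<Delta>t * (\<Sum>j=0..i. \<alpha> i j * a j))"

text \<open>The sub-step equations determine \<open>u\<close>, \<open>v\<close>, \<open>a\<close> from \<open>u 0\<close>, \<open>v 0\<close> uniquely as soon as
  \<open>1 + 2 * \<xi> * \<omega> * (\<alpha> i i * \<Delta>t) + (\<omega> * \<alpha> i i * \<Delta>t)\<^sup>2 \<noteq> 0\<close> for \<open>i = 1, \<dots>, s\<close>, in particular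
  for \<open>\<xi>, \<omega>, \<alpha> i i, \<Delta>t \<ge> 0\<close>. The solution is then affine in the initial data, with a linear part
  that depends on neither \<open>f\<close> nor \<open>tn\<close>, so the descriptions below are proper.\<close>

definition D_num ::
  "nat \<Rightarrow> (nat \<Rightarrow> nat \<Rightarrow> real) \<Rightarrow> (nat \<Rightarrow> real) \<Rightarrow> real \<Rightarrow> real \<Rightarrow> real \<Rightarrow> real mat" where
  "D_num s \<alpha> \<gamma> \<xi> \<omega> \<Delta>t =
     (THE D. D \<in> carrier_mat 2 2 \<and>
        (\<forall>f tn. \<exists>L\<in>carrier_vec 2. \<forall>u v a. sub_steps s \<alpha> \<gamma> \<xi> \<omega> \<Delta>t f tn u v a \<longrightarrow>
           state (u s) (v s) = D *\<^sub>v state (u 0) (v 0) + L))"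

definition L_num ::
  "nat \<Rightarrow> (nat \<Rightarrow> nat \<Rightarrow> real) \<Rightarrow> (nat \<Rightarrow> real) \<Rightarrow> real \<Rightarrow> real \<Rightarrow> real \<Rightarrow> (real \<Rightarrow> real) \<Rightarrow> real
    \<Rightarrow> real vec" where
  "L_num s \<alpha> \<gamma> \<xi> \<omega> \<Delta>t f tn =
     (THE L. L \<in> carrier_vec 2 \<and>
        (\<forall>u v a. sub_steps s \<alpha> \<gamma> \<xi> \<omega> \<Delta>t f tn u v a \<longrightarrow>
           state (u s) (v s) = D_num s \<alpha> \<gamma> \<xi> \<omega> \<Delta>t *\<^sub>v state (u 0) (v 0) + L))"

definition exact_motion ::
  "real \<Rightarrow> real \<Rightarrow> (real \<Rightarrow> real) \<Rightarrow> (real \<Rightarrow> real) \<Rightarrow> (real \<Rightarrow> real) \<Rightarrow> bool" where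
  "exact_motion \<xi> \<omega> f u v \<longleftrightarrow>
     (\<forall>t. (u has_real_derivative v t) (at t) \<and>
          (v has_real_derivative (f t - 2 * \<xi> * \<omega> * v t - \<omega>\<^sup>2 * u t)) (at t))"

definition D_exa :: "real \<Rightarrow> real \<Rightarrow> real \<Rightarrow> real mat" where
  "D_exa \<xi> \<omega> \<Delta>t =
     (THE D. D \<in> carrier_mat 2 2 \<and>
        (\<forall>u v. exact_motion \<xi> \<omega> (\<lambda>_. 0) u v \<longrightarrow>
           state (u \<Delta>t) (v \<Delta>t) = D *\<^sub>v state (u 0) (v 0)))"

definition L_exa :: "real \<Rightarrow> real \<Rightarrow> real \<Rightarrow> real vec" where
  "L_exa \<xi> \<omega> \<Delta>t =
     (THE L. \<forall>u v. exact_motion \<xi> \<omega> exp u v \<and> u 0 = 0 \<and> v 0 = 0 \<longrightarrow>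
        L = state (u \<Delta>t) (v \<Delta>t))"

definition accurate_of_order ::
  "nat \<Rightarrow> nat \<Rightarrow> (nat \<Rightarrow> nat \<Rightarrow> real) \<Rightarrow> (nat \<Rightarrow> real) \<Rightarrow> bool" where
  "accurate_of_order p s \<alpha> \<gamma> \<longleftrightarrow>
     (\<forall>\<omega>>0. \<forall>\<xi>\<in>{0..<1}.
        (\<forall>i<2. \<forall>j<2. (\<lambda>\<Delta>t. D_num s \<alpha> \<gamma> \<xi> \<omega> \<Delta>t $$ (i, j) - D_exa \<xi> \<omega> \<Delta>t $$ (i, j))
                       \<in> O[at_right 0](\<lambda>\<Delta>t. \<Delta>t ^ (p + 1))) \<and>
        (\<forall>i<2. (\<lambda>\<Delta>t. L_num s \<alpha> \<gamma> \<xi> \<omega> \<Delta>t exp 0 $ i - L_exa \<xi> \<omega> \<Delta>t $ i)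
                 \<in> O[at_right 0](\<lambda>\<Delta>t. \<Delta>t ^ (p + 1))))"

definition unconditionally_stable ::
  "nat \<Rightarrow> (nat \<Rightarrow> nat \<Rightarrow> real) \<Rightarrow> (nat \<Rightarrow> real) \<Rightarrow> bool" where
  "unconditionally_stable s \<alpha> \<gamma> \<longleftrightarrow>
     (\<forall>\<omega>>0. \<forall>\<Delta>t\<ge>0. spectral_radius (map_mat complex_of_real (D_num s \<alpha> \<gamma> 0 \<omega> \<Delta>t)) \<le> 1)"

definition G5 :: "real \<Rightarrow> real \<Rightarrow> real \<Rightarrow> real" where
  "G5 \<gamma>1 \<gamma>2 x = 30 * (1 - x) * (1 - \<gamma>2) * \<gamma>1^2 + (50 * x - 45 + 10 * (5 - 6 * x) * \<gamma>2) * \<gamma>1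
     + 5 * (4 * x - 3) * \<gamma>2 - 15 * x + 12"

definition N42 :: "real \<Rightarrow> real \<Rightarrow> real \<Rightarrow> real \<Rightarrow> real \<Rightarrow> real" where
  "N42 \<gamma>1 \<gamma>3 \<alpha>43 \<alpha>53 \<alpha>54 =
     15 * \<alpha>53 * \<gamma>1^4 + 30 * (\<alpha>43 * \<alpha>54 - 2 * \<alpha>53) * \<gamma>1^3 + 30 * (2 * \<alpha>53 - 3 * \<alpha>43 * \<alpha>54) * \<gamma>1^2
     + 20 * (- 6 * \<alpha>43^2 * \<alpha>54^2 * \<gamma>3 + 3 * \<alpha>43 * \<alpha>54 - \<alpha>53) * \<gamma>1
     + 120 * \<alpha>43^2 * \<alpha>54^2 * \<gamma>3^2 - 10 * \<alpha>43 * \<alpha>54 + 2 * \<alpha>53"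

definition SUCI5 :: "(nat \<Rightarrow> nat \<Rightarrow> real) \<Rightarrow> (nat \<Rightarrow> real) \<Rightarrow> bool" where
  "SUCI5 \<alpha> \<gamma> \<longleftrightarrow>
    (let \<gamma>1 = \<gamma> 1; \<gamma>2 = \<gamma> 2; \<gamma>3 = \<gamma> 3; \<gamma>4 = \<gamma> 4; G = G5 \<gamma>1 \<gamma>2;
         \<alpha>32 = \<alpha> 3 2; \<alpha>42 = \<alpha> 4 2; \<alpha>43 = \<alpha> 4 3; \<alpha>52 = \<alpha> 5 2; \<alpha>53 = \<alpha> 5 3; \<alpha>54 = \<alpha> 5 4
     in
      \<gamma> 0 = 0 \<and> \<gamma> 5 = 1 \<and> \<gamma>1 > 0 \<and>
      60 * \<gamma>4 * (\<gamma>4 - \<gamma>3) * (\<gamma>4 - \<gamma>2) * (\<gamma>4 - \<gamma>1) \<noteq> 0 \<and>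
      60 * \<gamma>3 * (\<gamma>3 - \<gamma>4) * (\<gamma>2 - \<gamma>3) * (\<gamma>1 - \<gamma>3) \<noteq> 0 \<and>
      \<gamma>3 * (\<gamma>3 - \<gamma>1) * (\<gamma>3 - \<gamma>2) * G \<gamma>3 \<noteq> 0 \<and>
      6 * \<gamma>2 * (\<gamma>2 - \<gamma>1) \<noteq> 0 \<and>
      120 * \<alpha>43 * \<alpha>54 * \<gamma>2 * (\<gamma>2 - \<gamma>1) \<noteq> 0 \<and>
      120 * \<alpha>43 * \<alpha>54^2 * \<gamma>2 * (\<gamma>1 - \<gamma>2) \<noteq> 0 \<and>
      2 * \<gamma>1 \<noteq> 0 \<and>
      \<alpha> 1 0 = \<gamma>1 / 2 \<and> (\<forall>i\<in>{1..5}. \<alpha> i i = \<gamma>1 / 2) \<and>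
      \<alpha>54 = G \<gamma>3 / (60 * \<gamma>4 * (\<gamma>4 - \<gamma>3) * (\<gamma>4 - \<gamma>2) * (\<gamma>4 - \<gamma>1)) \<and>
      \<alpha>53 = G \<gamma>4 / (60 * \<gamma>3 * (\<gamma>3 - \<gamma>4) * (\<gamma>2 - \<gamma>3) * (\<gamma>1 - \<gamma>3)) \<and>
      \<alpha>43 = \<gamma>4 * (\<gamma>4 - \<gamma>1) * (\<gamma>4 - \<gamma>2) * (\<gamma>4 - \<gamma>3)
              * (15 * \<gamma>1^3 * \<gamma>2 - 15 * \<gamma>1^3 - 45 * \<gamma>1^2 * \<gamma>2 + 35 * \<gamma>1^2 + 30 * \<gamma>1 * \<gamma>2
                 - 20 * \<gamma>1 - 5 * \<gamma>2 + 3)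
            / (\<gamma>3 * (\<gamma>3 - \<gamma>1) * (\<gamma>3 - \<gamma>2) * G \<gamma>3) \<and>
      \<alpha>52 = (3 * \<gamma>1^2 + 6 * (\<alpha>53 * \<gamma>3 + \<alpha>54 * \<gamma>4 - 1) * \<gamma>1 - 6 * \<alpha>53 * \<gamma>3^2 - 6 * \<alpha>54 * \<gamma>4^2 + 2)
            / (6 * \<gamma>2 * (\<gamma>2 - \<gamma>1)) \<and>
      \<alpha>32 = (15 * \<gamma>1^4 - 60 * \<gamma>1^3 + 60 * \<gamma>1^2 - 20 * \<gamma>1 + 2)
            / (120 * \<alpha>43 * \<alpha>54 * \<gamma>2 * (\<gamma>2 - \<gamma>1)) \<and>
      \<alpha>42 = N42 \<gamma>1 \<gamma>3 \<alpha>43 \<alpha>53 \<alpha>54 / (120 * \<alpha>43 * \<alpha>54^2 * \<gamma>2 * (\<gamma>1 - \<gamma>2)) \<and>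
      \<alpha> 2 0 = (- (\<gamma>1^2) + 3 * \<gamma>1 * \<gamma>2 - \<gamma>2^2) / (2 * \<gamma>1) \<and>
      \<alpha> 2 1 = \<gamma>2 * (\<gamma>2 - \<gamma>1) / (2 * \<gamma>1) \<and>
      \<alpha> 3 0 = (- (\<gamma>1^2) + (3 * \<gamma>3 - 2 * \<alpha>32) * \<gamma>1 + 2 * \<alpha>32 * \<gamma>2 - \<gamma>3^2) / (2 * \<gamma>1) \<and>
      \<alpha> 3 1 = (- 2 * \<alpha>32 * \<gamma>2 - \<gamma>1 * \<gamma>3 + \<gamma>3^2) / (2 * \<gamma>1) \<and>
      \<alpha> 4 0 = (- (\<gamma>1^2) + (3 * \<gamma>4 - 2 * \<alpha>42 - 2 * \<alpha>43) * \<gamma>1 + 2 * \<alpha>42 * \<gamma>2 + 2 * \<alpha>43 * \<gamma>3 - \<gamma>4^2)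
              / (2 * \<gamma>1) \<and>
      \<alpha> 4 1 = (- 2 * \<alpha>42 * \<gamma>2 - 2 * \<alpha>43 * \<gamma>3 - \<gamma>1 * \<gamma>4 + \<gamma>4^2) / (2 * \<gamma>1) \<and>
      \<alpha> 5 0 = (- (\<gamma>1^2) + (3 - 2 * \<alpha>52 - 2 * \<alpha>53 - 2 * \<alpha>54) * \<gamma>1 + 2 * \<alpha>52 * \<gamma>2 + 2 * \<alpha>53 * \<gamma>3
               + 2 * \<alpha>54 * \<gamma>4 - 1) / (2 * \<gamma>1) \<and>
      \<alpha> 5 1 = (- 2 * \<alpha>52 * \<gamma>2 - 2 * \<alpha>53 * \<gamma>3 - 2 * \<alpha>54 * \<gamma>4 - \<gamma>1 + 1) / (2 * \<gamma>1))"

definition R_inf :: "real \<Rightarrow> real" where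
  "R_inf x = (15 * x^5 - 150 * x^4 + 300 * x^3 - 200 * x^2 + 50 * x - 4) / (15 * x^5)"

end

theory Submission
  imports Defs "HOL-Analysis.Complex_Transcendental"
begin

text \<open>
  With \<open>\<xi> < 1\<close> the companion matrix of the equation has two distinct conjugate eigenvalues \<open>\<mu>\<close> and
  \<open>cnj \<mu>\<close>. In the complex coordinate \<open>w = v - cnj \<mu> * u\<close> the equation becomes \<open>w' = \<mu> * w + f\<close>, and the
  sub-step equations become the stages of a diagonally implicit Runge-Kutta method applied to it
  (\<open>sub_steps_iff_complex_stages\<close>). Hence \<open>D_num\<close> is multiplication by one complex number \<open>R(\<mu> \<Delta>t)\<close>, as
  \<open>D_exa\<close> is multiplication by \<open>exp (\<mu> \<Delta>t)\<close>; its trace is \<open>2 Re R\<close>, its determinant is \<open>|R|^2\<close>, and its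
  spectral radius is \<open>|R|\<close>.

  Order. The coefficients satisfy the simplifying assumptions \<open>A 1 = c\<close>, \<open>A c = c^2/2\<close> and all quadrature
  conditions of order five for linear equations, \<open>b A^k c^l = l!/(k+l+1)!\<close>
  (\<open>SUCI5_order5_conditions\<close>). The error of the stages solves the same scheme with the local defects as
  source; these start with \<open>\<Delta>t^3\<close>, so iterating the error recursion three times leaves an error
  \<open>O(\<Delta>t^6)\<close> (\<open>scheme_accuracy\<close>). Exponential solutions are enough: the forced solution for the load
  \<open>exp\<close> is the difference of the exponentials with rates \<open>1\<close> and \<open>\<mu>\<close>, divided by \<open>1 - \<mu>\<close>.

  Stability. All diagonal coefficients equal \<open>g = \<gamma>\<^sub>1/2\<close>, so \<open>R(z) (1 - g z)^5\<close> is a polynomial of degree at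
  most five. As it agrees with \<open>exp z (1 - g z)^5\<close> up to \<open>O(z^6)\<close>, it is the Taylor polynomial of the
  latter (\<open>stability_function\<close>): \<open>R\<close> depends on \<open>\<gamma>\<^sub>1\<close> alone. Its value at infinity is \<open>R_inf \<gamma>\<^sub>1\<close>, which gives
  the limit of the characteristic polynomial. On the imaginary axis \<open>|1 - g i y|^10 - |(1 - g i y)^5 R(i y)|^2\<close>
  equals \<open>y^6\<close> times a quadratic polynomial in \<open>y^2\<close> (\<open>gap_identity\<close>), so that stability is the nonnegativity of
  this quadratic on the positive half-line. The sign pattern of its three coefficients as functions of \<open>\<gamma>\<^sub>1\<close>
  then determines the set of stable \<open>\<gamma>\<^sub>1\<close> (\<open>gap_nonneg_iff\<close>): the leading coefficient is a positive
  multiple of \<open>1 - R_inf^2\<close>, which has \<open>a1\<close>, \<open>b1\<close> and \<open>a2\<close> among its zeros, while \<open>b2\<close> is a zero of the constant coefficient.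
  On \<open>[a1, b1]\<close> the limit \<open>R_inf\<close> runs from \<open>-1\<close> to \<open>1\<close>.
\<close>

section \<open>Order conditions\<close>

text \<open>
  The residual of the simplifying assumption \<open>C(k)\<close> at stage \<open>i\<close>: this number, multiplied by \<open>h^k / k!\<close> and by
  the \<open>k\<close>-th derivative of a smooth function, is the term of order \<open>k\<close> in the local error of the stage. For \<open>k = 1\<close> the factor
  \<open>\<gamma> j ^ 0\<close> is \<open>1\<close> even when \<open>\<gamma> j = 0\<close>.
\<close>

definition defect :: "(nat \<Rightarrow> nat \<Rightarrow> real) \<Rightarrow> (nat \<Rightarrow> real) \<Rightarrow> nat \<Rightarrow> nat \<Rightarrow> real" where
  "defect \<alpha> \<gamma> k i = \<gamma> i ^ k - real k * (\<Sum>j=0..i. \<alpha> i j * \<gamma> j ^ (k - 1))"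

text \<open>
  The conditions under which the terms of order at most five cancel in the last stage. With stage order two
  only the defects for \<open>k \<ge> 3\<close> are left, and a defect of order \<open>k\<close> reaches the last stage through at most
  \<open>5 - k\<close> further applications of the coefficient matrix before it is of order six.
\<close>

definition order5_conditions :: "(nat \<Rightarrow> nat \<Rightarrow> real) \<Rightarrow> (nat \<Rightarrow> real) \<Rightarrow> bool" where
  "order5_conditions \<alpha> \<gamma> \<longleftrightarrow>
     (\<forall>i\<in>{1..5}. defect \<alpha> \<gamma> 1 i = 0 \<and> defect \<alpha> \<gamma> 2 i = 0) \<and>
     defect \<alpha> \<gamma> 3 5 = 0 \<and> defect \<alpha> \<gamma> 4 5 = 0 \<and> defect \<alpha> \<gamma> 5 5 = 0 \<and>
     (\<Sum>i=1..5. \<alpha> 5 i * defect \<alpha> \<gamma> 3 i) = 0 \<and>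
     (\<Sum>i=1..5. \<alpha> 5 i * defect \<alpha> \<gamma> 4 i) = 0 \<and>
     (\<Sum>i=1..5. \<alpha> 5 i * (\<Sum>j=1..i. \<alpha> i j * defect \<alpha> \<gamma> 3 j)) = 0"

text \<open>
  The weights \<open>\<alpha>\<^sub>5\<^sub>3\<close> and \<open>\<alpha>\<^sub>5\<^sub>4\<close> are the solution of two linear equations: the last row must integrate
  \<open>x (x - \<gamma>\<^sub>1) (x - \<gamma>\<^sub>2)\<close> and \<open>x^2 (x - \<gamma>\<^sub>1) (x - \<gamma>\<^sub>2)\<close> exactly over \<open>[0, 1]\<close>. Both polynomials vanish at the
  nodes \<open>0\<close>, \<open>\<gamma>\<^sub>1\<close> and \<open>\<gamma>\<^sub>2\<close>, which leaves only the two unknown weights. The determinant of the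
  system contains \<open>\<gamma>\<^sub>4 - \<gamma>\<^sub>3\<close>, the factor that is cancelled here.
\<close>

lemma quadrature_moments:
  fixes g1 g2 g3 g4 a53 a54 :: real
  defines "r \<equiv> \<lambda>x. x * (x - g1) * (x - g2)"
  assumes ne: "g3 \<noteq> g4"
    and a54: "60 * g4 * (g4 - g3) * (g4 - g2) * (g4 - g1) * a54 = G5 g1 g2 g3"
    and a53: "60 * g3 * (g3 - g4) * (g2 - g3) * (g1 - g3) * a53 = G5 g1 g2 g4"
  shows "a53 * r g3 + a54 * r g4 + g1 / 2 * r 1 = 1/4 - (g1 + g2) / 3 + g1 * g2 / 2"
    and "a53 * g3 * r g3 + a54 * g4 * r g4 + g1 / 2 * r 1 = 1/5 - (g1 + g2) / 4 + g1 * g2 / 3"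
proof -
  have 1: "60 * (g4 - g3) * (a54 * r g4) = G5 g1 g2 g3"
    using a54 by (simp add: r_def algebra_simps)
  have 2: "60 * (g4 - g3) * (a53 * r g3) = - G5 g1 g2 g4"
    using a53 by (simp add: r_def algebra_simps)
  have "60 * (g4 - g3) * (a53 * r g3 + a54 * r g4 + g1 / 2 * r 1)
      = 60 * (g4 - g3) * (1/4 - (g1 + g2) / 3 + g1 * g2 / 2)"
    unfolding distrib_left[of "60 * (g4 - g3)"] 1 2
    by (simp add: r_def G5_def field_simps power2_eq_square)
  with ne show "a53 * r g3 + a54 * r g4 + g1 / 2 * r 1 = 1/4 - (g1 + g2) / 3 + g1 * g2 / 2"
    by simp
  have "60 * (g4 - g3) * (a53 * g3 * r g3 + a54 * g4 * r g4 + g1 / 2 * r 1)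
      = g3 * (60 * (g4 - g3) * (a53 * r g3)) + g4 * (60 * (g4 - g3) * (a54 * r g4)) + 60 * (g4 - g3) * (g1 / 2 * r 1)"
    by (simp add: algebra_simps)
  also have "\<dots> = 60 * (g4 - g3) * (1/5 - (g1 + g2) / 4 + g1 * g2 / 3)"
    unfolding 1 2 by (simp add: r_def G5_def field_simps power2_eq_square)
  finally show "a53 * g3 * r g3 + a54 * g4 * r g4 + g1 / 2 * r 1 = 1/5 - (g1 + g2) / 4 + g1 * g2 / 3"
    using ne by simp
qed

text \<open>
  The coefficients \<open>\<alpha>\<^sub>4\<^sub>3\<close>, \<open>\<alpha>\<^sub>3\<^sub>2\<close> and \<open>\<alpha>\<^sub>4\<^sub>2\<close> enter the order conditions only through the weights of the paths
  that run strictly down the coefficient matrix, evaluated on polynomials which vanish at the nodes \<open>0\<close> and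
  \<open>\<gamma>\<^sub>1\<close> (and \<open>\<gamma>\<^sub>2\<close>). These path weights are polynomials in \<open>\<gamma>\<^sub>1\<close> and \<open>\<gamma>\<^sub>2\<close>, although the coefficients
  themselves have large denominators.
\<close>

lemma chain_products:
  fixes g1 g2 g3 g4 a32 a42 a43 a53 a54 :: real
  defines "q \<equiv> \<lambda>x. x * (x - g1)"
  defines "M \<equiv> 15 * g1^4 - 60 * g1^3 + 60 * g1^2 - 20 * g1 + 2"
  assumes nz: "g4 * (g4 - g1) * (g4 - g2) * (g4 - g3) \<noteq> 0" "a43 * a54 \<noteq> 0"
    and a54: "60 * g4 * (g4 - g3) * (g4 - g2) * (g4 - g1) * a54 = G5 g1 g2 g3"
    and a43: "a43 * (g3 * (g3 - g1) * (g3 - g2) * G5 g1 g2 g3) = g4 * (g4 - g1) * (g4 - g2) * (g4 - g3)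
              * (15 * g1^3 * g2 - 15 * g1^3 - 45 * g1^2 * g2 + 35 * g1^2 + 30 * g1 * g2
                 - 20 * g1 - 5 * g2 + 3)"
    and a32: "a32 * (120 * a43 * a54 * g2 * (g2 - g1)) = M"
    and a42: "a42 * (120 * a43 * a54^2 * g2 * (g1 - g2)) = N42 g1 g3 a43 a53 a54"
  shows "60 * (a54 * a43 * (g3 * (g3 - g1) * (g3 - g2)))
      = 15 * g1^3 * g2 - 15 * g1^3 - 45 * g1^2 * g2 + 35 * g1^2 + 30 * g1 * g2 - 20 * g1 - 5 * g2 + 3"
    and "120 * (a54 * a43 * a32 * q g2) = M"
    and "12 * (a54 * (a42 * q g2 + a43 * q g3) + a53 * a32 * q g2) = 1 - 6 * g1 + 9 * g1^2 - 3 * g1^3"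
proof -
  have "(g4 * (g4 - g1) * (g4 - g2) * (g4 - g3)) * (60 * (a54 * a43 * (g3 * (g3 - g1) * (g3 - g2))))
     = a43 * (g3 * (g3 - g1) * (g3 - g2) * G5 g1 g2 g3)"
    unfolding a54[symmetric] by (simp add: algebra_simps)
  with nz(1) show "60 * (a54 * a43 * (g3 * (g3 - g1) * (g3 - g2)))
      = 15 * g1^3 * g2 - 15 * g1^3 - 45 * g1^2 * g2 + 35 * g1^2 + 30 * g1 * g2 - 20 * g1 - 5 * g2 + 3"
    unfolding a43 by simp
  show M: "120 * (a54 * a43 * a32 * q g2) = M"
    using a32 by (simp add: q_def algebra_simps)
  have "a43 * a54 * (120 * (a54 * (a42 * q g2 + a43 * q g3) + a53 * a32 * q g2))
      = - (a42 * (120 * a43 * a54^2 * g2 * (g1 - g2))) + 120 * a43^2 * a54^2 * q g3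
        + a53 * (120 * (a54 * a43 * a32 * q g2))"
    by (simp add: q_def algebra_simps power2_eq_square)
  also have "\<dots> = a43 * a54 * (10 * (1 - 6 * g1 + 9 * g1^2 - 3 * g1^3))"
    unfolding a42 M by (simp add: N42_def M_def q_def algebra_simps power2_eq_square)
  finally show "12 * (a54 * (a42 * q g2 + a43 * q g3) + a53 * a32 * q g2) = 1 - 6 * g1 + 9 * g1^2 - 3 * g1^3"
    using nz(2) by simp
qed

lemma sum_expand:
  fixes f :: "nat \<Rightarrow> 'a::comm_monoid_add"
  shows "(\<Sum>j=0..1. f j) = f 0 + f 1" "(\<Sum>j=0..2. f j) = f 0 + f 1 + f 2"
    "(\<Sum>j=0..3. f j) = f 0 + f 1 + f 2 + f 3" "(\<Sum>j=0..4. f j) = f 0 + f 1 + f 2 + f 3 + f 4"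
    "(\<Sum>j=0..5. f j) = f 0 + f 1 + f 2 + f 3 + f 4 + f 5"
    "(\<Sum>j=1..1. f j) = f 1" "(\<Sum>j=1..2. f j) = f 1 + f 2"
    "(\<Sum>j=1..3. f j) = f 1 + f 2 + f 3" "(\<Sum>j=1..4. f j) = f 1 + f 2 + f 3 + f 4"
    "(\<Sum>j=1..5. f j) = f 1 + f 2 + f 3 + f 4 + f 5"
  by (simp_all add: eval_nat_numeral add.assoc)

lemma ball_1_5: "(\<forall>i\<in>{1..5::nat}. P i) \<longleftrightarrow> P 1 \<and> P 2 \<and> P 3 \<and> P 4 \<and> P 5"
proof -
  have "{1..5::nat} = {1, 2, 3, 4, 5}" by auto
  then show ?thesis by simp
qed

text \<open>
  In each order condition the powers of the nodes are replaced by \<open>q(x) = x (x - \<gamma>\<^sub>1)\<close> and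
  \<open>r(x) = x (x - \<gamma>\<^sub>1) (x - \<gamma>\<^sub>2)\<close> plus polynomials of lower degree. The lower-degree parts are known from the
  previous conditions. On \<open>q\<close> and \<open>r\<close> the coefficient matrix acts as \<open>\<gamma>\<^sub>1/2\<close> times the identity plus its
  strictly lower part, whose contributions are the path weights of \<open>chain_products\<close>.
\<close>

lemma SUCI5_order5_conditions:
  assumes "SUCI5 \<alpha> \<gamma>"
  shows "order5_conditions \<alpha> \<gamma>"
proof -
  define g1 g2 g3 g4 where g: "g1 = \<gamma> 1" "g2 = \<gamma> 2" "g3 = \<gamma> 3" "g4 = \<gamma> 4"
  define a20 a21 a30 a31 a32 a40 a41 a42 a43 a50 a51 a52 a53 a54
    where a: "a20 = \<alpha> 2 0" "a21 = \<alpha> 2 1" "a30 = \<alpha> 3 0" "a31 = \<alpha> 3 1" "a32 = \<alpha> 3 2"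
      "a40 = \<alpha> 4 0" "a41 = \<alpha> 4 1" "a42 = \<alpha> 4 2" "a43 = \<alpha> 4 3"
      "a50 = \<alpha> 5 0" "a51 = \<alpha> 5 1" "a52 = \<alpha> 5 2" "a53 = \<alpha> 5 3" "a54 = \<alpha> 5 4"
  note S = assms[unfolded SUCI5_def Let_def ball_1_5, folded g a]
  have gamma: "\<gamma> 0 = 0" "\<gamma> 5 = 1"
    and diag: "\<alpha> 1 0 = g1 / 2" "\<alpha> 1 1 = g1 / 2" "\<alpha> 2 2 = g1 / 2" "\<alpha> 3 3 = g1 / 2" "\<alpha> 4 4 = g1 / 2" "\<alpha> 5 5 = g1 / 2"
    using S by blast+
  have n: "60 * g4 * (g4 - g3) * (g4 - g2) * (g4 - g1) \<noteq> 0"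
      "60 * g3 * (g3 - g4) * (g2 - g3) * (g1 - g3) \<noteq> 0"
      "g3 * (g3 - g1) * (g3 - g2) * G5 g1 g2 g3 \<noteq> 0" "6 * g2 * (g2 - g1) \<noteq> 0"
      "120 * a43 * a54 * g2 * (g2 - g1) \<noteq> 0" "120 * a43 * a54^2 * g2 * (g1 - g2) \<noteq> 0" "2 * g1 \<noteq> 0"
    using S by blast+
  have eqs: "a54 = G5 g1 g2 g3 / (60 * g4 * (g4 - g3) * (g4 - g2) * (g4 - g1))"
    "a53 = G5 g1 g2 g4 / (60 * g3 * (g3 - g4) * (g2 - g3) * (g1 - g3))"
    "a43 = g4 * (g4 - g1) * (g4 - g2) * (g4 - g3) * (15 * g1^3 * g2 - 15 * g1^3 - 45 * g1^2 * g2 + 35 * g1^2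
       + 30 * g1 * g2 - 20 * g1 - 5 * g2 + 3) / (g3 * (g3 - g1) * (g3 - g2) * G5 g1 g2 g3)"
    "a52 = (3 * g1^2 + 6 * (a53 * g3 + a54 * g4 - 1) * g1 - 6 * a53 * g3^2 - 6 * a54 * g4^2 + 2) / (6 * g2 * (g2 - g1))"
    "a32 = (15 * g1^4 - 60 * g1^3 + 60 * g1^2 - 20 * g1 + 2) / (120 * a43 * a54 * g2 * (g2 - g1))"
    "a42 = N42 g1 g3 a43 a53 a54 / (120 * a43 * a54^2 * g2 * (g1 - g2))"
    "a20 = (- (g1^2) + 3 * g1 * g2 - g2^2) / (2 * g1)"
    "a21 = g2 * (g2 - g1) / (2 * g1)"
    "a30 = (- (g1^2) + (3 * g3 - 2 * a32) * g1 + 2 * a32 * g2 - g3^2) / (2 * g1)"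
    "a31 = (- 2 * a32 * g2 - g1 * g3 + g3^2) / (2 * g1)"
    "a40 = (- (g1^2) + (3 * g4 - 2 * a42 - 2 * a43) * g1 + 2 * a42 * g2 + 2 * a43 * g3 - g4^2) / (2 * g1)"
    "a41 = (- 2 * a42 * g2 - 2 * a43 * g3 - g1 * g4 + g4^2) / (2 * g1)"
    "a50 = (- (g1^2) + (3 - 2 * a52 - 2 * a53 - 2 * a54) * g1 + 2 * a52 * g2 + 2 * a53 * g3 + 2 * a54 * g4 - 1) / (2 * g1)"
    "a51 = (- 2 * a52 * g2 - 2 * a53 * g3 - 2 * a54 * g4 - g1 + 1) / (2 * g1)"
    using S by blast+
  note cleared = eqs(1)[unfolded nonzero_eq_divide_eq[OF n(1)]] eqs(2)[unfolded nonzero_eq_divide_eq[OF n(2)]]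
    eqs(3)[unfolded nonzero_eq_divide_eq[OF n(3)]] eqs(4)[unfolded nonzero_eq_divide_eq[OF n(4)]]
    eqs(5)[unfolded nonzero_eq_divide_eq[OF n(5)]] eqs(6)[unfolded nonzero_eq_divide_eq[OF n(6)]]
    eqs(7-14)[unfolded nonzero_eq_divide_eq[OF n(7)]]
  have nz: "g1 \<noteq> 0" "g3 \<noteq> g4" "g4 * (g4 - g1) * (g4 - g2) * (g4 - g3) \<noteq> 0" "a43 * a54 \<noteq> 0"
    using n(1,2,5,7) by auto
  have a54: "60 * g4 * (g4 - g3) * (g4 - g2) * (g4 - g1) * a54 = G5 g1 g2 g3"
    and a53: "60 * g3 * (g3 - g4) * (g2 - g3) * (g1 - g3) * a53 = G5 g1 g2 g4"
    using cleared(1,2) by (simp_all only: mult.commute)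
  note a43 = cleared(3) and a52 = cleared(4) and a32 = cleared(5) and a42 = cleared(6)
  have D2: "2 * g1 * a21 = g2^2 - g1 * g2" "2 * g1 * a31 = g3^2 - 2 * a32 * g2 - g1 * g3"
    "2 * g1 * a41 = g4^2 - 2 * a42 * g2 - 2 * a43 * g3 - g1 * g4"
    "2 * g1 * a51 = 1 - 2 * a52 * g2 - 2 * a53 * g3 - 2 * a54 * g4 - g1"
    using cleared(8,10,12,14) by (simp_all add: algebra_simps power2_eq_square)
  have D1: "2 * g1 * a20 = - (g1^2) + 3 * g1 * g2 - g2^2"
    "2 * g1 * a30 = - (g1^2) + (3 * g3 - 2 * a32) * g1 + 2 * a32 * g2 - g3^2"
    "2 * g1 * a40 = - (g1^2) + (3 * g4 - 2 * a42 - 2 * a43) * g1 + 2 * a42 * g2 + 2 * a43 * g3 - g4^2"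
    "2 * g1 * a50 = - (g1^2) + (3 - 2 * a52 - 2 * a53 - 2 * a54) * g1 + 2 * a52 * g2 + 2 * a53 * g3 + 2 * a54 * g4 - 1"
    using cleared(7,9,11,13) by (simp_all only: mult.commute mult.left_commute)
  have D1': "a20 + a21 + g1 / 2 = g2" "a30 + a31 + a32 + g1 / 2 = g3"
     "a40 + a41 + a42 + a43 + g1 / 2 = g4" "a50 + a51 + a52 + a53 + a54 + g1 / 2 = 1"
  proof -
    have "2 * g1 * (a20 + a21 + g1 / 2) = 2 * g1 * g2"
      "2 * g1 * (a30 + a31 + a32 + g1 / 2) = 2 * g1 * g3"
      "2 * g1 * (a40 + a41 + a42 + a43 + g1 / 2) = 2 * g1 * g4"
      "2 * g1 * (a50 + a51 + a52 + a53 + a54 + g1 / 2) = 2 * g1 * 1"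
      unfolding distrib_left right_diff_distrib D1 D2 by (simp_all add: algebra_simps power2_eq_square)
    then show "a20 + a21 + g1 / 2 = g2" "a30 + a31 + a32 + g1 / 2 = g3"
     "a40 + a41 + a42 + a43 + g1 / 2 = g4" "a50 + a51 + a52 + a53 + a54 + g1 / 2 = 1"
      using nz(1) by (simp_all only: mult_cancel_left) simp_all
  qed
  note chain = chain_products[OF nz(3,4) a54 a43 a32 a42]
  note X = quadrature_moments[OF nz(2) a54 a53]
  note expand = defect_def sum_expand gamma diag g[symmetric] a[symmetric]
  have M1: "a51 * g1 + a52 * g2 + a53 * g3 + a54 * g4 + g1 / 2 = 1 / 2"
    using D2(4) by (simp add: algebra_simps)
  have M2: "a51 * g1^2 + a52 * g2^2 + a53 * g3^2 + a54 * g4^2 + g1 / 2 = 1 / 3"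
  proof -
    have "6 * (a51 * g1^2 + a52 * g2^2 + a53 * g3^2 + a54 * g4^2 + g1 / 2)
      = 3 * g1 * (2 * g1 * a51) + a52 * (6 * g2 * (g2 - g1)) + 6 * a52 * g1 * g2 + 6 * a53 * g3^2 + 6 * a54 * g4^2 + 3 * g1"
      by (simp add: algebra_simps power2_eq_square)
    also have "\<dots> = 2"
      unfolding D2(4) a52 by (simp add: algebra_simps power2_eq_square)
    finally show ?thesis by simp
  qed
  note ring = algebra_simps diff_divide_distrib add_divide_distrib power2_eq_square power3_eq_cube power4_eq_xxxx
  have M3: "a51 * g1^3 + a52 * g2^3 + a53 * g3^3 + a54 * g4^3 + g1 / 2 = 1 / 4"
  proof -
    have "a51 * g1^3 + a52 * g2^3 + a53 * g3^3 + a54 * g4^3 + g1 / 2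
      = (a53 * (g3 * (g3 - g1) * (g3 - g2)) + a54 * (g4 * (g4 - g1) * (g4 - g2)) + g1 / 2 * (1 * (1 - g1) * (1 - g2)))
        + (g1 + g2) * (a51 * g1^2 + a52 * g2^2 + a53 * g3^2 + a54 * g4^2 + g1 / 2)
        - g1 * g2 * (a51 * g1 + a52 * g2 + a53 * g3 + a54 * g4 + g1 / 2)"
      by (simp add: ring)
    then show ?thesis unfolding X M1 M2 by (simp add: field_simps)
  qed
  have M4: "a51 * g1^4 + a52 * g2^4 + a53 * g3^4 + a54 * g4^4 + g1 / 2 = 1 / 5"
  proof -
    have "a51 * g1^4 + a52 * g2^4 + a53 * g3^4 + a54 * g4^4 + g1 / 2
      = (a53 * g3 * (g3 * (g3 - g1) * (g3 - g2)) + a54 * g4 * (g4 * (g4 - g1) * (g4 - g2)) + g1 / 2 * (1 * (1 - g1) * (1 - g2)))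
        + (g1 + g2) * (a51 * g1^3 + a52 * g2^3 + a53 * g3^3 + a54 * g4^3 + g1 / 2)
        - g1 * g2 * (a51 * g1^2 + a52 * g2^2 + a53 * g3^2 + a54 * g4^2 + g1 / 2)"
      by (simp add: ring)
    then show ?thesis unfolding X M2 M3 by (simp add: field_simps)
  qed
  define q where "q x = x * (x - g1)" for x
  define r where "r x = x * (x - g1) * (x - g2)" for x
  \<comment> \<open>\<open>(A c\<^sup>2)\<^sub>i\<close> for \<open>i = 2, 3, 4\<close>. Since \<open>c\<^sup>2 = q(c) + \<gamma>\<^sub>1 c\<close>, this is \<open>(A q(c))\<^sub>i\<close> plus a known term.\<close>
  define m2 m3 m4 where m: "m2 = a21 * g1^2 + g1/2 * g2^2" "m3 = a31 * g1^2 + a32 * g2^2 + g1/2 * g3^2"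
    "m4 = a41 * g1^2 + a42 * g2^2 + a43 * g3^2 + g1/2 * g4^2"
  have mq: "m2 = g1/2 * q g2 + g1/2 * g2^2" "m3 = a32 * q g2 + g1/2 * q g3 + g1/2 * g3^2"
    "m4 = a42 * q g2 + a43 * q g3 + g1/2 * q g4 + g1/2 * g4^2"
  proof -
    have e: "a21 * g1^2 = g1 / 2 * (2 * g1 * a21)" "a31 * g1^2 = g1 / 2 * (2 * g1 * a31)"
      "a41 * g1^2 = g1 / 2 * (2 * g1 * a41)" by (simp_all add: power2_eq_square)
    show "m2 = g1/2 * q g2 + g1/2 * g2^2" "m3 = a32 * q g2 + g1/2 * q g3 + g1/2 * g3^2"
      "m4 = a42 * q g2 + a43 * q g3 + g1/2 * q g4 + g1/2 * g4^2"
      unfolding m e D2 by (simp_all add: q_def ring)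
  qed
  have bq: "a52 * q g2 + a53 * q g3 + a54 * q g4 = 1/3 - g1/2 - g1/2 * q 1"
  proof -
    have "a52 * q g2 + a53 * q g3 + a54 * q g4 =
      (a51 * g1^2 + a52 * g2^2 + a53 * g3^2 + a54 * g4^2 + g1 / 2)
      - g1 * (a51 * g1 + a52 * g2 + a53 * g3 + a54 * g4 + g1 / 2) - g1 / 2 * q 1"
      by (simp add: q_def ring)
    then show ?thesis unfolding M1 M2 by (simp add: q_def field_simps)
  qed
  have chain': "a54 * (a42 * q g2 + a43 * q g3) + a53 * a32 * q g2 = (1 - 6 * g1 + 9 * g1^2 - 3 * g1^3) / 12"
    "a54 * a43 * a32 * q g2 = (15 * g1^4 - 60 * g1^3 + 60 * g1^2 - 20 * g1 + 2) / 120"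
    using chain(2,3) by (simp_all add: q_def)
  \<comment> \<open>The condition \<open>b A c\<^sup>2 = 1/12\<close>; the last summand is \<open>\<alpha>\<^sub>5\<^sub>5 (A c\<^sup>2)\<^sub>5 = \<alpha>\<^sub>5\<^sub>5 b c\<^sup>2\<close>.\<close>
  have N2: "a51 * (g1/2 * g1^2) + a52 * m2 + a53 * m3 + a54 * m4 + g1 / 2 * (1/3) = 1 / 12"
  proof -
    have "a51 * (g1/2 * g1^2) + a52 * m2 + a53 * m3 + a54 * m4 + g1 / 2 * (1/3)
      = (a54 * (a42 * q g2 + a43 * q g3) + a53 * a32 * q g2)
        + g1/2 * (a52 * q g2 + a53 * q g3 + a54 * q g4)
        + g1/2 * (a51 * g1^2 + a52 * g2^2 + a53 * g3^2 + a54 * g4^2 + g1 / 2) + g1/6 - g1^2/4"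
      unfolding mq by (simp add: ring)
    then show ?thesis unfolding chain' bq M2 by (simp add: q_def field_simps power2_eq_square power3_eq_cube)
  qed
  \<comment> \<open>The condition \<open>b A c\<^sup>3 = 1/20\<close>, with \<open>n2\<close>, \<open>n3\<close>, \<open>n4\<close> the entries of \<open>A c\<^sup>3\<close>.\<close>
  define n2 n3 n4 where n: "n2 = a21 * g1^3 + g1/2 * g2^3" "n3 = a31 * g1^3 + a32 * g2^3 + g1/2 * g3^3"
    "n4 = a41 * g1^3 + a42 * g2^3 + a43 * g3^3 + g1/2 * g4^3"
  have nr: "n2 = (g1 + g2) * m2 - g1 * g2 * (g2^2 / 2)"
    "n3 = g1/2 * r g3 + (g1 + g2) * m3 - g1 * g2 * (g3^2 / 2)"
    "n4 = a43 * r g3 + g1/2 * r g4 + (g1 + g2) * m4 - g1 * g2 * (g4^2 / 2)"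
  proof -
    have e: "a21 * g1 = (2 * g1 * a21) / 2" "a31 * g1 = (2 * g1 * a31) / 2" "a41 * g1 = (2 * g1 * a41) / 2"
      by simp_all
    have m': "g2 ^ 2 / 2 = a21 * g1 + g1/2 * g2" "g3^2/2 = a31 * g1 + a32 * g2 + g1/2 * g3"
      "g4 ^ 2 / 2 = a41 * g1 + a42 * g2 + a43 * g3 + g1/2 * g4"
      unfolding e D2 by (simp_all add: field_simps)
    show "n2 = (g1 + g2) * m2 - g1 * g2 * (g2^2 / 2)"
    "n3 = g1/2 * r g3 + (g1 + g2) * m3 - g1 * g2 * (g3^2 / 2)"
    "n4 = a43 * r g3 + g1/2 * r g4 + (g1 + g2) * m4 - g1 * g2 * (g4^2 / 2)"
      unfolding n m m' by (simp_all add: r_def ring)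
  qed
  have N3: "a51 * (g1/2 * g1^3) + a52 * n2 + a53 * n3 + a54 * n4 + g1 / 2 * (1/4) = 1 / 20"
  proof -
    have K: "a54 * a43 * r g3 = (15 * g1^3 * g2 - 15 * g1^3 - 45 * g1^2 * g2 + 35 * g1^2 + 30 * g1 * g2 - 20 * g1 - 5 * g2 + 3) / 60"
      using chain(1) by (simp add: r_def)
    have "a51 * (g1/2 * g1^3) + a52 * n2 + a53 * n3 + a54 * n4 + g1 / 2 * (1/4)
     = a54 * a43 * r g3 + g1/2 * (a53 * r g3 + a54 * r g4 + g1 / 2 * r 1) - g1/2 * (g1 / 2 * r 1)
       + (g1 + g2) * (a51 * (g1/2 * g1^2) + a52 * m2 + a53 * m3 + a54 * m4 + g1 / 2 * (1/3))
       - g1 * g2 / 2 * (a51 * g1^2 + a52 * g2^2 + a53 * g3^2 + a54 * g4^2 + g1 / 2)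
       + g1/8 - (g1+g2) * g1 / 6 + g1^2 * g2 / 4"
      unfolding nr by (simp add: ring)
    then show ?thesis
      unfolding K X(1)[folded r_def] N2 M2 by (simp add: r_def field_simps power2_eq_square power3_eq_cube)
  qed
  \<comment> \<open>The condition \<open>b A\<^sup>2 c\<^sup>2 = 1/60\<close>, with \<open>p2\<close>, \<open>p3\<close>, \<open>p4\<close> the entries of \<open>A\<^sup>2 c\<^sup>2\<close>.\<close>
  define p2 p3 p4 where p: "p2 = a21 * (g1/2 * g1^2) + g1/2 * m2" "p3 = a31 * (g1/2 * g1^2) + a32 * m2 + g1/2 * m3"
    "p4 = a41 * (g1/2 * g1^2) + a42 * m2 + a43 * m3 + g1/2 * m4"
  have pq: "p2 = g1/2 * (g1/2 * q g2) + g1/2 * m2"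
    "p3 = a32 * (g1/2 * q g2) + g1/2 * (a32 * q g2 + g1/2 * q g3) + g1/2 * m3"
    "p4 = a42 * (g1/2 * q g2) + a43 * (a32 * q g2 + g1/2 * q g3) + g1/2 * (a42 * q g2 + a43 * q g3 + g1/2 * q g4) + g1/2 * m4"
  proof -
    have e: "m2 = g1/2 * q g2 + g1/2 * g2^2" "m3 = (a32 * q g2 + g1/2 * q g3) + g1/2 * g3^2"
      "m4 = (a42 * q g2 + a43 * q g3 + g1/2 * q g4) + g1/2 * g4^2" using mq by simp_all
    have "p2 = g1/2 * m2 + g1/2 * (g1/2 * q g2)"
      unfolding p by (subst (2) m(1), subst e(1)) (simp add: ring)
    then show "p2 = g1/2 * (g1/2 * q g2) + g1/2 * m2" by simp
    have "p3 = g1/2 * m3 + a32 * (g1/2 * q g2) + g1/2 * (a32 * q g2 + g1/2 * q g3)"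
      unfolding p by (subst (2) m(2), subst e(1), subst e(2)) (simp add: ring)
    then show "p3 = a32 * (g1/2 * q g2) + g1/2 * (a32 * q g2 + g1/2 * q g3) + g1/2 * m3" by simp
    have "p4 = g1/2 * m4 + a42 * (g1/2 * q g2) + a43 * (a32 * q g2 + g1/2 * q g3) + g1/2 * (a42 * q g2 + a43 * q g3 + g1/2 * q g4)"
      unfolding p by (subst (2) m(3), subst e(1), subst e(2), subst e(3)) (simp add: ring)
    then show "p4 = a42 * (g1/2 * q g2) + a43 * (a32 * q g2 + g1/2 * q g3) + g1/2 * (a42 * q g2 + a43 * q g3 + g1/2 * q g4) + g1/2 * m4"
      by simp
  qed
  have N22: "a51 * (g1/2 * (g1/2 * g1^2)) + a52 * p2 + a53 * p3 + a54 * p4 + g1/2 * (1/12) = 1/60"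
  proof -
    have "a51 * (g1/2 * (g1/2 * g1^2)) + a52 * p2 + a53 * p3 + a54 * p4 + g1/2 * (1/12)
      = a54 * a43 * a32 * q g2 + g1 * (a54 * (a42 * q g2 + a43 * q g3) + a53 * a32 * q g2)
        + g1^2/4 * (a52 * q g2 + a53 * q g3 + a54 * q g4)
        + g1/2 * (a51 * (g1/2 * g1^2) + a52 * m2 + a53 * m3 + a54 * m4 + g1 / 2 * (1/3)) + g1/24 - g1^2/12"
      unfolding pq by (simp add: ring)
    then show ?thesis unfolding chain' bq N2 by (simp add: q_def field_simps power2_eq_square power3_eq_cube power4_eq_xxxx)
  qed
  have one: "\<gamma> 1 = g1" "\<gamma> (Suc 0) = g1" using g by simp_all
  have D: "defect \<alpha> \<gamma> 3 1 = - (g1^3 / 2)" "defect \<alpha> \<gamma> 3 2 = g2^3 - 3 * m2" "defect \<alpha> \<gamma> 3 3 = g3^3 - 3 * m3"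
    "defect \<alpha> \<gamma> 3 4 = g4^3 - 3 * m4" "defect \<alpha> \<gamma> 3 5 = 0"
    "defect \<alpha> \<gamma> 4 1 = - (g1^4)" "defect \<alpha> \<gamma> 4 2 = g2^4 - 4 * n2" "defect \<alpha> \<gamma> 4 3 = g3^4 - 4 * n3"
    "defect \<alpha> \<gamma> 4 4 = g4^4 - 4 * n4" "defect \<alpha> \<gamma> 4 5 = 0" "defect \<alpha> \<gamma> 5 5 = 0"
    using M2 M3 M4 unfolding expand m n by (simp_all add: power3_eq_cube power2_eq_square power4_eq_xxxx)
  show ?thesis
    unfolding order5_conditions_def ball_1_5 sum_expand D g[symmetric] a[symmetric] diag
  proof (intro conjI refl)
    show "defect \<alpha> \<gamma> 1 1 = 0" "defect \<alpha> \<gamma> 1 2 = 0" "defect \<alpha> \<gamma> 1 3 = 0" "defect \<alpha> \<gamma> 1 4 = 0" "defect \<alpha> \<gamma> 1 5 = 0"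
      using D1' unfolding expand by simp_all
    show "defect \<alpha> \<gamma> 2 1 = 0" "defect \<alpha> \<gamma> 2 2 = 0" "defect \<alpha> \<gamma> 2 3 = 0" "defect \<alpha> \<gamma> 2 4 = 0" "defect \<alpha> \<gamma> 2 5 = 0"
      using D2 M1 unfolding expand by (simp_all add: algebra_simps power2_eq_square)
    show "a51 * - (g1^3 / 2) + a52 * (g2^3 - 3 * m2) + a53 * (g3^3 - 3 * m3) + a54 * (g4^3 - 3 * m4) + g1 / 2 * 0 = 0"
      using N2 M3 by (simp add: algebra_simps power2_eq_square power3_eq_cube)
    show "a51 * - (g1^4) + a52 * (g2^4 - 4 * n2) + a53 * (g3^4 - 4 * n3) + a54 * (g4^4 - 4 * n4) + g1 / 2 * 0 = 0"
      using N3 M4 by (simp add: algebra_simps power4_eq_xxxx power3_eq_cube)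
    show "a51 * (g1 / 2 * - (g1^3 / 2)) + a52 * (a21 * - (g1^3 / 2) + g1 / 2 * (g2^3 - 3 * m2))
      + a53 * (a31 * - (g1^3 / 2) + a32 * (g2^3 - 3 * m2) + g1 / 2 * (g3^3 - 3 * m3))
      + a54 * (a41 * - (g1^3 / 2) + a42 * (g2^3 - 3 * m2) + a43 * (g3^3 - 3 * m3) + g1 / 2 * (g4^3 - 3 * m4))
      + g1 / 2 * (a51 * - (g1^3 / 2) + a52 * (g2^3 - 3 * m2) + a53 * (g3^3 - 3 * m3) + a54 * (g4^3 - 3 * m4) + g1 / 2 * 0) = 0"
      (is "?L = 0")
    proof -
      have "?L = (a51 * (g1/2 * g1^3) + a52 * n2 + a53 * n3 + a54 * n4 + g1 / 2 * (1/4))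
        - 3 * (a51 * (g1/2 * (g1/2 * g1^2)) + a52 * p2 + a53 * p3 + a54 * p4 + g1/2 * (1/12))
        + g1/2 * ((a51 * g1^3 + a52 * g2^3 + a53 * g3^3 + a54 * g4^3 + g1 / 2) - 1/4
          - 3 * (a51 * (g1/2 * g1^2) + a52 * m2 + a53 * m3 + a54 * m4 + g1 / 2 * (1/3)) + 3 * (1/12))"
        unfolding n p by (simp add: ring)
      then show ?thesis unfolding N3 N22 M3 N2 by simp
    qed
  qed
qed

section \<open>The stages for a scalar linear equation\<close>

text \<open>
  The stages of the Runge-Kutta method for the scalar equation \<open>w' = \<mu> w + F\<close>, where \<open>F j\<close> is the source at
  the node \<open>j\<close>. Only the rows \<open>1, \<dots>, s\<close> are constrained: \<open>w 0\<close> is the initial value, whatever \<open>\<alpha> 0 0\<close> is.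
\<close>

definition complex_stages ::
  "nat \<Rightarrow> (nat \<Rightarrow> nat \<Rightarrow> real) \<Rightarrow> complex \<Rightarrow> real \<Rightarrow> (nat \<Rightarrow> complex) \<Rightarrow> (nat \<Rightarrow> complex) \<Rightarrow> bool" where
  "complex_stages s \<alpha> \<mu> h F w \<longleftrightarrow>
     (\<forall>i\<in>{1..s}. w i = w 0 + of_real h * (\<Sum>j=0..i. of_real (\<alpha> i j) * (\<mu> * w j + F j)))"

text \<open>
  The scheme is diagonally implicit, so that each stage is one scalar linear equation for its own value.
\<close>

lemma complex_stages_exist:
  assumes "\<And>i. i \<in> {1..s} \<Longrightarrow> 1 - of_real h * of_real (\<alpha> i i) * \<mu> \<noteq> 0"
  shows "\<exists>w. w 0 = c \<and> complex_stages s \<alpha> \<mu> h F w"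
  using assms
proof (induction s)
  case 0
  show ?case by (intro exI[of _ "\<lambda>_. c"]) (simp add: complex_stages_def)
next
  case (Suc s)
  then obtain w where w: "w 0 = c" "complex_stages s \<alpha> \<mu> h F w"
    by force
  define d where "d = 1 - of_real h * of_real (\<alpha> (Suc s) (Suc s)) * \<mu>"
  define b where "b = (c + of_real h * (\<Sum>j=0..s. of_real (\<alpha> (Suc s) j) * (\<mu> * w j + F j))
      + of_real h * of_real (\<alpha> (Suc s) (Suc s)) * F (Suc s)) / d"
  define w' where "w' = w(Suc s := b)"
  have "d \<noteq> 0" using Suc.prems[of "Suc s"] by (simp add: d_def)
  then have b: "b = c + of_real h * (\<Sum>j=0..s. of_real (\<alpha> (Suc s) j) * (\<mu> * w j + F j))
      + of_real h * of_real (\<alpha> (Suc s) (Suc s)) * (\<mu> * b + F (Suc s))"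
  proof -
    assume "d \<noteq> 0"
    then have "b * d = c + of_real h * (\<Sum>j=0..s. of_real (\<alpha> (Suc s) j) * (\<mu> * w j + F j))
      + of_real h * of_real (\<alpha> (Suc s) (Suc s)) * F (Suc s)" by (simp add: b_def)
    moreover have "b * d = b - of_real h * of_real (\<alpha> (Suc s) (Suc s)) * \<mu> * b"
      by (simp add: d_def right_diff_distrib mult_ac)
    ultimately show ?thesis by (simp add: distrib_left mult_ac diff_eq_eq add_ac)
  qed
  have old: "w' j = w j" if "j \<le> s" for j using that by (simp add: w'_def)
  have "w' i = w' 0 + of_real h * (\<Sum>j=0..i. of_real (\<alpha> i j) * (\<mu> * w' j + F j))"
    if "i \<in> {1..Suc s}" for i
  proof (cases "i = Suc s")
    case False
    with that have "i \<in> {1..s}" by auto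
    then show ?thesis using w(2) by (simp add: complex_stages_def old)
  next
    case True
    have new: "w' (Suc s) = b" by (simp add: w'_def)
    have "(\<Sum>j=0..s. of_real (\<alpha> (Suc s) j) * (\<mu> * w' j + F j)) = (\<Sum>j=0..s. of_real (\<alpha> (Suc s) j) * (\<mu> * w j + F j))"
      by (rule sum.cong) (simp_all add: old)
    then have "w' 0 + of_real h * (\<Sum>j=0..Suc s. of_real (\<alpha> (Suc s) j) * (\<mu> * w' j + F j)) = b"
      by (subst b) (simp add: old w(1) new distrib_left mult.assoc add.assoc)
    then show ?thesis using new True by simp
  qed
  then show ?case using w(1) by (intro exI[of _ w']) (simp add: complex_stages_def old)
qed

lemma complex_stages_combine:
  assumes "complex_stages s \<alpha> \<mu> h F w" "complex_stages s \<alpha> \<mu> h F' w'"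
  shows "complex_stages s \<alpha> \<mu> h (\<lambda>j. a * F j + b * F' j) (\<lambda>j. a * w j + b * w' j)"
  unfolding complex_stages_def
proof
  fix i assume i: "i \<in> {1..s}"
  define S where "S = (\<Sum>j=0..i. of_real (\<alpha> i j) * (\<mu> * w j + F j))"
  define S' where "S' = (\<Sum>j=0..i. of_real (\<alpha> i j) * (\<mu> * w' j + F' j))"
  have "(\<Sum>j=0..i. of_real (\<alpha> i j) * (\<mu> * (a * w j + b * w' j) + (a * F j + b * F' j))) = a * S + b * S'"
    unfolding S_def S'_def sum_distrib_left sum.distrib[symmetric]
    by (rule sum.cong) (simp_all add: algebra_simps)
  moreover have "w i = w 0 + of_real h * S" "w' i = w' 0 + of_real h * S'"
    using assms i unfolding complex_stages_def S_def S'_def by blast+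
  ultimately show "a * w i + b * w' i = a * w 0 + b * w' 0 + of_real h *
      (\<Sum>j=0..i. of_real (\<alpha> i j) * (\<mu> * (a * w j + b * w' j) + (a * F j + b * F' j)))"
    by (simp add: algebra_simps)
qed

lemma complex_stages_unique:
  assumes "complex_stages s \<alpha> \<mu> h F w" "complex_stages s \<alpha> \<mu> h F w'" "w 0 = w' 0" "i \<le> s"
    and inv: "\<And>i. i \<in> {1..s} \<Longrightarrow> 1 - of_real h * of_real (\<alpha> i i) * \<mu> \<noteq> 0"
  shows "w i = w' i"
  using \<open>i \<le> s\<close>
proof (induction i rule: less_induct)
  case (less i)
  show ?case
  proof (cases "i = 0")
    case False
    then have i: "i \<in> {1..s}" and split: "{0..i} = insert i {0..<i}" using less.prems by auto
    define A where "A = w 0 + of_real h * (\<Sum>j=0..<i. of_real (\<alpha> i j) * (\<mu> * w j + F j)) + of_real h * of_real (\<alpha> i i) * F i"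
    have last: "(\<Sum>j=0..i. f j) = (\<Sum>j=0..<i. f j) + f i" for f :: "nat \<Rightarrow> complex"
      unfolding split by (subst sum.insert) (simp_all add: add.commute)
    have "w i = w 0 + of_real h * (\<Sum>j=0..i. of_real (\<alpha> i j) * (\<mu> * w j + F j))"
      using assms(1) i unfolding complex_stages_def by blast
    then have 1: "w i = A + of_real h * of_real (\<alpha> i i) * \<mu> * w i"
      unfolding A_def last by (simp add: algebra_simps)
    have "w' i = w' 0 + of_real h * (\<Sum>j=0..i. of_real (\<alpha> i j) * (\<mu> * w' j + F j))"
      using assms(2) i unfolding complex_stages_def by blast
    moreover have "(\<Sum>j=0..<i. of_real (\<alpha> i j) * (\<mu> * w' j + F j)) = (\<Sum>j=0..<i. of_real (\<alpha> i j) * (\<mu> * w j + F j))"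
      using less by (intro sum.cong) auto
    ultimately have 2: "w' i = A + of_real h * of_real (\<alpha> i i) * \<mu> * w' i"
      unfolding A_def last using assms(3) by (simp add: algebra_simps)
    have "(1 - of_real h * of_real (\<alpha> i i) * \<mu>) * (w i - w' i)
        = (w i - of_real h * of_real (\<alpha> i i) * \<mu> * w i) - (w' i - of_real h * of_real (\<alpha> i i) * \<mu> * w' i)"
      by (simp add: algebra_simps)
    also have "\<dots> = A - A" by (metis 1 2 add_diff_cancel_right')
    finally show ?thesis using inv[OF i] by simp
  qed (use assms in simp)
qed

text \<open>
  A Landau set relates functions with values in the same field, so the powers of the step size that bound complex errors
  are complex as well.
\<close>

abbreviation hpow :: "nat \<Rightarrow> real \<Rightarrow> complex" where "hpow n \<equiv> (\<lambda>h. of_real h ^ n)"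

lemma hpow_mono: "m \<le> n \<Longrightarrow> f \<in> O[at_right 0](hpow n) \<Longrightarrow> f \<in> O[at_right 0](hpow m)"
proof (erule landau_o.big_trans, rule bigoI[of _ 1])
  assume "m \<le> n"
  have "eventually (\<lambda>h::real. h \<in> {0<..<1}) (at_right 0)"
    by (rule eventually_at_right_real) simp
  then show "\<forall>\<^sub>F h in at_right 0. norm (hpow n h) \<le> 1 * norm (hpow m h)"
    by eventually_elim (use \<open>m \<le> n\<close> in \<open>auto simp: norm_power intro!: power_decreasing\<close>)
qed

lemma hpow_mult:
  assumes "f \<in> O[at_right 0](hpow m)"
  shows "(\<lambda>h. of_real h ^ k * c * f h) \<in> O[at_right 0](hpow (k + m))"
proof -
  have "(\<lambda>h. (of_real h ^ k * c) * f h) \<in> O[at_right 0](\<lambda>h. hpow k h * hpow m h)"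
    by (intro landau_o.big.mult assms) (cases "c = 0", auto)
  then show ?thesis by (simp add: power_add)
qed

lemma cmult_in_hpow: "f \<in> O[F](g) \<Longrightarrow> (\<lambda>h. c * f h) \<in> O[F](g)" for c :: complex
  by (cases "c = 0") auto

lemma hpow_monom: "k \<ge> m \<Longrightarrow> (\<lambda>h. c * of_real h ^ k) \<in> O[at_right 0](hpow m)"
  by (rule hpow_mono[of _ k]) (cases "c = 0", auto)

lemma exp_taylor_remainder:
  "(\<lambda>h. exp (\<kappa> * of_real (c * h)) - (\<Sum>k<6. (\<kappa> * of_real c) ^ k / fact k * of_real h ^ k)) \<in> O[at_right 0](hpow 6)"
proof (rule bigoI[of _ "exp (norm (\<kappa> * of_real c)) * norm (\<kappa> * of_real c) ^ 6 / fact 5"])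
  have "eventually (\<lambda>h::real. h \<in> {0<..<1}) (at_right 0)"
    by (rule eventually_at_right_real) simp
  then show "\<forall>\<^sub>F h in at_right 0. norm (exp (\<kappa> * of_real (c * h)) - (\<Sum>k<6. (\<kappa> * of_real c) ^ k / fact k * of_real h ^ k))
     \<le> exp (norm (\<kappa> * of_real c)) * norm (\<kappa> * of_real c) ^ 6 / fact 5 * norm (hpow 6 h)"
  proof eventually_elim
    case (elim h)
    define z where "z = \<kappa> * of_real (c * h)"
    have s: "{..<6::nat} = {..5}" by auto
    have "norm (exp z - (\<Sum>k\<le>5. z ^ k / fact k)) \<le> exp \<bar>Re z\<bar> * norm z ^ 6 / fact 5"
      using Taylor_exp[of z 5] by simp
    also have "(\<Sum>k\<le>5. z ^ k / fact k) = (\<Sum>k<6. (\<kappa> * of_real c) ^ k / fact k * of_real h ^ k)"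
      unfolding s by (simp add: z_def power_mult_distrib mult_ac)
    also have "exp \<bar>Re z\<bar> * norm z ^ 6 / fact 5 \<le> exp (norm (\<kappa> * of_real c)) * norm z ^ 6 / fact 5"
    proof -
      have "\<bar>Re z\<bar> \<le> norm z" by (rule abs_Re_le_cmod)
      also have "norm z = norm (\<kappa> * of_real c) * h" using elim by (simp add: z_def norm_mult)
      also have "\<dots> \<le> norm (\<kappa> * of_real c) * 1" using elim by (intro mult_left_mono) auto
      finally show ?thesis by (intro divide_right_mono mult_right_mono) auto
    qed
    also have "\<dots> = exp (norm (\<kappa> * of_real c)) * norm (\<kappa> * of_real c) ^ 6 / fact 5 * norm (hpow 6 h)"
      using elim by (simp add: z_def norm_mult norm_power power_mult_distrib)
    finally show ?case by (simp add: z_def)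
  qed
qed

section \<open>Accuracy\<close>

text \<open>
  Taylor expansion of the local error of stage \<open>i\<close> on the solution \<open>exp (\<kappa> t)\<close>: the terms of order one and two
  vanish by the two hypotheses, and the remaining ones up to order five are given by the defects.
\<close>

lemma stage_defect_expansion:
  assumes "defect \<alpha> \<gamma> 1 i = 0" "defect \<alpha> \<gamma> 2 i = 0"
  shows "(\<lambda>h. (exp (\<kappa> * of_real (\<gamma> i * h)) - 1
             - of_real h * (\<Sum>j=0..i. of_real (\<alpha> i j) * (\<kappa> * exp (\<kappa> * of_real (\<gamma> j * h)))))
           - (\<Sum>k=3..5. \<kappa> ^ k / fact k * of_real (defect \<alpha> \<gamma> k i) * of_real h ^ k)) \<in> O[at_right 0](hpow 6)"
proof -
  define T where "T c h = (\<Sum>k<6. (\<kappa> * of_real c) ^ k / fact k * of_real h ^ k)" for c h :: real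
  define R where "R c h = exp (\<kappa> * of_real (c * h)) - T c h" for c h :: real
  have R: "R c \<in> O[at_right 0](hpow 6)" for c
    using exp_taylor_remainder unfolding R_def T_def .
  define m where "m k = (\<Sum>j=0..i. \<alpha> i j * \<gamma> j ^ k)" for k
  have mom: "of_real (m k) = (\<Sum>j=0..i. complex_of_real (\<alpha> i j) * of_real (\<gamma> j) ^ k)" for k
    by (simp add: m_def)
  have six: "{..<6} = {0,1,2,3,4,5::nat}" and three: "{3..5} = {3,4,5::nat}" by auto
  have T: "T c h = 1 + \<kappa> * of_real c * of_real h + \<kappa>^2 / 2 * of_real c^2 * of_real h^2
      + \<kappa>^3 / 6 * of_real c^3 * of_real h^3 + \<kappa>^4 / 24 * of_real c^4 * of_real h^4
      + \<kappa>^5 / 120 * of_real c^5 * of_real h^5" for c h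
    unfolding T_def six by (simp add: power_mult_distrib fact_numeral)
  have sumT: "(\<Sum>j=0..i. of_real (\<alpha> i j) * (\<kappa> * T (\<gamma> j) h)) =
      \<kappa> * of_real (m 0) + \<kappa>^2 * of_real (m 1) * of_real h + \<kappa>^3 / 2 * of_real (m 2) * of_real h^2
      + \<kappa>^4 / 6 * of_real (m 3) * of_real h^3 + \<kappa>^5 / 24 * of_real (m 4) * of_real h^4
      + \<kappa>^6 / 120 * of_real (m 5) * of_real h^5" for h
    unfolding mom T sum_distrib_left sum_distrib_right sum.distrib[symmetric]
    by (rule sum.cong) (simp_all add: algebra_simps eval_nat_numeral)
  have d: "\<gamma> i = m 0" "\<gamma> i ^ 2 = 2 * m 1" using assms by (simp_all add: defect_def m_def)
  have dk: "of_real (defect \<alpha> \<gamma> 3 i) = (of_real (\<gamma> i) ^ 3 - 3 * of_real (m 2) :: complex)"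
     "of_real (defect \<alpha> \<gamma> 4 i) = (of_real (\<gamma> i) ^ 4 - 4 * of_real (m 3) :: complex)"
     "of_real (defect \<alpha> \<gamma> 5 i) = (of_real (\<gamma> i) ^ 5 - 5 * of_real (m 4) :: complex)"
    by (simp_all add: defect_def m_def)
  have d': "complex_of_real (\<gamma> i) ^ 2 = 2 * of_real (m 1)" "complex_of_real (\<gamma> i) = of_real (m 0)"
    using d(2) d(1) by (simp_all flip: of_real_power)
  have key: "T (\<gamma> i) h - 1 - of_real h * (\<Sum>j=0..i. of_real (\<alpha> i j) * (\<kappa> * T (\<gamma> j) h))
        - (\<Sum>k=3..5. \<kappa> ^ k / fact k * of_real (defect \<alpha> \<gamma> k i) * of_real h ^ k)
      = - (\<kappa>^6 / 120 * of_real (m 5)) * of_real h^6" for h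
  proof -
    define y where "y = complex_of_real (\<gamma> i)"
    define x where "x = complex_of_real h"
    have s3: "(\<Sum>k=3..5. \<kappa> ^ k / fact k * of_real (defect \<alpha> \<gamma> k i) * of_real h ^ k) =
       \<kappa>^3 / 6 * (y ^ 3 - 3 * of_real (m 2)) * x ^ 3 + \<kappa>^4 / 24 * (y ^ 4 - 4 * of_real (m 3)) * x ^ 4
       + \<kappa>^5 / 120 * (y ^ 5 - 5 * of_real (m 4)) * x ^ 5"
      unfolding three y_def x_def by (simp add: dk fact_numeral)
    have y2: "y ^ 2 = 2 * of_real (m 1)" and m0: "of_real (m 0) = y"
      using d' by (simp_all add: y_def)
    show ?thesis
      unfolding s3 sumT unfolding T m0 by (fold y_def x_def, unfold y2) (simp add: field_simps eval_nat_numeral)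
  qed
  have "(\<lambda>h. R (\<gamma> i) h - of_real h ^ 1 * \<kappa> * (\<Sum>j=0..i. of_real (\<alpha> i j) * R (\<gamma> j) h)
      + (- (\<kappa>^6 / 120 * of_real (m 5))) * of_real h ^ 6) \<in> O[at_right 0](hpow 6)"
  proof (intro sum_in_bigo R hpow_monom)
    have "(\<lambda>h. \<Sum>j=0..i. of_real (\<alpha> i j) * R (\<gamma> j) h) \<in> O[at_right 0](hpow 6)"
      by (intro big_sum_in_bigo cmult_in_hpow R)
    then show "(\<lambda>h. of_real h ^ 1 * \<kappa> * (\<Sum>j=0..i. of_real (\<alpha> i j) * R (\<gamma> j) h)) \<in> O[at_right 0](hpow 6)"
      by (intro hpow_mono[OF _ hpow_mult]) auto
  qed simp
  also have "(\<lambda>h. R (\<gamma> i) h - of_real h ^ 1 * \<kappa> * (\<Sum>j=0..i. of_real (\<alpha> i j) * R (\<gamma> j) h)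
      + (- (\<kappa>^6 / 120 * of_real (m 5))) * of_real h ^ 6) = 
    (\<lambda>h. (exp (\<kappa> * of_real (\<gamma> i * h)) - 1
             - of_real h * (\<Sum>j=0..i. of_real (\<alpha> i j) * (\<kappa> * exp (\<kappa> * of_real (\<gamma> j * h)))))
           - (\<Sum>k=3..5. \<kappa> ^ k / fact k * of_real (defect \<alpha> \<gamma> k i) * of_real h ^ k))"
  proof
    fix h :: real
    have "(\<Sum>j=0..i. of_real (\<alpha> i j) * (\<kappa> * exp (\<kappa> * of_real (\<gamma> j * h)))) =
      (\<Sum>j=0..i. of_real (\<alpha> i j) * (\<kappa> * T (\<gamma> j) h)) + \<kappa> * (\<Sum>j=0..i. of_real (\<alpha> i j) * R (\<gamma> j) h)"
      unfolding R_def sum_distrib_left sum.distrib[symmetric]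
      by (rule sum.cong) (simp_all add: algebra_simps)
    then show "R (\<gamma> i) h - of_real h ^ 1 * \<kappa> * (\<Sum>j=0..i. of_real (\<alpha> i j) * R (\<gamma> j) h)
      + (- (\<kappa>^6 / 120 * of_real (m 5))) * of_real h ^ 6 =
     (exp (\<kappa> * of_real (\<gamma> i * h)) - 1
             - of_real h * (\<Sum>j=0..i. of_real (\<alpha> i j) * (\<kappa> * exp (\<kappa> * of_real (\<gamma> j * h)))))
           - (\<Sum>k=3..5. \<kappa> ^ k / fact k * of_real (defect \<alpha> \<gamma> k i) * of_real h ^ k)"
      unfolding key[symmetric] by (simp add: R_def algebra_simps)
  qed
  finally show ?thesis .
qed

text \<open>
  The source \<open>(\<kappa> - \<mu>) exp (\<kappa> t)\<close> is the one for which \<open>exp (\<kappa> t)\<close> solves \<open>w' = \<mu> w + F\<close> with initial value one.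
  The free parameter \<open>\<kappa>\<close> makes one statement cover the homogeneous equation (\<open>\<kappa> = \<mu>\<close>), the load \<open>exp\<close>
  (\<open>\<kappa> = 1\<close>) and the identification of the stability function (\<open>\<kappa> = \<mu> = 1\<close>).
\<close>

lemma scheme_accuracy:
  fixes w :: "real \<Rightarrow> nat \<Rightarrow> complex"
  assumes cond: "order5_conditions \<alpha> \<gamma>" and \<gamma>: "\<gamma> 0 = 0" "\<gamma> 5 = 1"
    and st: "\<forall>\<^sub>F h in at_right 0. w h 0 = 1 \<and>
      complex_stages 5 \<alpha> \<mu> h (\<lambda>j. (\<kappa> - \<mu>) * exp (\<kappa> * of_real (\<gamma> j * h))) (w h)"
  shows "(\<lambda>h. w h 5 - exp (\<kappa> * of_real h)) \<in> O[at_right 0](hpow 6)"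
proof -
  define e where "e h i = w h i - exp (\<kappa> * of_real (\<gamma> i * h))" for h i
  define \<delta> where "\<delta> h i = exp (\<kappa> * of_real (\<gamma> i * h)) - 1
      - of_real h * (\<Sum>j=0..i. of_real (\<alpha> i j) * (\<kappa> * exp (\<kappa> * of_real (\<gamma> j * h))))" for h i
  define d where "d k i = complex_of_real (defect \<alpha> \<gamma> k i)" for k i
  define \<rho> where "\<rho> h i = \<delta> h i - (\<Sum>k=3..5. \<kappa> ^ k / fact k * d k i * of_real h ^ k)" for h i
  have \<rho>: "(\<lambda>h. \<rho> h i) \<in> O[at_right 0](hpow 6)" if "i \<in> {1..5}" for i
    unfolding \<rho>_def \<delta>_def d_def
    by (rule stage_defect_expansion) (use cond that in \<open>auto simp: order5_conditions_def\<close>)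
  have three: "{3..5} = {3,4,5::nat}" by auto
  have \<delta>: "\<delta> h i = (\<kappa>^3 / 6 * d 3 i) * of_real h ^ 3 + (\<kappa>^4 / 24 * d 4 i) * of_real h ^ 4
      + (\<kappa>^5 / 120 * d 5 i) * of_real h ^ 5 + \<rho> h i" for h i
    unfolding \<rho>_def three by (simp add: fact_numeral)
  have \<delta>3: "(\<lambda>h. \<delta> h i) \<in> O[at_right 0](hpow 3)" if "i \<in> {1..5}" for i
    unfolding \<delta> by (intro sum_in_bigo hpow_monom hpow_mono[OF _ \<rho>[OF that]]) auto
  \<comment> \<open>The exact solution satisfies the stage equations up to the local errors \<open>\<delta>\<close>; subtract the two.\<close>
  have rec: "\<forall>\<^sub>F h in at_right 0. \<forall>i\<in>{1..5}. e h i = of_real h * \<mu> * (\<Sum>j=1..i. of_real (\<alpha> i j) * e h j) - \<delta> h i"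
    using st
  proof eventually_elim
    case (elim h)
    have e0: "e h 0 = 0" using elim by (simp add: e_def \<gamma>)
    show ?case
    proof
      fix i :: nat assume i: "i \<in> {1..5}"
      have "w h i = 1 + of_real h * (\<Sum>j=0..i. of_real (\<alpha> i j) * (\<mu> * w h j + (\<kappa> - \<mu>) * exp (\<kappa> * of_real (\<gamma> j * h))))"
        using elim i unfolding complex_stages_def by auto
      also have "(\<Sum>j=0..i. of_real (\<alpha> i j) * (\<mu> * w h j + (\<kappa> - \<mu>) * exp (\<kappa> * of_real (\<gamma> j * h))))
        = \<mu> * (\<Sum>j=0..i. of_real (\<alpha> i j) * e h j) + (\<Sum>j=0..i. of_real (\<alpha> i j) * (\<kappa> * exp (\<kappa> * of_real (\<gamma> j * h))))"
        unfolding e_def sum_distrib_left sum.distrib[symmetric]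
        by (rule sum.cong) (simp_all add: algebra_simps)
      also have "(\<Sum>j=0..i. of_real (\<alpha> i j) * e h j) = (\<Sum>j=1..i. of_real (\<alpha> i j) * e h j)"
        by (simp add: sum.atLeast_Suc_atMost e0)
      finally show "e h i = of_real h * \<mu> * (\<Sum>j=1..i. of_real (\<alpha> i j) * e h j) - \<delta> h i"
        by (simp add: e_def \<delta>_def algebra_simps)
    qed
  qed
  have e3: "(\<lambda>h. e h i) \<in> O[at_right 0](hpow 3)" if "i \<in> {1..5}" for i
    using that
  proof (induction i rule: less_induct)
    case (less i)
    define D where "D h = 1 - of_real h * \<mu> * of_real (\<alpha> i i)" for h
    have "(D \<longlongrightarrow> 1 - of_real 0 * \<mu> * of_real (\<alpha> i i)) (at_right 0)"
      unfolding D_def by (intro tendsto_intros)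
    then have D: "(D \<longlongrightarrow> 1) (at_right 0)" by simp
    then have ne: "\<forall>\<^sub>F h in at_right 0. D h \<noteq> 0"
      by (rule tendsto_imp_eventually_ne) simp
    have "((\<lambda>h. inverse (D h)) \<longlongrightarrow> inverse 1) (at_right 0)"
      using D by (intro tendsto_inverse) auto
    then have inv: "(\<lambda>h. inverse (D h)) \<in> O[at_right 0](\<lambda>_. 1)"
      by (intro bigoI_tendsto[where c = "inverse 1"]) auto
    have split: "{1..i} = insert i {1..<i}" using less.prems by auto
    have "(\<lambda>h. of_real h ^ 1 * \<mu> * (\<Sum>j=1..<i. of_real (\<alpha> i j) * e h j) - \<delta> h i) \<in> O[at_right 0](hpow 3)"
    proof (intro sum_in_bigo \<delta>3 less.prems)
      have "(\<lambda>h. \<Sum>j=1..<i. of_real (\<alpha> i j) * e h j) \<in> O[at_right 0](hpow 3)"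
        by (intro big_sum_in_bigo cmult_in_hpow less.IH) (use less.prems in auto)
      then show "(\<lambda>h. of_real h ^ 1 * \<mu> * (\<Sum>j=1..<i. of_real (\<alpha> i j) * e h j)) \<in> O[at_right 0](hpow 3)"
        by (intro hpow_mono[OF _ hpow_mult]) auto
    qed
    with inv have "(\<lambda>h. inverse (D h) * (of_real h ^ 1 * \<mu> * (\<Sum>j=1..<i. of_real (\<alpha> i j) * e h j) - \<delta> h i)) \<in> O[at_right 0](\<lambda>h. 1 * hpow 3 h)"
      by (rule landau_o.big.mult)
    moreover have "\<forall>\<^sub>F h in at_right 0. e h i = inverse (D h) * (of_real h ^ 1 * \<mu> * (\<Sum>j=1..<i. of_real (\<alpha> i j) * e h j) - \<delta> h i)"
      using rec ne
    proof eventually_elim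
      case (elim h)
      have "(\<Sum>j=1..i. of_real (\<alpha> i j) * e h j) = of_real (\<alpha> i i) * e h i + (\<Sum>j=1..<i. of_real (\<alpha> i j) * e h j)"
        unfolding split by simp
      with elim(1) less.prems have "D h * e h i = of_real h ^ 1 * \<mu> * (\<Sum>j=1..<i. of_real (\<alpha> i j) * e h j) - \<delta> h i"
        by (auto simp: D_def algebra_simps)
      with elim(2) show ?case by (simp add: field_simps)
    qed
    ultimately show ?case by (simp add: landau_o.big.in_cong)
  qed
  define S :: "(nat \<Rightarrow> complex) \<Rightarrow> nat \<Rightarrow> complex" where "S f i = (\<Sum>j=1..i. of_real (\<alpha> i j) * f j)" for f i
  have S_lin: "S (\<lambda>j. a * f j + g j) i = a * S f i + S g i" for a f g i
    unfolding S_def sum_distrib_left sum.distrib[symmetric]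
    by (rule sum.cong) (simp_all add: algebra_simps)
  have S_cong: "S f i = S g i" if "\<And>j. j \<in> {1..5} \<Longrightarrow> f j = g j" "i \<in> {1..5}" for f g i
    unfolding S_def by (rule sum.cong) (use that in auto)
  have S_O: "(\<lambda>h. S (f h) i) \<in> O[at_right 0](hpow n)"
    if "\<And>j. j \<in> {1..5} \<Longrightarrow> (\<lambda>h. f h j) \<in> O[at_right 0](hpow n)" "i \<in> {1..5}" for f i n
    unfolding S_def by (intro big_sum_in_bigo cmult_in_hpow that(1)) (use that(2) in auto)
  have c: "d 3 5 = 0" "d 4 5 = 0" "d 5 5 = 0" "S (d 3) 5 = 0" "S (d 4) 5 = 0" "S (S (d 3)) 5 = 0"
  proof -
    show "d 3 5 = 0" "d 4 5 = 0" "d 5 5 = 0"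
      using cond by (simp_all add: order5_conditions_def d_def)
    have Sd: "S (d k) = (\<lambda>i. of_real (\<Sum>j=1..i. \<alpha> i j * defect \<alpha> \<gamma> k j))" for k
      by (rule ext) (simp add: S_def d_def)
    have Sr: "S (\<lambda>i. of_real (f i)) 5 = of_real (\<Sum>i=1..5. \<alpha> 5 i * f i)" for f
      by (simp add: S_def)
    show "S (d 3) 5 = 0" "S (d 4) 5 = 0" "S (S (d 3)) 5 = 0"
      using cond unfolding Sd Sr of_real_eq_0_iff by (simp_all only: order5_conditions_def)
  qed
  have S\<delta>: "S (\<delta> h) i = (\<kappa>^3 / 6 * of_real h ^ 3) * S (d 3) i + ((\<kappa>^4 / 24 * of_real h ^ 4) * S (d 4) i
      + ((\<kappa>^5 / 120 * of_real h ^ 5) * S (d 5) i + S (\<rho> h) i))" for h i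
  proof -
    have "\<delta> h = (\<lambda>i. (\<kappa>^3 / 6 * of_real h ^ 3) * d 3 i + ((\<kappa>^4 / 24 * of_real h ^ 4) * d 4 i
      + ((\<kappa>^5 / 120 * of_real h ^ 5) * d 5 i + \<rho> h i)))"
      by (rule ext) (simp add: \<delta> algebra_simps)
    then show ?thesis by (simp only: S_lin)
  qed
  have SS\<delta>: "S (S (\<delta> h)) i = (\<kappa>^3 / 6 * of_real h ^ 3) * S (S (d 3)) i + ((\<kappa>^4 / 24 * of_real h ^ 4) * S (S (d 4)) i
      + ((\<kappa>^5 / 120 * of_real h ^ 5) * S (S (d 5)) i + S (S (\<rho> h)) i))" for h i
  proof -
    have "S (\<delta> h) = (\<lambda>i. (\<kappa>^3 / 6 * of_real h ^ 3) * S (d 3) i + ((\<kappa>^4 / 24 * of_real h ^ 4) * S (d 4) i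
      + ((\<kappa>^5 / 120 * of_real h ^ 5) * S (d 5) i + S (\<rho> h) i)))"
      by (rule ext) (rule S\<delta>)
    then show ?thesis by (simp only: S_lin)
  qed
  have S\<rho>: "(\<lambda>h. S (\<rho> h) i) \<in> O[at_right 0](hpow 6)" "(\<lambda>h. S (S (\<rho> h)) i) \<in> O[at_right 0](hpow 6)" if "i \<in> {1..5}" for i
    by (rule S_O[OF \<rho> that], assumption, rule S_O[OF S_O[OF \<rho>] that], assumption+)
  have "(\<lambda>h. - \<delta> h 5 - of_real h ^ 1 * \<mu> * S (\<delta> h) 5 - of_real h ^ 2 * \<mu> ^ 2 * S (S (\<delta> h)) 5
      + of_real h ^ 3 * \<mu> ^ 3 * S (S (S (e h))) 5) \<in> O[at_right 0](hpow 6)"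
  proof (intro sum_in_bigo)
    show "(\<lambda>h. - \<delta> h 5) \<in> O[at_right 0](hpow 6)"
      unfolding \<delta> c using \<rho>[of 5] by simp
    have "(\<lambda>h. S (\<delta> h) 5) \<in> O[at_right 0](hpow 5)"
    proof -
      have "(\<lambda>h. (\<kappa>^5 / 120 * S (d 5) 5) * of_real h ^ 5 + S (\<rho> h) 5) \<in> O[at_right 0](hpow 5)"
        by (intro sum_in_bigo hpow_monom hpow_mono[OF _ S\<rho>(1)]) auto
      then show ?thesis unfolding S\<delta> c by (simp add: mult_ac)
    qed
    then show "(\<lambda>h. of_real h ^ 1 * \<mu> * S (\<delta> h) 5) \<in> O[at_right 0](hpow 6)"
      by (intro hpow_mono[OF _ hpow_mult]) auto
    have "(\<lambda>h. S (S (\<delta> h)) 5) \<in> O[at_right 0](hpow 4)"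
    proof -
      have "(\<lambda>h. (\<kappa>^4 / 24 * S (S (d 4)) 5) * of_real h ^ 4 + ((\<kappa>^5 / 120 * S (S (d 5)) 5) * of_real h ^ 5
          + S (S (\<rho> h)) 5)) \<in> O[at_right 0](hpow 4)"
        by (intro sum_in_bigo hpow_monom hpow_mono[OF _ S\<rho>(2)]) auto
      then show ?thesis unfolding SS\<delta> c by (simp add: mult_ac)
    qed
    then show "(\<lambda>h. of_real h ^ 2 * \<mu>^2 * S (S (\<delta> h)) 5) \<in> O[at_right 0](hpow 6)"
      by (intro hpow_mono[OF _ hpow_mult]) auto
    have "(\<lambda>h. S (S (S (e h))) 5) \<in> O[at_right 0](hpow 3)"
      by (rule S_O[OF S_O[OF S_O[OF e3]]]) auto
    then show "(\<lambda>h. of_real h ^ 3 * \<mu>^3 * S (S (S (e h))) 5) \<in> O[at_right 0](hpow 6)"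
      by (intro hpow_mono[OF _ hpow_mult]) auto
  qed
  moreover have "\<forall>\<^sub>F h in at_right 0. w h 5 - exp (\<kappa> * of_real h) =
     - \<delta> h 5 - of_real h ^ 1 * \<mu> * S (\<delta> h) 5 - of_real h ^ 2 * \<mu> ^ 2 * S (S (\<delta> h)) 5
      + of_real h ^ 3 * \<mu> ^ 3 * S (S (S (e h))) 5"
    using rec
  proof eventually_elim
    case (elim h)
    define z where "z = of_real h * \<mu>"
    have r: "e h i = z * S (e h) i + (- \<delta> h i)" if "i \<in> {1..5}" for i
      using bspec[OF elim that] unfolding z_def S_def by (simp only: diff_conv_add_uminus)
    have Sneg: "S (\<lambda>i. - f i) i = - S f i" for f i
      using S_lin[of "-1" f "\<lambda>_. 0" i] by (simp add: S_def sum_negf)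
    have r1: "S (e h) i = z * S (S (e h)) i + (- S (\<delta> h) i)" if "i \<in> {1..5}" for i
      by (rule S_cong[OF r that, THEN trans], assumption) (simp only: S_lin Sneg)
    have r2: "S (S (e h)) 5 = z * S (S (S (e h))) 5 + (- S (S (\<delta> h)) 5)"
      by (rule S_cong[OF r1, THEN trans], assumption) (simp_all only: S_lin Sneg, simp)
    have "e h 5 = z * (z * (z * S (S (S (e h))) 5 + (- S (S (\<delta> h)) 5)) + (- S (\<delta> h) 5)) + (- \<delta> h 5)"
      unfolding r2[symmetric] using r1[of 5] r[of 5] by (simp only: atLeastAtMost_iff) simp
    then show ?case
      by (simp add: e_def \<gamma> z_def algebra_simps power2_eq_square power3_eq_cube)
  qed
  ultimately show ?thesis by (simp add: landau_o.big.in_cong)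
qed

section \<open>The stability function\<close>

text \<open>
  Each stage adds one division by \<open>1 - g z\<close> with \<open>z = h \<mu>\<close>, because all diagonal coefficients agree, and one
  multiplication of the preceding stages by \<open>z\<close>.
\<close>

lemma complex_stages_polynomial:
  fixes g :: real
  assumes "\<And>i. i \<in> {1..s} \<Longrightarrow> \<alpha> i i = g"
  shows "\<exists>p :: nat \<Rightarrow> complex poly. \<forall>i\<le>s. degree (p i) \<le> i \<and>
    (\<forall>\<mu> h w. complex_stages s \<alpha> \<mu> h (\<lambda>_. 0) w \<longrightarrow> w 0 = 1 \<longrightarrow>
      (1 - of_real g * (of_real h * \<mu>)) ^ i * w i = poly (p i) (of_real h * \<mu>))"
  using assms
proof (induction s)
  case 0
  show ?case by (intro exI[of _ "\<lambda>_. 1"]) simp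
next
  case (Suc s)
  then obtain p :: "nat \<Rightarrow> complex poly" where p: "\<And>i. i \<le> s \<Longrightarrow> degree (p i) \<le> i"
    "\<And>i \<mu> h w. i \<le> s \<Longrightarrow> complex_stages s \<alpha> \<mu> h (\<lambda>_. 0) w \<Longrightarrow> w 0 = 1 \<Longrightarrow>
      (1 - of_real g * (of_real h * \<mu>)) ^ i * w i = poly (p i) (of_real h * \<mu>)"
    by (metis (no_types, lifting) atLeastAtMost_iff le_SucI)
  define D where "D = [:1, - complex_of_real g:]"
  define P where "P = D ^ s + [:0, 1:] * (\<Sum>j=0..s. Polynomial.smult (of_real (\<alpha> (Suc s) j)) (D ^ (s - j) * p j))"
  have degD: "degree (D ^ k) \<le> k" for k
    by (rule order.trans[OF degree_power_le]) (simp add: D_def)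
  have "degree (D ^ (s - j) * p j) \<le> s" if "j \<le> s" for j
    using order.trans[OF degree_mult_le add_mono[OF degD p(1)[OF that]], of "s - j"] that by simp
  then have "degree (\<Sum>j=0..s. Polynomial.smult (of_real (\<alpha> (Suc s) j)) (D ^ (s - j) * p j)) \<le> s"
    by (intro degree_sum_le) (auto intro: order.trans[OF degree_smult_le])
  then have "degree ([:0, 1:] * (\<Sum>j=0..s. Polynomial.smult (of_real (\<alpha> (Suc s) j)) (D ^ (s - j) * p j))) \<le> Suc s"
    by (intro order.trans[OF degree_mult_le]) simp
  then have degP: "degree P \<le> Suc s"
    unfolding P_def by (intro degree_add_le) (auto intro: order.trans[OF degD])
  define p' where "p' = p(Suc s := P)"
  have "degree (p' i) \<le> i \<and> (\<forall>\<mu> h w. complex_stages (Suc s) \<alpha> \<mu> h (\<lambda>_. 0) w \<longrightarrow> w 0 = 1 \<longrightarrow>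
      (1 - of_real g * (of_real h * \<mu>)) ^ i * w i = poly (p' i) (of_real h * \<mu>))" if "i \<le> Suc s" for i
  proof (intro conjI allI impI)
    show "degree (p' i) \<le> i" using degP p(1) that by (auto simp: p'_def)
    fix \<mu> h w assume w: "complex_stages (Suc s) \<alpha> \<mu> h (\<lambda>_. 0) w" "w 0 = (1::complex)"
    have w': "complex_stages s \<alpha> \<mu> h (\<lambda>_. 0) w" using w(1) by (simp add: complex_stages_def)
    define z where "z = of_real h * \<mu>"
    define d where "d = 1 - of_real g * z"
    have dz: "poly D z = d" by (simp add: D_def d_def)
    show "(1 - of_real g * (of_real h * \<mu>)) ^ i * w i = poly (p' i) (of_real h * \<mu>)"
    proof (cases "i = Suc s")
      case False
      then show ?thesis using p(2)[OF _ w' w(2)] that by (simp add: p'_def)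
    next
      case True
      have "w (Suc s) = 1 + of_real h * (\<Sum>j=0..Suc s. of_real (\<alpha> (Suc s) j) * (\<mu> * w j + 0))"
        using w unfolding complex_stages_def by (metis atLeastAtMost_iff le_refl le_add1 plus_1_eq_Suc)
      also have "of_real h * (\<Sum>j=0..Suc s. of_real (\<alpha> (Suc s) j) * (\<mu> * w j + 0))
         = (\<Sum>j=0..Suc s. z * (of_real (\<alpha> (Suc s) j) * w j))"
        unfolding sum_distrib_left by (rule sum.cong) (simp_all add: z_def mult_ac)
      also have "\<dots> = z * (\<Sum>j=0..s. of_real (\<alpha> (Suc s) j) * w j) + of_real g * z * w (Suc s)"
        using Suc.prems[of "Suc s"] by (simp add: sum_distrib_left mult_ac)
      finally have "d * w (Suc s) = 1 + z * (\<Sum>j=0..s. of_real (\<alpha> (Suc s) j) * w j)"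
        by (simp add: d_def algebra_simps)
      note dw = this
      have "d ^ Suc s * w (Suc s) = d ^ s * (d * w (Suc s))" by simp
      also have "\<dots> = d ^ s + z * (\<Sum>j=0..s. of_real (\<alpha> (Suc s) j) * (d ^ s * w j))"
        unfolding dw by (simp add: distrib_left sum_distrib_left mult_ac)
      also have "(\<Sum>j=0..s. of_real (\<alpha> (Suc s) j) * (d ^ s * w j))
         = (\<Sum>j=0..s. of_real (\<alpha> (Suc s) j) * (d ^ (s - j) * poly (p j) z))"
      proof (rule sum.cong[OF refl])
        fix j assume j: "j \<in> {0..s}"
        then have "d ^ s = d ^ (s - j) * d ^ j" by (simp flip: power_add)
        moreover have "d ^ j * w j = poly (p j) z"
          using p(2)[OF _ w' w(2), of j] j by (simp add: d_def z_def)
        ultimately show "of_real (\<alpha> (Suc s) j) * (d ^ s * w j) = of_real (\<alpha> (Suc s) j) * (d ^ (s - j) * poly (p j) z)"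
          by (simp add: mult.assoc)
      qed
      finally show ?thesis
        using True by (simp add: p'_def P_def poly_sum dz flip: z_def d_def)
    qed
  qed
  then show ?case by blast
qed

text \<open>
  The lowest nonvanishing term would dominate; it is removed one power at a time.
\<close>

lemma poly_bigo_eq_0:
  assumes "degree p < n" "(\<lambda>h. poly p (of_real h)) \<in> O[at_right 0](hpow n)"
  shows "p = 0"
  using assms
proof (induction n arbitrary: p)
  case (Suc n)
  obtain a q where p: "p = pCons a q" by (cases p)
  obtain c where c: "\<forall>\<^sub>F h in at_right 0. norm (poly p (of_real h)) \<le> c * norm (hpow (Suc n) h)"
    using landau_o.bigE[OF Suc.prems(2)] by blast
  have pos: "\<forall>\<^sub>F h::real in at_right 0. h > 0" by (simp add: eventually_at_right_less)
  have "((\<lambda>h. poly p (of_real h)) \<longlongrightarrow> poly p (of_real 0)) (at_right 0)"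
    by (intro tendsto_intros)
  moreover have "((\<lambda>h. poly p (of_real h)) \<longlongrightarrow> 0) (at_right 0)"
  proof (rule Lim_null_comparison[OF c])
    have "((\<lambda>h. c * norm (hpow (Suc n) h)) \<longlongrightarrow> c * norm (hpow (Suc n) 0)) (at_right 0)"
      by (intro tendsto_intros)
    then show "((\<lambda>h. c * norm (hpow (Suc n) h)) \<longlongrightarrow> 0) (at_right 0)" by simp
  qed
  ultimately have "poly p (of_real 0) = 0" by (intro tendsto_unique[of "at_right (0::real)"]) auto
  then have a: "a = 0" by (simp add: p)
  show ?case
  proof (cases "q = 0")
    case False
    have "(\<lambda>h. poly q (of_real h)) \<in> O[at_right 0](hpow n)"
    proof (rule bigoI)
      show "\<forall>\<^sub>F h in at_right 0. norm (poly q (of_real h)) \<le> c * norm (hpow n h)"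
        using c pos by eventually_elim (simp add: p a norm_mult norm_power mult.left_commute)
    qed
    moreover have "degree q < n" using Suc.prems(1) False by (simp add: p)
    ultimately show ?thesis using Suc.IH False by blast
  qed (simp add: p a)
qed simp


text \<open>
  The Taylor coefficients of \<open>exp z (1 - g z)^5\<close> at \<open>0\<close>, as a Cauchy product.
\<close>

definition num_coeff :: "real \<Rightarrow> nat \<Rightarrow> real" where
  "num_coeff g k = (\<Sum>j\<le>k. (- g) ^ j * real (5 choose j) / fact (k - j))"

definition num_poly :: "real \<Rightarrow> complex poly" where
  "num_poly g = (\<Sum>k\<le>5. Polynomial.monom (of_real (num_coeff g k)) k)"

lemma num_coeff_simps:
  "num_coeff g 0 = 1" "num_coeff g 1 = 1 - 5 * g" "num_coeff g 2 = 1/2 - 5 * g + 10 * g^2"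
  "num_coeff g 3 = 1/6 - 5/2 * g + 10 * g^2 - 10 * g^3"
  "num_coeff g 4 = 1/24 - 5/6 * g + 5 * g^2 - 10 * g^3 + 5 * g^4"
  "num_coeff g 5 = 1/120 - 5/24 * g + 5/3 * g^2 - 5 * g^3 + 5 * g^4 - g^5"
proof -
  have b: "5 choose 0 = (1::nat)" "5 choose Suc 0 = (5::nat)" "5 choose 2 = (10::nat)" "5 choose 3 = (10::nat)"
    "5 choose 4 = (5::nat)" "5 choose 5 = (1::nat)"
    by (simp_all add: eval_nat_numeral)
  have s: "{..0::nat} = {0}" "{..1} = {0,1::nat}" "{..2} = {0,1,2::nat}" "{..3} = {0,1,2,3::nat}"
    "{..4} = {0,1,2,3,4::nat}" "{..5} = {0,1,2,3,4,5::nat}" by auto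
  show "num_coeff g 0 = 1" "num_coeff g 1 = 1 - 5 * g" "num_coeff g 2 = 1/2 - 5 * g + 10 * g^2"
    "num_coeff g 3 = 1/6 - 5/2 * g + 10 * g^2 - 10 * g^3"
    "num_coeff g 4 = 1/24 - 5/6 * g + 5 * g^2 - 10 * g^3 + 5 * g^4"
    "num_coeff g 5 = 1/120 - 5/24 * g + 5/3 * g^2 - 5 * g^3 + 5 * g^4 - g^5"
    unfolding num_coeff_def s by (simp_all add: b fact_numeral)
qed

lemma poly_num_poly:
  "poly (num_poly g) z = of_real (num_coeff g 0) + of_real (num_coeff g 1) * z + of_real (num_coeff g 2) * z^2
     + of_real (num_coeff g 3) * z^3 + of_real (num_coeff g 4) * z^4 + of_real (num_coeff g 5) * z^5"
proof -
  have "{..5} = {0,1,2,3,4,5::nat}" by auto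
  then show ?thesis by (simp add: num_poly_def poly_monom poly_sum)
qed

lemma num_poly_approximates:
  "(\<lambda>h. (1 - of_real g * of_real h) ^ 5 * exp (of_real h) - poly (num_poly g) (of_real h)) \<in> O[at_right 0](hpow 6)"
proof -
  define E where "E h = (\<Sum>k<6. (of_real h :: complex) ^ k / fact k)" for h :: real
  \<comment> \<open>The terms of order six to ten of \<open>(1 - g h)^5\<close> times the Taylor polynomial of \<open>exp\<close>, divided by \<open>h^6\<close>.\<close>
  define r where "r h = complex_of_real (10 * g^2 / 24 - 5 * g / 120 - 10 * g^3 / 6 + 5 * g^4 / 2 - g^5
    + h * (10 * g^2 / 120 - 10 * g^3 / 24 + 5 * g^4 / 6 - g^5 / 2) + h^2 * (5 * g^4 / 24 - 10 * g^3 / 120 - g^5 / 6)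
    + h^3 * (5 * g^4 / 120 - g^5 / 24) - h^4 * (g^5 / 120))" for h
  have six: "{..<6} = {0,1,2,3,4,5::nat}" by auto
  have poly: "(1 - of_real g * of_real h) ^ 5 * E h - poly (num_poly g) (of_real h) = r h * of_real h ^ 6" for h
  proof -
    have "(1 - g * h) ^ 5 * (1 + h + h^2/2 + h^3/6 + h^4/24 + h^5/120) -
       (num_coeff g 0 + num_coeff g 1 * h + num_coeff g 2 * h^2
     + num_coeff g 3 * h^3 + num_coeff g 4 * h^4 + num_coeff g 5 * h^5) = 
       (10 * g^2 / 24 - 5 * g / 120 - 10 * g^3 / 6 + 5 * g^4 / 2 - g^5
    + h * (10 * g^2 / 120 - 10 * g^3 / 24 + 5 * g^4 / 6 - g^5 / 2) + h^2 * (5 * g^4 / 24 - 10 * g^3 / 120 - g^5 / 6)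
    + h^3 * (5 * g^4 / 120 - g^5 / 24) - h^4 * (g^5 / 120)) * h ^ 6"
      unfolding num_coeff_simps by (simp add: field_simps eval_nat_numeral)
    from this[THEN arg_cong[of _ _ complex_of_real]] show ?thesis
      unfolding poly_num_poly r_def E_def six by (simp add: fact_numeral add.assoc)
  qed
  have r: "r \<in> O[at_right 0](\<lambda>_. 1)"
    by (rule bigoI_tendsto[where c = "r 0"]) (auto simp: r_def intro!: tendsto_eq_intros)
  have q: "(\<lambda>h. (1 - complex_of_real g * of_real h) ^ 5) \<in> O[at_right 0](\<lambda>_. 1)"
    by (rule bigoI_tendsto[where c = 1]) (auto intro!: tendsto_eq_intros)
  have e: "(\<lambda>h. exp (of_real h) - E h) \<in> O[at_right 0](hpow 6)"
    using exp_taylor_remainder[of 1 1] by (simp add: E_def)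
  have "(\<lambda>h. (1 - complex_of_real g * of_real h) ^ 5 * (exp (of_real h) - E h) + r h * of_real h ^ 6) \<in> O[at_right 0](hpow 6)"
    using landau_o.big.mult[OF q e] landau_o.big.mult[OF r landau_o.big_refl] by (intro sum_in_bigo) simp_all
  also have "(\<lambda>h. (1 - complex_of_real g * of_real h) ^ 5 * (exp (of_real h) - E h) + r h * of_real h ^ 6)
     = (\<lambda>h. (1 - of_real g * of_real h) ^ 5 * exp (of_real h) - poly (num_poly g) (of_real h))"
    unfolding poly[symmetric] by (simp add: algebra_simps)
  finally show ?thesis .
qed

text \<open>
  The order of accuracy determines the numerator of the stability function: it has degree at most five, and
  order five fixes its coefficients up to degree five. It is enough to compare both sides along the ray of positive
  real \<open>z\<close>, that is for \<open>\<mu> = 1\<close>. So the individual coefficients of the method are never needed.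
\<close>

lemma stability_function:
  fixes g :: real
  assumes cond: "order5_conditions \<alpha> \<gamma>" and \<gamma>: "\<gamma> 0 = 0" "\<gamma> 5 = 1"
    and diag: "\<And>i. i \<in> {1..5} \<Longrightarrow> \<alpha> i i = g"
    and w: "complex_stages 5 \<alpha> \<mu> h (\<lambda>_. 0) w" "w 0 = 1"
  shows "(1 - of_real g * (of_real h * \<mu>)) ^ 5 * w 5 = poly (num_poly g) (of_real h * \<mu>)"
proof -
  obtain p :: "complex poly" where p: "degree p \<le> 5"
    "\<And>\<mu> h w. complex_stages 5 \<alpha> \<mu> h (\<lambda>_. 0) w \<Longrightarrow> w 0 = 1 \<Longrightarrow>
      (1 - of_real g * (of_real h * \<mu>)) ^ 5 * w 5 = poly p (of_real h * \<mu>)"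
    using complex_stages_polynomial[of 5 \<alpha> g, OF diag] by blast
  have "((\<lambda>h. 1 - complex_of_real h * of_real g * 1) \<longlongrightarrow> 1 - of_real 0 * of_real g * 1) (at_right 0)"
    by (intro tendsto_intros)
  then have ne: "\<forall>\<^sub>F h in at_right 0. 1 - complex_of_real h * of_real g * 1 \<noteq> 0"
    by (rule tendsto_imp_eventually_ne) simp
  define W where "W h = (SOME w. w 0 = 1 \<and> complex_stages 5 \<alpha> 1 h (\<lambda>_. 0) w)" for h
  have W: "\<forall>\<^sub>F h in at_right 0. W h 0 = 1 \<and> complex_stages 5 \<alpha> 1 h (\<lambda>_. 0) (W h)"
    using ne
  proof eventually_elim
    case (elim h)
    then have "\<exists>w. w 0 = 1 \<and> complex_stages 5 \<alpha> 1 h (\<lambda>_. 0) w"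
      by (intro complex_stages_exist) (simp add: diag)
    then show ?case unfolding W_def by (rule someI_ex)
  qed
  have "(\<lambda>h. W h 5 - exp (1 * of_real h)) \<in> O[at_right 0](hpow 6)"
    using scheme_accuracy[OF cond \<gamma>, of W 1 1] W by simp
  moreover have "(\<lambda>h. (1 - complex_of_real g * of_real h) ^ 5) \<in> O[at_right 0](\<lambda>_. 1)"
    by (rule bigoI_tendsto[where c = 1]) (auto intro!: tendsto_eq_intros)
  ultimately have "(\<lambda>h. (1 - of_real g * of_real h) ^ 5 * (W h 5 - exp (of_real h))) \<in> O[at_right 0](hpow 6)"
    using landau_o.big.mult[of "\<lambda>h. (1 - of_real g * of_real h) ^ 5" _ "\<lambda>_. 1"] by fastforce
  from sum_in_bigo(1)[OF this num_poly_approximates[of g]]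
  have "(\<lambda>h. (1 - of_real g * of_real h) ^ 5 * W h 5 - poly (num_poly g) (of_real h)) \<in> O[at_right 0](hpow 6)"
    by (simp add: algebra_simps)
  moreover have "\<forall>\<^sub>F h in at_right 0. (1 - of_real g * of_real h) ^ 5 * W h 5 - poly (num_poly g) (of_real h) = poly (p - num_poly g) (of_real h)"
    using W by eventually_elim (use p(2)[of 1] in simp)
  ultimately have "(\<lambda>h. poly (p - num_poly g) (of_real h)) \<in> O[at_right 0](hpow 6)"
    by (simp add: landau_o.big.in_cong)
  moreover have "degree (p - num_poly g) < 6"
  proof -
    have "degree (num_poly g) \<le> 5" unfolding num_poly_def
      by (intro degree_sum_le) (auto intro: order.trans[OF degree_monom_le])
    then have "degree (p - num_poly g) \<le> 5" by (rule degree_diff_le[OF p(1)])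
    then show ?thesis by linarith
  qed
  ultimately have "p = num_poly g" using poly_bigo_eq_0 by fastforce
  then show ?thesis using p(2)[OF w] by simp
qed

section \<open>Sign analysis of the stability gap\<close>

text \<open>
  A homogeneous form \<open>\<Sum> c\<^sub>i u^i v^(n-i)\<close>. A polynomial on an interval \<open>[a, b]\<close> becomes such a form in
  \<open>u = x - a\<close> and \<open>v = b - x\<close> (up to scaling, which keeps the coefficients integral), and its sign is
  evident if all coefficients have the same sign. All the sign certificates below have this shape; on a
  half-line \<open>v = 1\<close> is used instead.
\<close>

fun bernstein :: "real list \<Rightarrow> real \<Rightarrow> real \<Rightarrow> real" where
  "bernstein [] u v = 0"
| "bernstein (c # cs) u v = c * v ^ length cs + u * bernstein cs u v"

lemma bernstein_nonneg:
  "(\<forall>c\<in>set cs. 0 \<le> c) \<Longrightarrow> 0 \<le> u \<Longrightarrow> 0 \<le> v \<Longrightarrow> 0 \<le> bernstein cs u v"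
  by (induction cs) auto

lemma bernstein_pos:
  assumes "\<forall>c\<in>set cs. 0 < c" "cs \<noteq> []" "0 \<le> u" "0 \<le> v" "0 < u + v"
  shows "0 < bernstein cs u v"
  using assms(1,2)
proof (induction cs)
  case (Cons c cs)
  have nn: "0 \<le> bernstein cs u v"
    using Cons.prems assms(3,4) by (intro bernstein_nonneg) (auto intro: less_imp_le)
  show ?case
  proof (cases "cs = [] \<or> v > 0")
    case True
    then have "0 < c * v ^ length cs" using Cons.prems by auto
    then show ?thesis using mult_nonneg_nonneg[OF assms(3) nn] by simp
  next
    case False
    then have "0 < u * bernstein cs u v" using Cons assms(4,5) by auto
    then show ?thesis using False Cons.prems assms(4) by (simp add: add_nonneg_pos)
  qed
qed simp

text \<open>
  With \<open>x = \<gamma>\<^sub>1\<close> these two polynomials are \<open>15 x^5 (1 + R_inf x)\<close> and \<open>15 x^5 (1 - R_inf x)\<close>.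
\<close>

definition R_plus :: "real \<Rightarrow> real" where "R_plus x = 30 * x^5 - 150 * x^4 + 300 * x^3 - 200 * x^2 + 50 * x - 4"
definition R_minus :: "real \<Rightarrow> real" where "R_minus x = 150 * x^4 - 300 * x^3 + 200 * x^2 - 50 * x + 4"
text \<open>
  Up to a constant factor, \<open>gap6\<close> and \<open>gap8\<close> are the coefficients of \<open>y^6\<close> and \<open>y^8\<close> in
  \<open>|1 - g i y|^10 - |(1 - g i y)^5 R(i y)|^2\<close>, and the coefficient of \<open>y^10\<close> is \<open>g^10 (1 - R_inf^2)\<close>, with
  \<open>g = x/2\<close>. Thus \<open>gap\<close> is this difference divided by \<open>y^6\<close>, as a function of \<open>Y = y^2\<close>. The lower powers
  cancel because the method has order five.
\<close>

definition gap6 :: "real \<Rightarrow> real" where "gap6 x = 45 * x^5 - 225 * x^4 + 300 * x^3 - 150 * x^2 + 30 * x - 2"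
definition gap8 :: "real \<Rightarrow> real" where
  "gap8 x = 3 - 60 * x + 470 * x^2 - 1860 * x^3 + 3975 * x^4 - 4530 * x^5 + 2475 * x^6 - 450 * x^7"
definition gap :: "real \<Rightarrow> real \<Rightarrow> real" where
  "gap x Y = gap6 x / 720 + gap8 x / 2880 * Y + R_plus x * R_minus x / 230400 * Y^2"

lemmas bernstein_expand = R_plus_def R_minus_def gap6_def gap8_def gap_def field_simps eval_nat_numeral

lemma R_plus_neg_left:
  fixes x :: real
  assumes "0 \<le> x" "x \<le> 3/19"
  shows "R_plus x < 0"
proof -
  have "601692057/2 * (- R_plus x) = bernstein [4952198, 14986915, 16598780, 7934780, 1375315, 953] (19 * x - 0) (3 - 19 * x)"
    by (simp add: bernstein_expand)
  also have "\<dots> > 0"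
    using assms by (intro bernstein_pos) auto
  finally show ?thesis by simp
qed

lemma R_plus_pos_left:
  fixes x :: real
  assumes "4/25 \<le> x" "x \<le> 7/25"
  shows "R_plus x > 0"
proof -
  have "474609375/2 * R_plus x = bernstein [13322, 849505, 2170580, 1905140, 604435, 34421] (25 * x - 4) (7 - 25 * x)"
    by (simp add: bernstein_expand)
  also have "\<dots> > 0"
    using assms by (intro bernstein_pos) auto
  finally show ?thesis by simp
qed

lemma R_plus_neg_middle:
  fixes x :: real
  assumes "2/5 \<le> x" "x \<le> 49/100"
  shows "R_plus x < 0"
proof -
  have "59049000000000 * (- R_plus x) = bernstein [332800000, 1714400000, 3244480000, 2696308000, 858680900, 25075753] (100 * x - 40) (49 - 100 * x)"
    by (simp add: bernstein_expand)
  also have "\<dots> > 0"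
    using assms by (intro bernstein_pos) auto
  finally show ?thesis by simp
qed

lemma R_plus_pos_right:
  fixes x :: real
  assumes "1/2 \<le> x" "x \<le> 1"
  shows "R_plus x > 0"
proof -
  have "16 * R_plus x = bernstein [1, 80, 560, 1360, 1280, 416] (2 * x - 1) (2 - 2 * x)"
    by (simp add: bernstein_expand)
  also have "\<dots> > 0"
    using assms by (intro bernstein_pos) auto
  finally show ?thesis by simp
qed

lemma R_plus_deriv_pos:
  fixes x :: real
  assumes "9/20 \<le> x" "x \<le> 17/20"
  shows "(150 * x^4 - 600 * x^3 + 900 * x^2 - 400 * x + 50) > 0"
proof -
  have "13107200 * (150 * x^4 - 600 * x^3 + 900 * x^2 - 400 * x + 50) = bernstein [11923, 175916, 595602, 643564, 224243] (20 * x - 9) (17 - 20 * x)"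
    by (simp add: bernstein_expand)
  also have "\<dots> > 0"
    using assms by (intro bernstein_pos) auto
  finally show ?thesis by simp
qed

lemma gap6_neg_left:
  fixes x :: real
  assumes "4/15 \<le> x" "x \<le> 2/5"
  shows "gap6 x < 0"
proof -
  have "270000 * (- gap6 x) = bernstein [463, 4485, 12930, 14670, 6615, 837] (15 * x - 4) (6 - 15 * x)"
    by (simp add: bernstein_expand)
  also have "\<dots> > 0"
    using assms by (intro bernstein_pos) auto
  finally show ?thesis by simp
qed

lemma gap6_pos:
  fixes x :: real
  assumes "10/21 \<le> x" "x \<le> 19/21"
  shows "gap6 x > 0"
proof -
  have "26795786661 * gap6 x = bernstein [90122, 1542040, 7020590, 11763050, 6377605, 478472] (21 * x - 10) (19 - 21 * x)"
    by (simp add: bernstein_expand)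
  also have "\<dots> > 0"
    using assms by (intro bernstein_pos) auto
  finally show ?thesis by simp
qed

lemma gap6_deriv_neg:
  fixes x :: real
  assumes "9/10 \<le> x" "x \<le> 1"
  shows "(225 * x^4 - 900 * x^3 + 900 * x^2 - 300 * x + 30) < 0"
proof -
  have "400/3 * (- (225 * x^4 - 900 * x^3 + 900 * x^2 - 300 * x + 30)) = bernstein [2597, 13200, 24600, 20000, 6000] (10 * x - 9) (10 - 10 * x)"
    by (simp add: bernstein_expand)
  also have "\<dots> > 0"
    using assms by (intro bernstein_pos) auto
  finally show ?thesis by simp
qed

lemma gap6_neg_right:
  fixes x :: real
  assumes "19/20 \<le> x" "x \<le> 3"
  shows "gap6 x < 0"
proof -
  have "74147968640000 * (- gap6 x) = bernstein [68009, 41174200, 507092000, 2095760000, 2961760000, 289280000] (20 * x - 19) (60 - 20 * x)"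
    by (simp add: bernstein_expand)
  also have "\<dots> > 0"
    using assms by (intro bernstein_pos) auto
  finally show ?thesis by simp
qed

lemma gap8_pos:
  fixes x :: real
  assumes "25/51 \<le> x" "x \<le> 49/51"
  shows "gap8 x > 0"
proof -
  have "457327603284009025536 * gap8 x = bernstein [1486684117, 86032586659, 615499175577, 1528238933135, 1321978220255, 793694162217, 2170770447859, 1472445274597] (51 * x - 25) (49 - 51 * x)"
    by (simp add: bernstein_expand)
  also have "\<dots> > 0"
    using assms by (intro bernstein_pos) auto
  finally show ?thesis by simp
qed

text \<open>
  Near \<open>x = 0.158\<close> there is a tiny interval, between a zero of \<open>1 + R_inf\<close> and a zero of \<open>1 - R_inf\<close>, on which the
  constant and the leading coefficient of the gap are both positive. Only the middle coefficient violates
  stability there, and \<open>Y = 100\<close> shows it: the leading coefficient is still negligible at this \<open>Y\<close>.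
\<close>

lemma gap_100_neg:
  fixes x :: real
  assumes "3/19 \<le> x" "x \<le> 4/19"
  shows "gap x 100 < 0"
proof -
  have "232335142400880 * (- gap x 100) = bernstein [104710002883, 1225486269817, 6822982779223, 20946014127557, 38466836108128, 44222060619963, 32181142758237, 14427121009203, 3641596032527, 396585513833] (19 * x - 3) (4 - 19 * x)"
    by (simp add: bernstein_expand)
  also have "\<dots> > 0"
    using assms by (intro bernstein_pos) auto
  finally show ?thesis by simp
qed

text \<open>
  For large \<open>x\<close> the constant and the leading coefficient are again both positive. With \<open>Y = s/x^2\<close> the three
  terms of the gap have the same growth \<open>x^5\<close>, and \<open>s = 1\<close> lies in the range where their sum is negative
  from \<open>x = 3\<close> on.
\<close>

lemma gap_inverse_square_neg:
  fixes x :: real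
  assumes "3 \<le> x"
  shows "gap x (1 / x^2) < 0"
proof -
  have x: "x > 0" using assms by simp
  have "57600 * (- (gap6 x / 720 * x^4 + gap8 x / 2880 * x^2 + R_plus x * R_minus x / 230400)) = bernstein [1541584, 14510495, 36438230, 45258520, 33219685, 15428820, 4607175, 860700, 91800, 4275] (x - 3) 1"
    by (simp add: bernstein_expand)
  also have "\<dots> > 0"
    using assms by (intro bernstein_pos) auto
  finally have "0 < - (gap6 x / 720 * x^4 + gap8 x / 2880 * x^2 + R_plus x * R_minus x / 230400)"
    by (rule zero_less_mult_pos) simp
  then have "gap6 x / 720 * x^4 + gap8 x / 2880 * x^2 + R_plus x * R_minus x / 230400 < 0"
    by (simp only: neg_0_less_iff_less)
  moreover have "gap6 x / 720 * x^4 + gap8 x / 2880 * x^2 + R_plus x * R_minus x / 230400 = gap x (1 / x^2) * x^4"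
    using x by (simp add: gap_def field_simps eval_nat_numeral)
  ultimately show ?thesis
    using x by (simp add: mult_less_0_iff)
qed

text \<open>
  The value \<open>Y = 0\<close> is left out since the gap is multiplied by \<open>Y^3\<close> in \<open>gap_identity\<close>.
\<close>

definition gap_nonneg :: "real \<Rightarrow> bool" where
  "gap_nonneg x \<longleftrightarrow> (\<forall>Y>0. gap x Y \<ge> 0)"

lemma not_gap_nonneg_P6:
  assumes "gap6 x < 0" shows "\<not> gap_nonneg x"
proof -
  have "(gap x \<longlongrightarrow> gap6 x / 720 + gap8 x / 2880 * 0 + R_plus x * R_minus x / 230400 * 0^2) (at_right 0)"
    unfolding gap_def by (intro tendsto_intros)
  then have "\<forall>\<^sub>F Y in at_right 0. gap x Y < 0"
    by (rule order_tendstoD(2)) (use assms in simp)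
  moreover have "\<forall>\<^sub>F Y::real in at_right 0. Y > 0" by (simp add: eventually_at_right_less)
  ultimately have "\<forall>\<^sub>F Y in at_right 0. gap x Y < 0 \<and> Y > 0" by (rule eventually_conj)
  then obtain Y where "gap x Y < 0" "Y > 0"
    using eventually_happens'[OF trivial_limit_at_right_real] by blast
  then show ?thesis unfolding gap_nonneg_def by (meson not_le)
qed

lemma not_gap_nonneg_leading:
  assumes "R_plus x * R_minus x < 0" shows "\<not> gap_nonneg x"
proof -
  define a b c where "a = \<bar>gap6 x / 720\<bar>" "b = \<bar>gap8 x / 2880\<bar>" "c = - (R_plus x * R_minus x / 230400)"
  have c: "c > 0" using assms by (simp add: a_b_c_def)
  \<comment> \<open>At this \<open>Y \<ge> 1\<close> the quadratic term outweighs the bounds \<open>a Y\<close> and \<open>b Y\<close> for the other two.\<close>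
  define Y where "Y = 1 + (a + b) / c"
  have ab: "a \<ge> 0" "b \<ge> 0" by (simp_all add: a_b_c_def)
  have Y: "Y \<ge> 1" using c ab by (simp add: Y_def)
  have "gap x Y \<le> a * Y + b * Y - c * Y^2"
  proof -
    have "gap6 x / 720 \<le> a" "gap8 x / 2880 \<le> b" unfolding a_b_c_def by (rule abs_ge_self)+
    moreover have "a * 1 \<le> a * Y" using ab Y by (intro mult_left_mono) auto
    moreover have "gap8 x / 2880 * Y \<le> b * Y" using Y calculation(2) by (intro mult_right_mono) auto
    ultimately show ?thesis by (simp add: gap_def a_b_c_def(3))
  qed
  also have "\<dots> = - c * Y" using c by (simp add: Y_def field_simps power2_eq_square)
  also have "\<dots> < 0" using c Y by simp
  finally show ?thesis using Y unfolding gap_nonneg_def by (auto intro!: exI[of _ Y] simp: not_le)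
qed

lemma gap_nonneg_if_coeffs:
  assumes "gap6 x \<ge> 0" "gap8 x \<ge> 0" "R_plus x * R_minus x \<ge> 0" shows "gap_nonneg x"
  using assms by (auto simp: gap_nonneg_def gap_def)

lemma R_minus_factor: "R_minus x = (5 * x^2 - 5 * x + 1) * (30 * x^2 - 30 * x + 4)"
  by (simp add: R_minus_def field_simps eval_nat_numeral)

lemma R_plus_strict_mono:
  assumes "9/20 \<le> x" "x < y" "y \<le> 17/20" shows "R_plus x < R_plus y"
proof (rule DERIV_pos_imp_increasing[OF assms(2)])
  fix t assume t: "x \<le> t" "t \<le> y"
  have "(R_plus has_real_derivative 150 * t^4 - 600 * t^3 + 900 * t^2 - 400 * t + 50) (at t)"
    unfolding R_plus_def[abs_def] by (rule derivative_eq_intros refl | simp)+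
  moreover have "150 * t^4 - 600 * t^3 + 900 * t^2 - 400 * t + 50 > 0"
    using R_plus_deriv_pos[of t] t assms by simp
  ultimately show "\<exists>y. (R_plus has_real_derivative y) (at t) \<and> 0 < y" by blast
qed

lemma gap6_strict_antimono:
  assumes "9/10 \<le> x" "x < y" "y \<le> 1" shows "gap6 y < gap6 x"
proof (rule DERIV_neg_imp_decreasing[OF assms(2)])
  fix t assume t: "x \<le> t" "t \<le> y"
  have "(gap6 has_real_derivative 225 * t^4 - 900 * t^3 + 900 * t^2 - 300 * t + 30) (at t)"
    unfolding gap6_def[abs_def] by (rule derivative_eq_intros refl | simp)+
  moreover have "225 * t^4 - 900 * t^3 + 900 * t^2 - 300 * t + 30 < 0"
    using gap6_deriv_neg[of t] t assms by simp
  ultimately show "\<exists>y. (gap6 has_real_derivative y) (at t) \<and> y < 0" by blast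
qed

lemma stability_interval_endpoints:
  obtains a1 b1 a2 b2 :: real where
    "\<bar>a1 - 0.4930103863\<bar> \<le> 1 / 10^8" "\<bar>b1 - 0.7236067977\<bar> \<le> 1 / 10^8"
    "\<bar>a2 - 0.8415650255\<bar> \<le> 1 / 10^8" "\<bar>b2 - 0.9465367825\<bar> \<le> 1 / 10^8"
    "R_plus a1 = 0" "gap6 b2 = 0" "5 * b1^2 - 5 * b1 + 1 = 0" "30 * a2^2 - 30 * a2 + 4 = 0"
proof -
  have "\<exists>a\<ge>0.4930103863 - 1/10^8. a \<le> 0.4930103863 + 1/10^8 \<and> R_plus a = 0"
    by (rule IVT') (auto simp: R_plus_def[abs_def] eval_nat_numeral intro!: continuous_intros)
  then obtain a1 where a1: "0.4930103863 - 1/10^8 \<le> a1" "a1 \<le> 0.4930103863 + 1/10^8" "R_plus a1 = 0" by blast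
  have "\<exists>a\<ge>0.9465367825 - 1/10^8. a \<le> 0.9465367825 + 1/10^8 \<and> gap6 a = 0"
    by (rule IVT2') (auto simp: gap6_def[abs_def] eval_nat_numeral intro!: continuous_intros)
  then obtain b2 where b2: "0.9465367825 - 1/10^8 \<le> b2" "b2 \<le> 0.9465367825 + 1/10^8" "gap6 b2 = 0" by blast
  have "\<exists>a\<ge>0.7236067977 - 1/10^8. a \<le> 0.7236067977 + 1/10^8 \<and> 5 * a^2 - 5 * a + 1 = (0::real)"
    by (rule IVT'[where f = "\<lambda>a. 5 * a^2 - 5 * a + 1"]) (auto simp: eval_nat_numeral intro!: continuous_intros)
  then obtain b1 :: real where b1: "0.7236067977 - 1/10^8 \<le> b1" "b1 \<le> 0.7236067977 + 1/10^8" "5 * b1^2 - 5 * b1 + 1 = 0" by blast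
  have "\<exists>a\<ge>0.8415650255 - 1/10^8. a \<le> 0.8415650255 + 1/10^8 \<and> 30 * a^2 - 30 * a + 4 = (0::real)"
    by (rule IVT'[where f = "\<lambda>a. 30 * a^2 - 30 * a + 4"]) (auto simp: eval_nat_numeral intro!: continuous_intros)
  then obtain a2 :: real where a2: "0.8415650255 - 1/10^8 \<le> a2" "a2 \<le> 0.8415650255 + 1/10^8" "30 * a2^2 - 30 * a2 + 4 = 0" by blast
  have close: "\<bar>a - c\<bar> \<le> e" if "c - e \<le> a" "a \<le> c + e" for a c e :: real
    using that by (simp add: abs_le_iff)
  show ?thesis
    by (rule that[of a1 b1 a2 b2]; (rule close)?; fact)
qed

text \<open>
  On the two intervals all three coefficients of the gap are nonnegative. To the left of \<open>a1\<close> the coefficients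
  that exclude stability are, from left to right: the leading one (\<open>R_inf < -1\<close>), the middle one in the small
  interval around \<open>0.158\<close>, the leading one (\<open>R_inf > 1\<close>), the constant one, and the leading one again
  (\<open>R_inf < -1\<close>, up to its zero \<open>a1\<close>). Between \<open>b1\<close> and \<open>a2\<close> one has \<open>R_inf > 1\<close>. Beyond \<open>b2\<close> the constant
  coefficient is negative up to \<open>3\<close>, and from then on the gap is negative at \<open>Y = 1/x^2\<close>.
\<close>

lemma gap_nonneg_iff:
  fixes a1 b1 a2 b2 x :: real
  assumes close: "\<bar>a1 - 0.4930103863\<bar> \<le> 1 / 10^8" "\<bar>b1 - 0.7236067977\<bar> \<le> 1 / 10^8"
    "\<bar>a2 - 0.8415650255\<bar> \<le> 1 / 10^8" "\<bar>b2 - 0.9465367825\<bar> \<le> 1 / 10^8"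
    and roots: "R_plus a1 = 0" "gap6 b2 = 0" "5 * b1^2 - 5 * b1 + 1 = 0" "30 * a2^2 - 30 * a2 + 4 = 0"
    and "x > 0"
  shows "gap_nonneg x \<longleftrightarrow> x \<in> {a1..b1} \<union> {a2..b2}"
proof -
  have a1: "0.493 < a1" "a1 < 0.494" and b1: "0.723 < b1" "b1 < 0.724"
    and a2: "0.841 < a2" "a2 < 0.842" and b2: "0.946 < b2" "b2 < 0.947"
    using close by (simp_all only: abs_le_iff) simp_all
  \<comment> \<open>Both quadratic factors of \<open>R_minus\<close> are symmetric about \<open>1/2\<close>.\<close>
  have f1: "5 * x^2 - 5 * x + 1 = 5 * ((x - b1) * (x - (1 - b1)))"
    and f2: "30 * x^2 - 30 * x + 4 = 30 * ((x - a2) * (x - (1 - a2)))"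
    using roots(3,4) by (simp_all add: algebra_simps power2_eq_square)
  have R_minus: "R_minus x = 150 * (((x - b1) * (x - (1 - b1))) * ((x - a2) * (x - (1 - a2))))"
    unfolding R_minus_factor f1 f2 by simp
  have R_minus_pos: "R_minus x > 0" if "((x - b1) * (x - (1 - b1)) > 0 \<and> (x - a2) * (x - (1 - a2)) > 0)
      \<or> ((x - b1) * (x - (1 - b1)) < 0 \<and> (x - a2) * (x - (1 - a2)) < 0)"
    unfolding R_minus using that by (intro mult_pos_pos[of 150]) (blast intro: mult_pos_pos mult_neg_neg | simp)+
  have R_minus_neg: "R_minus x < 0" if "(x - b1) * (x - (1 - b1)) > 0" "(x - a2) * (x - (1 - a2)) < 0"
    unfolding R_minus by (intro mult_pos_neg[of 150] mult_pos_neg[OF that]) simp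
  have "gap_nonneg x" if "x \<in> {a1..b1}"
  proof (rule gap_nonneg_if_coeffs)
    show "gap6 x \<ge> 0" using gap6_pos[of x] that a1 b1 by simp
    show "gap8 x \<ge> 0" using gap8_pos[of x] that a1 b1 by simp
    have "R_plus x \<ge> R_plus a1"
      using R_plus_strict_mono[of a1 x] that a1 b1 by (cases "a1 = x") auto
    moreover have "R_minus x \<ge> 0"
    proof -
      have "(x - b1) * (x - (1 - b1)) \<le> 0" "(x - a2) * (x - (1 - a2)) \<le> 0"
        using that a1 a2 b1 by (auto intro!: mult_nonpos_nonneg)
      then show ?thesis unfolding R_minus by (intro mult_nonneg_nonneg[of 150] mult_nonpos_nonpos) simp
    qed
    ultimately show "R_plus x * R_minus x \<ge> 0" using roots(1) by simp
  qed
  moreover have "gap_nonneg x" if "x \<in> {a2..b2}"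
  proof (rule gap_nonneg_if_coeffs)
    have "gap6 x \<ge> gap6 b2" if "x \<ge> 9/10"
      using gap6_strict_antimono[of x b2] that \<open>x \<in> {a2..b2}\<close> b2 by (cases "x = b2") auto
    then show "gap6 x \<ge> 0" using gap6_pos[of x] that a2 roots(2) by (cases "x \<ge> 9/10") auto
    show "gap8 x \<ge> 0" using gap8_pos[of x] that a2 b2 by simp
    have "R_plus x > 0" using R_plus_pos_right[of x] that a2 b2 by simp
    moreover have "R_minus x \<ge> 0"
      unfolding R_minus using that a2 b1 by (intro mult_nonneg_nonneg) auto
    ultimately show "R_plus x * R_minus x \<ge> 0" by simp
  qed
  moreover have "\<not> gap_nonneg x" if "x < a1"
  proof -
    consider "x \<le> 3/19" | "3/19 \<le> x" "x \<le> 4/25" | "4/25 \<le> x" "x \<le> 4/15" | "4/15 \<le> x" "x \<le> 2/5"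
      | "2/5 \<le> x" "x \<le> 49/100" | "49/100 \<le> x" by linarith
    then show ?thesis
    proof cases
      case 1
      have "R_minus x > 0"
        using 1 a2 b1 by (intro R_minus_pos disjI1 conjI mult_neg_neg) auto
      then show ?thesis
        using R_plus_neg_left[of x] 1 \<open>x > 0\<close> by (intro not_gap_nonneg_leading) (simp add: mult_less_0_iff)
    next
      case 2
      then have "gap x 100 < 0" by (intro gap_100_neg) auto
      then show ?thesis unfolding gap_nonneg_def by (auto intro!: exI[of _ 100] simp: not_le)
    next
      case 3
      have "R_minus x < 0"
        using 3 a2 b1 by (intro R_minus_neg mult_neg_neg mult_neg_pos) auto
      then show ?thesis
        using R_plus_pos_left[of x] 3 by (intro not_gap_nonneg_leading) (simp add: mult_less_0_iff)
    next
      case 4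
      then show ?thesis by (intro not_gap_nonneg_P6 gap6_neg_left) auto
    next
      case 5
      have "R_minus x > 0"
        using 5 a2 b1 by (intro R_minus_pos disjI2 conjI mult_neg_pos) auto
      then show ?thesis
        using R_plus_neg_middle[of x] 5 by (intro not_gap_nonneg_leading) (simp add: mult_less_0_iff)
    next
      case 6
      have "R_plus x < 0" using R_plus_strict_mono[of x a1] 6 that a1 roots(1) by simp
      moreover have "R_minus x > 0"
        using 6 that a1 a2 b1 by (intro R_minus_pos disjI2 conjI mult_neg_pos) auto
      ultimately show ?thesis by (intro not_gap_nonneg_leading) (simp add: mult_less_0_iff)
    qed
  qed
  moreover have "\<not> gap_nonneg x" if "b1 < x" "x < a2"
  proof (rule not_gap_nonneg_leading)
    have "R_plus x > 0" using R_plus_pos_right[of x] that a2 b1 by simp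
    moreover have "R_minus x < 0"
      using that a2 b1 by (intro R_minus_neg mult_pos_pos mult_neg_pos) auto
    ultimately show "R_plus x * R_minus x < 0" by (rule mult_pos_neg)
  qed
  moreover have "\<not> gap_nonneg x" if "b2 < x"
  proof -
    consider "x \<le> 1" | "1 \<le> x" "x \<le> 3" | "3 \<le> x" by linarith
    then show ?thesis
    proof cases
      case 1
      then show ?thesis
        using gap6_strict_antimono[of b2 x] that b2 roots(2) by (intro not_gap_nonneg_P6) simp
    next
      case 2
      then show ?thesis by (intro not_gap_nonneg_P6 gap6_neg_right) auto
    next
      case 3
      have "0 < 1 / x^2" using \<open>x > 0\<close> by simp
      with gap_inverse_square_neg[OF 3] show ?thesis
        unfolding gap_nonneg_def by (meson not_le)
    qed
  qed
  ultimately show ?thesis by (meson Un_iff atLeastAtMost_iff not_le)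
qed

lemma R_inf_R_plus_minus:
  assumes "x > 0"
  shows "R_inf x = R_plus x / (15 * x^5) - 1" "R_inf x = 1 - R_minus x / (15 * x^5)"
  using assms by (simp_all add: R_inf_def R_plus_def R_minus_def field_simps)

lemma R_inf_attains:
  fixes a1 b1 \<rho> :: real
  assumes "0 < a1" "a1 \<le> b1" "R_plus a1 = 0" "R_minus b1 = 0" "\<rho> \<in> {-1..1}"
  shows "\<exists>x\<in>{a1..b1}. R_inf x = \<rho>"
proof -
  have "\<exists>x\<ge>a1. x \<le> b1 \<and> R_inf x = \<rho>"
  proof (rule IVT')
    show "R_inf a1 \<le> \<rho>" "\<rho> \<le> R_inf b1"
      using R_inf_R_plus_minus(1)[of a1] R_inf_R_plus_minus(2)[of b1] assms by simp_all
    show "continuous_on {a1..b1} R_inf"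
      unfolding R_inf_def[abs_def] using assms(1) by (intro continuous_intros) auto
  qed (rule assms)
  then show ?thesis by auto
qed

section \<open>The stability function on the imaginary axis and at infinity\<close>

text \<open>
  The squared modulus of \<open>(1 - g z)^5\<close> on the imaginary axis, minus that of the numerator, compared coefficient by
  coefficient in \<open>Y = y^2\<close>. Each coefficient is an identity in the single variable \<open>g = x/2\<close>.
\<close>

lemma gap_identity:
  fixes x Y :: real
  defines "c \<equiv> num_coeff (x / 2)"
  shows "(1 + (x / 2)^2 * Y) ^ 5 - ((c 0 - c 2 * Y + c 4 * Y^2)^2 + Y * (c 1 - c 3 * Y + c 5 * Y^2)^2)
    = Y^3 * gap x Y"
proof -
  define g where "g = x / 2"
  have x: "x = 2 * g" by (simp add: g_def)
  have Y1: "5 * g^2 + 2 * c 0 * c 2 - c 1 ^ 2 = 0" and Y2: "10 * g^4 - 2 * c 0 * c 4 - c 2 ^ 2 + 2 * c 1 * c 3 = 0"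
    unfolding c_def num_coeff_simps x by (simp_all add: field_simps eval_nat_numeral)
  have Y3: "10 * g^6 + 2 * c 2 * c 4 - c 3 ^ 2 - 2 * c 1 * c 5 = gap6 x / 720"
    unfolding c_def num_coeff_simps x by (simp add: gap6_def field_simps eval_nat_numeral)
  have Y4: "5 * g^8 - c 4 ^ 2 + 2 * c 3 * c 5 = gap8 x / 2880"
    unfolding c_def num_coeff_simps x by (simp add: gap8_def field_simps eval_nat_numeral)
  have Y5: "g^10 - c 5 ^ 2 = R_plus x * R_minus x / 230400"
    unfolding c_def num_coeff_simps x by (simp add: R_plus_def R_minus_def field_simps eval_nat_numeral)
  have c0: "c 0 = 1" by (simp add: c_def num_coeff_simps)
  have "(1 + g^2 * Y) ^ 5 - ((c 0 - c 2 * Y + c 4 * Y^2)^2 + Y * (c 1 - c 3 * Y + c 5 * Y^2)^2)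
    = (1 - c 0 ^ 2) + Y * (5 * g^2 + 2 * c 0 * c 2 - c 1 ^ 2) + Y^2 * (10 * g^4 - 2 * c 0 * c 4 - c 2 ^ 2 + 2 * c 1 * c 3)
      + Y^3 * (10 * g^6 + 2 * c 2 * c 4 - c 3 ^ 2 - 2 * c 1 * c 5)
      + Y^4 * (5 * g^8 - c 4 ^ 2 + 2 * c 3 * c 5) + Y^5 * (g^10 - c 5 ^ 2)"
    by (simp add: algebra_simps eval_nat_numeral)
  also have "\<dots> = Y^3 * gap x Y"
    unfolding Y1 Y2 Y3 Y4 Y5 by (simp add: c0 gap_def algebra_simps eval_nat_numeral)
  finally show ?thesis by (simp add: g_def)
qed

lemma norm_stability_function_imaginary:
  fixes x y :: real and R :: complex
  assumes R: "(1 - of_real (x / 2) * (\<i> * of_real y)) ^ 5 * R = poly (num_poly (x / 2)) (\<i> * of_real y)"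
  shows "norm R \<le> 1 \<longleftrightarrow> 0 \<le> y ^ 6 * gap x (y^2)"
proof -
  define c where "c = num_coeff (x / 2)"
  define Y where "Y = y^2"
  define d where "d = 1 - complex_of_real (x / 2) * (\<i> * of_real y)"
  have d: "d = Complex 1 (- (x / 2 * y))" by (simp add: d_def complex_eq_iff)
  have nd: "norm d ^ 2 = 1 + (x / 2)^2 * Y"
    unfolding d cmod_power2 by (simp add: Y_def power_mult_distrib power_divide)
  have dpos: "norm d > 0" unfolding d by (simp add: complex_eq_iff)
  have N: "poly (num_poly (x / 2)) (\<i> * of_real y) = Complex (c 0 - c 2 * Y + c 4 * Y^2) (y * (c 1 - c 3 * Y + c 5 * Y^2))"
    unfolding poly_num_poly c_def[symmetric]
    by (simp add: Y_def complex_eq_iff eval_nat_numeral algebra_simps)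
  have "norm R \<le> 1 \<longleftrightarrow> norm (d ^ 5 * R) \<le> norm d ^ 5"
    using dpos by (simp add: norm_mult norm_power)
  also have "\<dots> \<longleftrightarrow> norm (d ^ 5 * R) ^ 2 \<le> (norm d ^ 5) ^ 2"
    by (rule power_mono_iff[symmetric]) (simp_all)
  also have "norm (d ^ 5 * R) ^ 2 = (c 0 - c 2 * Y + c 4 * Y^2)^2 + Y * (c 1 - c 3 * Y + c 5 * Y^2)^2"
    unfolding d_def R N cmod_power2 by (simp add: Y_def power_mult_distrib)
  also have "(norm d ^ 5) ^ 2 = (1 + (x / 2)^2 * Y) ^ 5"
    unfolding nd[symmetric] by (simp flip: power_mult)
  finally have "norm R \<le> 1 \<longleftrightarrow> 0 \<le> Y^3 * gap x Y"
    unfolding gap_identity[symmetric] c_def by (simp only: diff_ge_0_iff_ge)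
  then show ?thesis by (simp add: Y_def flip: power_mult)
qed

lemma num_coeff_5_R_inf:
  assumes "x > 0" shows "num_coeff (x / 2) 5 = - ((x / 2) ^ 5) * R_inf x"
  unfolding num_coeff_simps R_inf_def using assms by (simp add: field_simps eval_nat_numeral)

text \<open>
  Dividing numerator and denominator by \<open>z^5\<close> leaves a rational function of \<open>1/z\<close> that is continuous at \<open>0\<close>, where
  it is the quotient of the leading coefficients.
\<close>

lemma stability_function_tendsto:
  fixes x :: real and R z :: "'a \<Rightarrow> complex"
  assumes "x > 0" and R: "\<forall>\<^sub>F t in F. (1 - of_real (x / 2) * z t) ^ 5 * R t = poly (num_poly (x / 2)) (z t)"
    and z: "filterlim z at_infinity F"
  shows "(R \<longlongrightarrow> of_real (R_inf x)) F"
proof -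
  define c where "c k = complex_of_real (num_coeff (x / 2) k)" for k
  define g where "g = complex_of_real (x / 2)"
  have g: "g \<noteq> 0" using assms(1) by (simp add: g_def)
  have inv: "((\<lambda>t. inverse (z t)) \<longlongrightarrow> 0) F"
    using z by (rule filterlim_compose[OF tendsto_inverse_0])
  define n where "n u = c 0 * u^5 + c 1 * u^4 + c 2 * u^3 + c 3 * u^2 + c 4 * u + c 5" for u
  have "((\<lambda>t. n (inverse (z t)) / (inverse (z t) - g) ^ 5) \<longlongrightarrow> n 0 / (0 - g) ^ 5) F"
    unfolding n_def by (intro tendsto_intros inv) (use g in auto)
  also have "n 0 / (0 - g) ^ 5 = of_real (R_inf x)"
    using g num_coeff_5_R_inf[OF assms(1)] by (simp add: n_def c_def g_def power_divide)
  finally have lim: "((\<lambda>t. n (inverse (z t)) / (inverse (z t) - g) ^ 5) \<longlongrightarrow> of_real (R_inf x)) F" .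
  have "((\<lambda>t. inverse (z t) - g) \<longlongrightarrow> 0 - g) F" by (intro tendsto_intros inv)
  then have "\<forall>\<^sub>F t in F. inverse (z t) - g \<noteq> 0"
    by (rule tendsto_imp_eventually_ne) (use g in simp)
  moreover have "\<forall>\<^sub>F t in F. z t \<noteq> 0"
    using z unfolding filterlim_at_infinity[OF order_refl] by (elim allE[of _ 1]) (auto elim: eventually_mono)
  ultimately have "\<forall>\<^sub>F t in F. n (inverse (z t)) / (inverse (z t) - g) ^ 5 = R t"
    using R
  proof eventually_elim
    case (elim t)
    have "n (inverse (z t)) * z t ^ 5 = poly (num_poly (x / 2)) (z t)"
      unfolding poly_num_poly n_def c_def using elim(2) by (simp add: field_simps eval_nat_numeral)
    also have "\<dots> = ((1 - g * z t)) ^ 5 * R t" unfolding g_def elim(3) ..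
    also have "1 - g * z t = (inverse (z t) - g) * z t" using elim(2) by (simp add: field_simps)
    finally have "n (inverse (z t)) = (inverse (z t) - g) ^ 5 * R t"
      using elim(2) by (simp add: power_mult_distrib)
    then show ?case using elim(1) by simp
  qed
  with lim show ?thesis by (rule Lim_transform_eventually)
qed

section \<open>From the complex coordinate to real matrices\<close>

lemma det_2x2:
  assumes "A \<in> carrier_mat 2 2"
  shows "Determinant.det A = A $$ (0, 0) * A $$ (1, 1) - A $$ (0, 1) * A $$ (1, 0)"
proof -
  have "Determinant.det A = (\<Sum>i<2. A $$ (i, 0) * cofactor A i 0)"
    by (rule laplace_expansion_column[OF assms]) simp
  also have "\<dots> = A $$ (0, 0) * A $$ (1, 1) - A $$ (0, 1) * A $$ (1, 0)"
  proof -
    have "mat_delete A i 0 \<in> carrier_mat 1 1" for i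
      using mat_delete_carrier[of A 2 2 i 0] assms by simp
    from det_single[OF this] show ?thesis
      using assms by (simp add: cofactor_def numeral_2_eq_2 mat_delete_def)
  qed
  finally show ?thesis .
qed

lemma dim_state [simp]: "dim_vec (state u v) = 2" "state u v \<in> carrier_vec 2"
  by (simp_all add: state_def carrier_vecI)

lemma state_index [simp]: "vec_index (state u v) 0 = u" "vec_index (state u v) (Suc 0) = v" "vec_index (state u v) 1 = v"
  by (simp_all add: state_def vec_of_list_index)

lemma vec2_eqI:
  assumes "x \<in> carrier_vec 2" "y \<in> carrier_vec 2" "vec_index x 0 = vec_index y 0" "vec_index x 1 = vec_index y 1"
  shows "x = y"
  using assms by (intro eq_vecI) (auto simp: less_2_cases_iff)

lemma mult_mat_state:
  assumes "D \<in> carrier_mat 2 2" "i < 2"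
  shows "vec_index (D *\<^sub>v state u v) i = D $$ (i, 0) * u + D $$ (i, 1) * v"
  using assms by (simp add: scalar_prod_def numeral_2_eq_2)

lemma mat2_eqI_states:
  assumes "D \<in> carrier_mat 2 2" "D' \<in> carrier_mat 2 2"
    and eq: "D *\<^sub>v state 1 0 = D' *\<^sub>v state 1 0" "D *\<^sub>v state 0 1 = D' *\<^sub>v state 0 1"
  shows "D = D'"
proof (rule eq_matI)
  fix i j assume "i < dim_row D'" "j < dim_col D'"
  then have i: "i < 2" and j: "j = 0 \<or> j = 1" using assms(2) by auto
  show "D $$ (i, j) = D' $$ (i, j)"
    using eq[THEN arg_cong[of _ _ "\<lambda>v. vec_index v i"]] j
    by (auto simp: mult_mat_state assms(1,2) i)
qed (use assms in auto)

text \<open>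
  The linear form \<open>v - cnj \<mu> u\<close> is a left eigenvector of the companion matrix for the eigenvalue \<open>\<mu>\<close>. If \<open>\<mu>\<close> is
  not real, it identifies the real states with the complex numbers; \<open>decode\<close> is its inverse.
\<close>

definition encode :: "complex \<Rightarrow> real \<Rightarrow> real \<Rightarrow> complex" where
  "encode \<mu> u v = of_real v - cnj \<mu> * of_real u"

definition decode :: "complex \<Rightarrow> complex \<Rightarrow> real Matrix.vec" where
  "decode \<mu> w = state (Im w / Im \<mu>) (Re w + Re \<mu> * (Im w / Im \<mu>))"

text \<open>
  The matrix, in the coordinates \<open>(u, v)\<close>, of multiplication by \<open>R\<close> in the complex coordinate \<open>encode \<mu> u v\<close>.
\<close>

definition real_mat :: "complex \<Rightarrow> complex \<Rightarrow> real mat" where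
  "real_mat \<mu> R = Matrix.mat 2 2 (\<lambda>(i, j). if i = 0
     then (if j = 0 then Re R - Re \<mu> * Im R / Im \<mu> else Im R / Im \<mu>)
     else (if j = 0 then - Im R * ((Re \<mu>)^2 + (Im \<mu>)^2) / Im \<mu> else Re R + Re \<mu> * Im R / Im \<mu>))"

lemma real_mat_carrier [simp]: "real_mat \<mu> R \<in> carrier_mat 2 2"
  by (simp add: real_mat_def)

lemma decode_encode: "Im \<mu> \<noteq> 0 \<Longrightarrow> decode \<mu> (encode \<mu> u v) = state u v"
  by (simp add: decode_def encode_def)

lemma encode_decode: "Im \<mu> \<noteq> 0 \<Longrightarrow> encode \<mu> (Im w / Im \<mu>) (Re w + Re \<mu> * (Im w / Im \<mu>)) = w"
  by (simp add: encode_def complex_eq_iff)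

lemma decode_carrier [simp]: "decode \<mu> w \<in> carrier_vec 2"
  by (simp add: decode_def)

lemma decode_add: "decode \<mu> (a + b) = decode \<mu> a + decode \<mu> b"
  by (rule vec2_eqI) (simp_all add: decode_def add_divide_distrib distrib_left)

lemma real_mat_mult_state:
  assumes "Im \<mu> \<noteq> 0"
  shows "real_mat \<mu> R *\<^sub>v state u v = decode \<mu> (R * encode \<mu> u v)"
proof (rule vec2_eqI)
  show "real_mat \<mu> R *\<^sub>v state u v \<in> carrier_vec 2"
    by (rule mult_mat_vec_carrier[OF real_mat_carrier]) simp
  show "vec_index (real_mat \<mu> R *\<^sub>v state u v) 0 = vec_index (decode \<mu> (R * encode \<mu> u v)) 0"
    "vec_index (real_mat \<mu> R *\<^sub>v state u v) 1 = vec_index (decode \<mu> (R * encode \<mu> u v)) 1"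
    using assms by (simp_all add: mult_mat_state, simp_all add: real_mat_def decode_def encode_def field_simps power2_eq_square)
qed simp

text \<open>
  The root of \<open>z^2 + 2 \<xi> \<omega> z + \<omega>^2\<close> in the upper half-plane.
\<close>

definition eig :: "real \<Rightarrow> real \<Rightarrow> complex" where
  "eig \<xi> \<omega> = Complex (- \<xi> * \<omega>) (\<omega> * sqrt (1 - \<xi>^2))"

lemma eig_props:
  assumes "\<xi> \<in> {0..<1}" "\<omega> > 0"
  shows "Re (eig \<xi> \<omega>) = - \<xi> * \<omega>" "Im (eig \<xi> \<omega>) > 0" "norm (eig \<xi> \<omega>) ^ 2 = \<omega>^2" "norm (eig \<xi> \<omega>) = \<omega>"
proof -
  have x: "\<xi>^2 < 1" using assms by (simp add: power_less_one_iff abs_square_less_1)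
  show "Re (eig \<xi> \<omega>) = - \<xi> * \<omega>" "Im (eig \<xi> \<omega>) > 0"
    using assms x by (simp_all add: eig_def)
  show n: "norm (eig \<xi> \<omega>) ^ 2 = \<omega>^2"
    using x by (simp add: eig_def cmod_power2 power_mult_distrib algebra_simps)
  then show "norm (eig \<xi> \<omega>) = \<omega>" using assms(2) by (simp add: power2_eq_iff_nonneg)
qed

text \<open>
  The complex coordinate of \<open>(u', v')\<close>, where \<open>v'\<close> is given by the equation of motion with load \<open>F\<close>: this is the
  step that diagonalizes the second-order equation.
\<close>

lemma encode_acceleration:
  assumes "\<xi> \<in> {0..<1}" "\<omega> > 0"
  shows "encode (eig \<xi> \<omega>) v (F - 2 * \<xi> * \<omega> * v - \<omega>^2 * u) = eig \<xi> \<omega> * encode (eig \<xi> \<omega>) u v + of_real F"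
proof -
  have "Re (eig \<xi> \<omega>) ^ 2 + Im (eig \<xi> \<omega>) ^ 2 = \<omega>^2"
    using eig_props(3)[OF assms] by (simp add: cmod_power2)
  then show ?thesis
    using eig_props(1)[OF assms]
    by (simp add: encode_def complex_eq_iff algebra_simps power2_eq_square flip: distrib_right)
qed

lemma encode_eq_iff: "Im \<mu> \<noteq> 0 \<Longrightarrow> encode \<mu> u v = encode \<mu> u' v' \<longleftrightarrow> u = u' \<and> v = v'"
  by (auto simp: encode_def complex_eq_iff)

lemma encode_linear:
  "encode \<mu> (u + h * (\<Sum>j\<in>A. c j * x j)) (v + h * (\<Sum>j\<in>A. c j * y j))
    = encode \<mu> u v + of_real h * (\<Sum>j\<in>A. of_real (c j) * encode \<mu> (x j) (y j))"
  by (simp add: encode_def algebra_simps sum_subtractf sum_distrib_left)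

text \<open>
  The real and imaginary parts of a complex stage equation are equivalent to the two update formulas for
  displacement and velocity, once the accelerations are eliminated.
\<close>

lemma sub_steps_iff_complex_stages:
  assumes "\<xi> \<in> {0..<1}" "\<omega> > 0" "\<gamma> 0 = 0"
  shows "sub_steps s \<alpha> \<gamma> \<xi> \<omega> h f tn u v a \<longleftrightarrow>
    (\<forall>i\<le>s. a i = f (tn + \<gamma> i * h) - 2 * \<xi> * \<omega> * v i - \<omega>^2 * u i) \<and>
    complex_stages s \<alpha> (eig \<xi> \<omega>) h (\<lambda>j. of_real (f (tn + \<gamma> j * h))) (\<lambda>i. encode (eig \<xi> \<omega>) (u i) (v i))"
    (is "_ \<longleftrightarrow> ?acc \<and> ?st")
proof -
  define \<mu> where "\<mu> = eig \<xi> \<omega>"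
  have im: "Im \<mu> \<noteq> 0" using eig_props(2)[OF assms(1,2)] by (simp add: \<mu>_def)
  have acc: "?acc \<longleftrightarrow> a 0 = f tn - 2 * \<xi> * \<omega> * v 0 - \<omega>\<^sup>2 * u 0 \<and>
      (\<forall>i\<in>{1..s}. a i + 2 * \<xi> * \<omega> * v i + \<omega>\<^sup>2 * u i = f (tn + \<gamma> i * h))"
  proof -
    have "{..s} = insert 0 {1..s}" by auto
    then have "?acc \<longleftrightarrow> (\<forall>i\<in>insert 0 {1..s}. a i = f (tn + \<gamma> i * h) - 2 * \<xi> * \<omega> * v i - \<omega>^2 * u i)"
      by (metis atMost_iff)
    then show ?thesis using assms(3) by (auto simp: algebra_simps)
  qed
  have st: "encode \<mu> (u i) (v i) = encode \<mu> (u 0) (v 0) + of_real h *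
        (\<Sum>j=0..i. of_real (\<alpha> i j) * (\<mu> * encode \<mu> (u j) (v j) + of_real (f (tn + \<gamma> j * h)))) \<longleftrightarrow>
      u i = u 0 + h * (\<Sum>j=0..i. \<alpha> i j * v j) \<and> v i = v 0 + h * (\<Sum>j=0..i. \<alpha> i j * a j)"
    if ?acc "i \<in> {1..s}" for i
  proof -
    have "(\<Sum>j=0..i. of_real (\<alpha> i j) * (\<mu> * encode \<mu> (u j) (v j) + of_real (f (tn + \<gamma> j * h))))
        = (\<Sum>j=0..i. of_real (\<alpha> i j) * encode \<mu> (v j) (a j))"
      using that encode_acceleration[OF assms(1,2)] by (intro sum.cong) (auto simp: \<mu>_def)
    then show ?thesis
      by (simp only: encode_linear[symmetric] encode_eq_iff[OF im])
  qed
  show ?thesis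
    unfolding sub_steps_def complex_stages_def \<mu>_def[symmetric] acc[symmetric]
    using st acc by (auto simp del: of_real_add)
qed

lemma sub_steps_solution:
  assumes \<xi>: "\<xi> \<in> {0..<1}" "\<omega> > 0" and \<gamma>: "\<gamma> 0 = 0"
    and w: "complex_stages s \<alpha> (eig \<xi> \<omega>) h (\<lambda>j. of_real (f (tn + \<gamma> j * h))) w"
  obtains u v a where "sub_steps s \<alpha> \<gamma> \<xi> \<omega> h f tn u v a" "\<And>i. encode (eig \<xi> \<omega>) (u i) (v i) = w i"
proof -
  define \<mu> where "\<mu> = eig \<xi> \<omega>"
  define u where "u i = Im (w i) / Im \<mu>" for i
  define v where "v i = Re (w i) + Re \<mu> * (Im (w i) / Im \<mu>)" for i
  define a where "a i = f (tn + \<gamma> i * h) - 2 * \<xi> * \<omega> * v i - \<omega>^2 * u i" for i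
  have e: "encode \<mu> (u i) (v i) = w i" for i
    unfolding u_def v_def by (rule encode_decode) (use eig_props(2)[OF \<xi>] in \<open>simp add: \<mu>_def\<close>)
  have "sub_steps s \<alpha> \<gamma> \<xi> \<omega> h f tn u v a"
    unfolding sub_steps_iff_complex_stages[where \<gamma> = \<gamma>, OF \<xi> \<gamma>] \<mu>_def[symmetric] e
    using w by (simp add: a_def \<mu>_def)
  with e show ?thesis using that by (simp add: \<mu>_def)
qed

lemma final_state_affine:
  assumes \<xi>: "\<xi> \<in> {0..<1}" "\<omega> > 0" and \<gamma>: "\<gamma> 0 = 0"
    and inv: "\<And>i. i \<in> {1..s} \<Longrightarrow> 1 - of_real h * of_real (\<alpha> i i) * eig \<xi> \<omega> \<noteq> 0"
    and W: "complex_stages s \<alpha> (eig \<xi> \<omega>) h (\<lambda>_. 0) W" "W 0 = 1"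
    and p: "complex_stages s \<alpha> (eig \<xi> \<omega>) h (\<lambda>j. of_real (f (tn + \<gamma> j * h))) p" "p 0 = 0"
    and sub: "sub_steps s \<alpha> \<gamma> \<xi> \<omega> h f tn u v a"
  shows "state (u s) (v s) = real_mat (eig \<xi> \<omega>) (W s) *\<^sub>v state (u 0) (v 0) + decode (eig \<xi> \<omega>) (p s)"
proof -
  define \<mu> where "\<mu> = eig \<xi> \<omega>"
  have im: "Im \<mu> \<noteq> 0" using eig_props(2)[OF \<xi>] by (simp add: \<mu>_def)
  define c where "c = encode \<mu> (u 0) (v 0)"
  have 1: "complex_stages s \<alpha> \<mu> h (\<lambda>j. of_real (f (tn + \<gamma> j * h))) (\<lambda>i. encode \<mu> (u i) (v i))"
    using sub unfolding sub_steps_iff_complex_stages[where \<gamma> = \<gamma>, OF \<xi> \<gamma>] \<mu>_def by blast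
  have 2: "complex_stages s \<alpha> \<mu> h (\<lambda>j. of_real (f (tn + \<gamma> j * h))) (\<lambda>i. c * W i + 1 * p i)"
    using complex_stages_combine[OF W(1) p(1), of c 1] by (simp add: \<mu>_def)
  have "encode \<mu> (u s) (v s) = c * W s + 1 * p s"
    by (rule complex_stages_unique[OF 1 2]) (use W(2) p(2) inv in \<open>simp_all add: c_def \<mu>_def\<close>)
  then have "state (u s) (v s) = decode \<mu> (c * W s + 1 * p s)"
    using decode_encode[OF im] by metis
  also have "\<dots> = real_mat \<mu> (W s) *\<^sub>v state (u 0) (v 0) + decode \<mu> (p s)"
    unfolding real_mat_mult_state[OF im] decode_add by (simp add: c_def mult.commute)
  finally show ?thesis by (simp add: \<mu>_def)
qed

text \<open>
  That a matrix with the defining property of \<open>D_num\<close> is unique needs the existence of numerical solutions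
  with arbitrary initial states: the state \<open>(0, 0)\<close> without load shows that the affine part vanishes, and the two unit
  states then give the columns.
\<close>

lemma D_num_eq:
  assumes \<xi>: "\<xi> \<in> {0..<1}" "\<omega> > 0" and \<gamma>: "\<gamma> 0 = 0"
    and inv: "\<And>i. i \<in> {1..s} \<Longrightarrow> 1 - of_real h * of_real (\<alpha> i i) * eig \<xi> \<omega> \<noteq> 0"
    and W: "complex_stages s \<alpha> (eig \<xi> \<omega>) h (\<lambda>_. 0) W" "W 0 = 1"
  shows "D_num s \<alpha> \<gamma> \<xi> \<omega> h = real_mat (eig \<xi> \<omega>) (W s)"
  unfolding D_num_def
proof (rule the_equality)
  define \<mu> where "\<mu> = eig \<xi> \<omega>"
  have im: "Im \<mu> \<noteq> 0" using eig_props(2)[OF \<xi>] by (simp add: \<mu>_def)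
  show "real_mat (eig \<xi> \<omega>) (W s) \<in> carrier_mat 2 2 \<and>
    (\<forall>f tn. \<exists>L\<in>carrier_vec 2. \<forall>u v a. sub_steps s \<alpha> \<gamma> \<xi> \<omega> h f tn u v a \<longrightarrow>
           state (u s) (v s) = real_mat (eig \<xi> \<omega>) (W s) *\<^sub>v state (u 0) (v 0) + L)"
  proof (intro conjI allI)
    fix f :: "real \<Rightarrow> real" and tn :: real
    obtain p where p: "p 0 = 0" "complex_stages s \<alpha> (eig \<xi> \<omega>) h (\<lambda>j. of_real (f (tn + \<gamma> j * h))) p"
      using complex_stages_exist[of s h \<alpha> "eig \<xi> \<omega>" 0, OF inv] by blast
    show "\<exists>L\<in>carrier_vec 2. \<forall>u v a. sub_steps s \<alpha> \<gamma> \<xi> \<omega> h f tn u v a \<longrightarrow>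
           state (u s) (v s) = real_mat (eig \<xi> \<omega>) (W s) *\<^sub>v state (u 0) (v 0) + L"
      using final_state_affine[where \<gamma> = \<gamma>, OF \<xi> \<gamma> inv W p(2,1)] by (intro bexI[of _ "decode (eig \<xi> \<omega>) (p s)"]) auto
  qed simp
  fix D
  assume D: "D \<in> carrier_mat 2 2 \<and>
        (\<forall>f tn. \<exists>L\<in>carrier_vec 2. \<forall>u v a. sub_steps s \<alpha> \<gamma> \<xi> \<omega> h f tn u v a \<longrightarrow>
           state (u s) (v s) = D *\<^sub>v state (u 0) (v 0) + L)"
  then obtain L where L: "L \<in> carrier_vec 2" "\<And>u v a. sub_steps s \<alpha> \<gamma> \<xi> \<omega> h (\<lambda>_. 0) 0 u v a \<Longrightarrow>
           state (u s) (v s) = D *\<^sub>v state (u 0) (v 0) + L" by blast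
  have act: "decode \<mu> (W s * encode \<mu> x y) = D *\<^sub>v state x y + L" for x y
  proof -
    define c where "c = encode \<mu> x y"
    have st: "complex_stages s \<alpha> \<mu> h (\<lambda>j. of_real ((\<lambda>_. 0) (0 + \<gamma> j * h))) (\<lambda>i. c * W i)"
      using complex_stages_combine[OF W(1) W(1), of c 0] by (simp add: \<mu>_def)
    obtain u v a where s: "sub_steps s \<alpha> \<gamma> \<xi> \<omega> h (\<lambda>_. 0) 0 u v a" "\<And>i. encode \<mu> (u i) (v i) = c * W i"
      using sub_steps_solution[where \<gamma> = \<gamma> and h = h and tn = 0 and f = "\<lambda>_. 0", OF \<xi> \<gamma> st[unfolded \<mu>_def]] unfolding \<mu>_def by blast
    have "state (u 0) (v 0) = state x y"
      using s(2)[of 0] W(2) encode_eq_iff[OF im] by (simp add: c_def)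
    moreover have "state (u s) (v s) = decode \<mu> (c * W s)"
      using decode_encode[OF im] s(2) by metis
    ultimately show ?thesis using L(2)[OF s(1)] by (simp add: c_def mult.commute)
  qed
  have Dst: "D *\<^sub>v state x y \<in> carrier_vec 2" for x y
    using D mult_mat_vec_carrier[of D 2 2 "state x y"] by simp
  have "L = 0\<^sub>v 2"
  proof -
    have "D *\<^sub>v state 0 0 = 0\<^sub>v 2"
      using D by (intro vec2_eqI Dst) (simp_all add: mult_mat_state del: index_mult_mat_vec)
    moreover have "decode \<mu> (W s * encode \<mu> 0 0) = 0\<^sub>v 2"
      by (rule vec2_eqI) (simp_all add: encode_def decode_def)
    ultimately show ?thesis using act[of 0 0] L(1) by simp
  qed
  then have "D *\<^sub>v state x y = real_mat \<mu> (W s) *\<^sub>v state x y" for x y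
    using act[of x y] Dst by (simp add: real_mat_mult_state[OF im])
  then show "D = real_mat (eig \<xi> \<omega>) (W s)"
    using D by (intro mat2_eqI_states) (simp_all add: \<mu>_def)
qed

lemma L_num_eq:
  assumes \<xi>: "\<xi> \<in> {0..<1}" "\<omega> > 0" and \<gamma>: "\<gamma> 0 = 0"
    and inv: "\<And>i. i \<in> {1..s} \<Longrightarrow> 1 - of_real h * of_real (\<alpha> i i) * eig \<xi> \<omega> \<noteq> 0"
    and p: "complex_stages s \<alpha> (eig \<xi> \<omega>) h (\<lambda>j. of_real (f (tn + \<gamma> j * h))) p" "p 0 = 0"
  shows "L_num s \<alpha> \<gamma> \<xi> \<omega> h f tn = decode (eig \<xi> \<omega>) (p s)"
proof -
  obtain W where W: "W 0 = 1" "complex_stages s \<alpha> (eig \<xi> \<omega>) h (\<lambda>_. 0) W"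
    using complex_stages_exist[of s h \<alpha> "eig \<xi> \<omega>" 1 "\<lambda>_. 0", OF inv] by blast
  define D where "D = real_mat (eig \<xi> \<omega>) (W s)"
  have DD: "D_num s \<alpha> \<gamma> \<xi> \<omega> h = D"
    unfolding D_def by (rule D_num_eq[where \<gamma> = \<gamma>, OF \<xi> \<gamma> inv W(2,1)])
  have aff: "state (u s) (v s) = D *\<^sub>v state (u 0) (v 0) + decode (eig \<xi> \<omega>) (p s)"
    if "sub_steps s \<alpha> \<gamma> \<xi> \<omega> h f tn u v a" for u v a
    unfolding D_def by (rule final_state_affine[where \<gamma> = \<gamma>, OF \<xi> \<gamma> inv W(2,1) p that])
  show ?thesis
    unfolding L_num_def DD
  proof (rule the_equality)
    show "decode (eig \<xi> \<omega>) (p s) \<in> carrier_vec 2 \<and> (\<forall>u v a. sub_steps s \<alpha> \<gamma> \<xi> \<omega> h f tn u v a \<longrightarrow>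
           state (u s) (v s) = D *\<^sub>v state (u 0) (v 0) + decode (eig \<xi> \<omega>) (p s))"
      using aff by simp
    fix L assume L: "L \<in> carrier_vec 2 \<and> (\<forall>u v a. sub_steps s \<alpha> \<gamma> \<xi> \<omega> h f tn u v a \<longrightarrow>
           state (u s) (v s) = D *\<^sub>v state (u 0) (v 0) + L)"
    obtain u v a where s: "sub_steps s \<alpha> \<gamma> \<xi> \<omega> h f tn u v a"
      by (rule sub_steps_solution[where \<gamma> = \<gamma>, OF \<xi> \<gamma> p(1)])
    have e: "D *\<^sub>v state (u 0) (v 0) + L = D *\<^sub>v state (u 0) (v 0) + decode (eig \<xi> \<omega>) (p s)"
    proof -
      have "state (u s) (v s) = D *\<^sub>v state (u 0) (v 0) + L" using L s by blast
      then show ?thesis unfolding aff[OF s] by (rule sym)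
    qed
    have Ld: "dim_vec L = 2" using L by (auto dest: carrier_vecD)
    show "L = decode (eig \<xi> \<omega>) (p s)"
    proof (rule vec2_eqI)
      show "vec_index L 0 = vec_index (decode (eig \<xi> \<omega>) (p s)) 0" "vec_index L 1 = vec_index (decode (eig \<xi> \<omega>) (p s)) 1"
        using e[THEN arg_cong[of _ _ "\<lambda>v. vec_index v 0"]] e[THEN arg_cong[of _ _ "\<lambda>v. vec_index v 1"]] Ld
        by (simp_all del: index_mult_mat_vec add: decode_def carrier_vecD)
    qed (use L in auto)
  qed
qed

section \<open>Exact solution operators, characteristic polynomial and spectral radius\<close>

definition complex_motion :: "complex \<Rightarrow> (real \<Rightarrow> real) \<Rightarrow> (real \<Rightarrow> complex) \<Rightarrow> bool" where
  "complex_motion \<mu> f y \<longleftrightarrow> (\<forall>t. (y has_vector_derivative \<mu> * y t + of_real (f t)) (at t))"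

lemma exp_has_vector_derivative:
  fixes \<kappa> :: complex
  shows "((\<lambda>t. exp (\<kappa> * of_real t)) has_vector_derivative \<kappa> * exp (\<kappa> * of_real t)) (at t)"
proof -
  have "((\<lambda>z. exp (\<kappa> * z)) has_field_derivative \<kappa> * exp (\<kappa> * of_real t)) (at (of_real t))"
    by (auto intro!: derivative_eq_intros)
  then show ?thesis by (rule has_vector_derivative_real_field)
qed

text \<open>
  The difference of two solutions, multiplied by \<open>exp (-\<mu> t)\<close>, has derivative zero.
\<close>

lemma complex_motion_unique:
  assumes "complex_motion \<mu> f y" "complex_motion \<mu> f y'" "y 0 = y' 0"
  shows "y t = y' t"
proof -
  define d where "d t = exp (- \<mu> * of_real t) * (y t - y' t)" for t
  have "(d has_vector_derivative 0) (at t within UNIV)" for t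
  proof -
    have "(d has_vector_derivative exp (- \<mu> * of_real t) * ((\<mu> * y t + of_real (f t)) - (\<mu> * y' t + of_real (f t)))
        + (- \<mu> * exp (- \<mu> * of_real t)) * (y t - y' t)) (at t)"
      unfolding d_def using assms(1,2)
      by (intro has_vector_derivative_mult has_vector_derivative_diff exp_has_vector_derivative)
         (simp_all add: complex_motion_def)
    then show ?thesis by (simp add: algebra_simps)
  qed
  then obtain c where "\<And>t. d t = c"
    using has_vector_derivative_zero_constant[of UNIV d] by auto
  then have "d t = d 0" by metis
  then show ?thesis using assms(3) by (simp add: d_def)
qed

lemma complex_motion_exp: "complex_motion \<mu> (\<lambda>_. 0) (\<lambda>t. exp (\<mu> * of_real t) * c)"
  unfolding complex_motion_def
proof
  fix t
  have "((\<lambda>t. exp (\<mu> * of_real t) * c) has_vector_derivative \<mu> * exp (\<mu> * of_real t) * c) (at t)"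
    by (rule has_vector_derivative_mult_left exp_has_vector_derivative)+
  then show "((\<lambda>t. exp (\<mu> * of_real t) * c) has_vector_derivative \<mu> * (exp (\<mu> * of_real t) * c) + of_real 0) (at t)"
    by (simp add: mult.assoc)
qed

lemma complex_motion_exp_load:
  assumes "\<mu> \<noteq> 1"
  shows "complex_motion \<mu> exp (\<lambda>t. (exp (of_real t) - exp (\<mu> * of_real t)) * (1 / (1 - \<mu>)))"
  unfolding complex_motion_def
proof
  fix t
  have "((\<lambda>t. (exp (1 * of_real t) - exp (\<mu> * of_real t)) * (1 / (1 - \<mu>))) has_vector_derivative
     (1 * exp (1 * of_real t) - \<mu> * exp (\<mu> * of_real t)) * (1 / (1 - \<mu>))) (at t)"
    by (rule has_vector_derivative_mult_left has_vector_derivative_diff exp_has_vector_derivative)+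
  also have "(1 * exp (1 * of_real t) - \<mu> * exp (\<mu> * of_real t)) * (1 / (1 - \<mu>))
     = \<mu> * ((exp (of_real t) - exp (\<mu> * of_real t)) * (1 / (1 - \<mu>))) + of_real (exp t)"
    using assms by (simp add: field_simps exp_of_real)
  finally show "((\<lambda>t. (exp (of_real t) - exp (\<mu> * of_real t)) * (1 / (1 - \<mu>))) has_vector_derivative
    \<mu> * ((exp (of_real t) - exp (\<mu> * of_real t)) * (1 / (1 - \<mu>))) + of_real (exp t)) (at t)" by simp
qed

lemma exact_motion_complex:
  assumes "\<xi> \<in> {0..<1}" "\<omega> > 0" "exact_motion \<xi> \<omega> f u v"
  shows "complex_motion (eig \<xi> \<omega>) f (\<lambda>t. encode (eig \<xi> \<omega>) (u t) (v t))"
  unfolding complex_motion_def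
proof
  fix t
  define \<mu> where "\<mu> = eig \<xi> \<omega>"
  have "((\<lambda>t. of_real (v t) - cnj \<mu> * of_real (u t)) has_vector_derivative
     of_real (f t - 2 * \<xi> * \<omega> * v t - \<omega>\<^sup>2 * u t) - cnj \<mu> * of_real (v t)) (at t)"
    using assms(3) unfolding exact_motion_def
    by (intro has_vector_derivative_diff has_vector_derivative_mult_right has_vector_derivative_of_real) auto
  then have "((\<lambda>t. encode \<mu> (u t) (v t)) has_vector_derivative
      encode \<mu> (v t) (f t - 2 * \<xi> * \<omega> * v t - \<omega>\<^sup>2 * u t)) (at t)"
    unfolding encode_def .
  then show "((\<lambda>t. encode (eig \<xi> \<omega>) (u t) (v t)) has_vector_derivative
      eig \<xi> \<omega> * encode (eig \<xi> \<omega>) (u t) (v t) + of_real (f t)) (at t)"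
    unfolding \<mu>_def encode_acceleration[OF assms(1,2)] .
qed

lemma complex_motion_exact:
  assumes \<xi>: "\<xi> \<in> {0..<1}" "\<omega> > 0" and y: "complex_motion (eig \<xi> \<omega>) f y"
  obtains u v where "exact_motion \<xi> \<omega> f u v" "\<And>t. encode (eig \<xi> \<omega>) (u t) (v t) = y t"
proof -
  define \<mu> where "\<mu> = eig \<xi> \<omega>"
  have im: "Im \<mu> \<noteq> 0" using eig_props(2)[OF \<xi>] by (simp add: \<mu>_def)
  define u where "u t = Im (y t) / Im \<mu>" for t
  define v where "v t = Re (y t) + Re \<mu> * (Im (y t) / Im \<mu>)" for t
  have e: "encode \<mu> (u t) (v t) = y t" for t
    unfolding u_def v_def by (rule encode_decode[OF im])
  have yd: "(y has_vector_derivative encode \<mu> (v t) (f t - 2 * \<xi> * \<omega> * v t - \<omega>\<^sup>2 * u t)) (at t)" for t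
    using y unfolding complex_motion_def \<mu>_def encode_acceleration[OF \<xi>] using e by (simp add: \<mu>_def)
  have dI: "((\<lambda>t. Im (y t)) has_real_derivative Im (encode \<mu> (v t) (f t - 2 * \<xi> * \<omega> * v t - \<omega>\<^sup>2 * u t))) (at t)" for t
    unfolding has_real_derivative_iff_has_vector_derivative
    by (rule bounded_linear.has_vector_derivative[OF bounded_linear_Im yd])
  have dR: "((\<lambda>t. Re (y t)) has_real_derivative Re (encode \<mu> (v t) (f t - 2 * \<xi> * \<omega> * v t - \<omega>\<^sup>2 * u t))) (at t)" for t
    unfolding has_real_derivative_iff_has_vector_derivative
    by (rule bounded_linear.has_vector_derivative[OF bounded_linear_Re yd])
  have "exact_motion \<xi> \<omega> f u v"
    unfolding exact_motion_def
  proof (intro allI conjI)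
    fix t
    have Im: "Im (encode \<mu> (v t) a) / Im \<mu> = v t" and Re: "Re (encode \<mu> (v t) a) + Re \<mu> * v t = a" for a
      using im by (simp_all add: encode_def)
    show "(u has_real_derivative v t) (at t)"
      unfolding u_def[abs_def] using DERIV_cdivide[OF dI[of t], of "Im \<mu>"] by (simp add: Im)
    show "(v has_real_derivative f t - 2 * \<xi> * \<omega> * v t - \<omega>\<^sup>2 * u t) (at t)"
      using DERIV_add[OF dR[of t] DERIV_cmult[OF DERIV_cdivide[OF dI[of t], of "Im \<mu>"], of "Re \<mu>"]]
      unfolding v_def[abs_def, symmetric] Im Re by (simp add: v_def[abs_def])
  qed
  with e show ?thesis using that by (simp add: \<mu>_def)
qed

lemma D_exa_eq:
  assumes \<xi>: "\<xi> \<in> {0..<1}" "\<omega> > 0"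
  shows "D_exa \<xi> \<omega> h = real_mat (eig \<xi> \<omega>) (exp (eig \<xi> \<omega> * of_real h))"
proof -
  define \<mu> where "\<mu> = eig \<xi> \<omega>"
  have im: "Im \<mu> \<noteq> 0" using eig_props(2)[OF \<xi>] by (simp add: \<mu>_def)
  define D where "D = real_mat \<mu> (exp (\<mu> * of_real h))"
  have flow: "state (u h) (v h) = D *\<^sub>v state (u 0) (v 0)" if "exact_motion \<xi> \<omega> (\<lambda>_. 0) u v" for u v
  proof -
    have "complex_motion \<mu> (\<lambda>_. 0) (\<lambda>t. encode \<mu> (u t) (v t))"
      using exact_motion_complex[OF \<xi> that] by (simp add: \<mu>_def)
    from complex_motion_unique[OF this complex_motion_exp[of \<mu> "encode \<mu> (u 0) (v 0)"], of h]
    have "encode \<mu> (u h) (v h) = exp (\<mu> * of_real h) * encode \<mu> (u 0) (v 0)" by simp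
    then show ?thesis
      unfolding D_def real_mat_mult_state[OF im] by (metis decode_encode[OF im])
  qed
  show ?thesis
    unfolding D_exa_def \<mu>_def[symmetric] D_def[symmetric]
  proof (rule the_equality)
    show "D \<in> carrier_mat 2 2 \<and> (\<forall>u v. exact_motion \<xi> \<omega> (\<lambda>_. 0) u v \<longrightarrow>
           state (u h) (v h) = D *\<^sub>v state (u 0) (v 0))"
      using flow by (simp add: D_def)
    fix D' assume D': "D' \<in> carrier_mat 2 2 \<and> (\<forall>u v. exact_motion \<xi> \<omega> (\<lambda>_. 0) u v \<longrightarrow>
           state (u h) (v h) = D' *\<^sub>v state (u 0) (v 0))"
    have "D' *\<^sub>v state x y = D *\<^sub>v state x y" for x y
    proof -
      obtain u v where uv: "exact_motion \<xi> \<omega> (\<lambda>_. 0) u v"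
        "\<And>t. encode \<mu> (u t) (v t) = exp (\<mu> * of_real t) * encode \<mu> x y"
        by (rule complex_motion_exact[OF \<xi> complex_motion_exp[of "eig \<xi> \<omega>" "encode \<mu> x y"]]) (auto simp: \<mu>_def)
      have "u 0 = x" "v 0 = y" using uv(2)[of 0] encode_eq_iff[OF im] by auto
      with D' flow[OF uv(1)] uv(1) show ?thesis by metis
    qed
    with D' show "D' = D" by (intro mat2_eqI_states) (simp_all add: D_def)
  qed
qed

lemma L_exa_eq:
  assumes \<xi>: "\<xi> \<in> {0..<1}" "\<omega> > 0"
  shows "L_exa \<xi> \<omega> h = decode (eig \<xi> \<omega>) ((exp (of_real h) - exp (eig \<xi> \<omega> * of_real h)) * (1 / (1 - eig \<xi> \<omega>)))"
proof -
  define \<mu> where "\<mu> = eig \<xi> \<omega>"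
  have im: "Im \<mu> \<noteq> 0" using eig_props(2)[OF \<xi>] by (simp add: \<mu>_def)
  then have "\<mu> \<noteq> 1" by auto
  define Y where "Y t = (exp (of_real t) - exp (\<mu> * of_real t)) * (1 / (1 - \<mu>))" for t
  have Y: "complex_motion \<mu> exp Y" unfolding Y_def[abs_def] by (rule complex_motion_exp_load[OF \<open>\<mu> \<noteq> 1\<close>])
  have sol: "state (u h) (v h) = decode \<mu> (Y h)" if "exact_motion \<xi> \<omega> exp u v" "u 0 = 0" "v 0 = 0" for u v
  proof -
    have "complex_motion \<mu> exp (\<lambda>t. encode \<mu> (u t) (v t))"
      using exact_motion_complex[OF \<xi> that(1)] by (simp add: \<mu>_def)
    then have "encode \<mu> (u h) (v h) = Y h"
      by (rule complex_motion_unique[OF _ Y]) (simp add: that Y_def encode_def)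
    then show ?thesis by (metis decode_encode[OF im])
  qed
  obtain u v where uv: "exact_motion \<xi> \<omega> exp u v" "\<And>t. encode \<mu> (u t) (v t) = Y t"
    using complex_motion_exact[OF \<xi> Y[unfolded \<mu>_def]] unfolding \<mu>_def by blast
  have z: "u 0 = 0" "v 0 = 0"
    using uv(2)[of 0] encode_eq_iff[OF im, of "u 0" "v 0" 0 0] by (auto simp: Y_def encode_def)
  show ?thesis
    unfolding L_exa_def \<mu>_def[symmetric] Y_def[symmetric]
  proof (rule the_equality)
    show "\<forall>u v. exact_motion \<xi> \<omega> exp u v \<and> u 0 = 0 \<and> v 0 = 0 \<longrightarrow> decode \<mu> (Y h) = state (u h) (v h)"
      using sol by simp
    show "L = decode \<mu> (Y h)" if "\<forall>u v. exact_motion \<xi> \<omega> exp u v \<and> u 0 = 0 \<and> v 0 = 0 \<longrightarrow> L = state (u h) (v h)" for L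
      using that uv(1) z sol[OF uv(1) z] by metis
  qed
qed

text \<open>
  The eigenvalues of a multiplication by \<open>R\<close>, seen as a real-linear map of the plane, are \<open>R\<close> and \<open>cnj R\<close>.
\<close>

lemma char_poly_real_mat:
  assumes "Im \<mu> \<noteq> 0"
  shows "char_poly (real_mat \<mu> R) = [:(norm R)^2, - 2 * Re R, 1:]"
proof -
  have "char_poly (real_mat \<mu> R) = [:- (Re R - Re \<mu> * Im R / Im \<mu>), 1:] * [:- (Re R + Re \<mu> * Im R / Im \<mu>), 1:]
     - [:- (Im R / Im \<mu>):] * [:- (- Im R * ((Re \<mu>)^2 + (Im \<mu>)^2) / Im \<mu>):]"
    unfolding char_poly_def
    by (subst det_2x2) (simp_all add: char_poly_matrix_def real_mat_def)
  also have "\<dots> = [:(norm R)^2, - 2 * Re R, 1:]"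
    unfolding cmod_power2 using assms by (simp add: field_simps power2_eq_square)
  finally show ?thesis .
qed

lemma spectral_radius_real_mat:
  assumes "Im \<mu> \<noteq> 0"
  shows "spectral_radius (map_mat complex_of_real (real_mat \<mu> R)) = norm R"
proof -
  define A where "A = map_mat complex_of_real (real_mat \<mu> R)"
  have A: "A \<in> carrier_mat 2 2" by (simp add: A_def)
  have "char_poly A = map_poly of_real (char_poly (real_mat \<mu> R))"
    unfolding A_def by (rule of_real_hom.char_poly_hom[OF real_mat_carrier])
  also have "\<dots> = [:- R, 1:] * [:- cnj R, 1:]"
    unfolding char_poly_real_mat[OF assms] cmod_power2
    by (simp add: map_poly_pCons complex_eq_iff power2_eq_square)
  finally have cp: "char_poly A = [:- R, 1:] * [:- cnj R, 1:]" .
  have "eigenvalue A k \<longleftrightarrow> k = R \<or> k = cnj R" for k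
  proof -
    have "poly [:- c, 1:] k = 0 \<longleftrightarrow> k = c" for c :: complex by (simp add: add_eq_0_iff)
    then show ?thesis unfolding eigenvalue_root_char_poly[OF A] cp poly_mult mult_eq_0_iff by simp
  qed
  then have "spectrum A = {R, cnj R}"
    unfolding spectrum_def by blast
  then show ?thesis
    unfolding A_def[symmetric] spectral_radius_def by simp
qed

section \<open>Order, stability and limit of the method\<close>

lemma Re_Im_bigo:
  assumes "f \<in> O[at_right 0](hpow n)"
  shows "(\<lambda>h. a * Re (f h) + b * Im (f h)) \<in> O[at_right 0](\<lambda>h. h ^ n)"
proof -
  obtain c where c: "\<forall>\<^sub>F h in at_right 0. norm (f h) \<le> c * norm (hpow n h)"
    using landau_o.bigE[OF assms] by blast
  show ?thesis
  proof (rule bigoI)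
    show "\<forall>\<^sub>F h in at_right 0. norm (a * Re (f h) + b * Im (f h)) \<le> ((\<bar>a\<bar> + \<bar>b\<bar>) * c) * norm (h ^ n)"
      using c
    proof eventually_elim
      case (elim h)
      have "norm (a * Re (f h) + b * Im (f h)) \<le> \<bar>a\<bar> * \<bar>Re (f h)\<bar> + \<bar>b\<bar> * \<bar>Im (f h)\<bar>"
        by (metis abs_mult abs_triangle_ineq real_norm_def)
      also have "\<dots> \<le> \<bar>a\<bar> * norm (f h) + \<bar>b\<bar> * norm (f h)"
        by (intro add_mono mult_left_mono abs_Re_le_cmod abs_Im_le_cmod) auto
      also have "\<dots> = (\<bar>a\<bar> + \<bar>b\<bar>) * norm (f h)" by (simp add: distrib_right)
      also have "\<dots> \<le> (\<bar>a\<bar> + \<bar>b\<bar>) * (c * norm (hpow n h))"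
        using elim by (intro mult_left_mono) auto
      finally show ?case by (simp add: norm_power power_abs mult.assoc)
    qed
  qed
qed

lemma real_mat_bigo:
  assumes "(\<lambda>h. R h - E h) \<in> O[at_right 0](hpow n)" "i < 2" "j < 2"
  shows "(\<lambda>h. real_mat \<mu> (R h) $$ (i, j) - real_mat \<mu> (E h) $$ (i, j)) \<in> O[at_right 0](\<lambda>h. h ^ n)"
proof -
  define a where "a = (if i = j then 1 else 0 :: real)"
  define b where "b = (if i = 0 then if j = 0 then - Re \<mu> / Im \<mu> else 1 / Im \<mu>
     else if j = 0 then - ((Re \<mu>)^2 + (Im \<mu>)^2) / Im \<mu> else Re \<mu> / Im \<mu>)"
  have "real_mat \<mu> (R h) $$ (i, j) - real_mat \<mu> (E h) $$ (i, j) = a * Re (R h - E h) + b * Im (R h - E h)" for h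
    using assms(2,3) by (auto simp: real_mat_def a_def b_def less_2_cases_iff algebra_simps diff_divide_distrib add_divide_distrib)
  then show ?thesis using Re_Im_bigo[OF assms(1)] by simp
qed

lemma decode_bigo:
  assumes "(\<lambda>h. R h - E h) \<in> O[at_right 0](hpow n)" "i < 2"
  shows "(\<lambda>h. vec_index (decode \<mu> (R h)) i - vec_index (decode \<mu> (E h)) i) \<in> O[at_right 0](\<lambda>h. h ^ n)"
proof -
  define a where "a = (if i = 0 then 0 else 1 :: real)"
  define b where "b = (if i = 0 then 1 / Im \<mu> else Re \<mu> / Im \<mu>)"
  have "vec_index (decode \<mu> (R h)) i - vec_index (decode \<mu> (E h)) i = a * Re (R h - E h) + b * Im (R h - E h)" for h
    using assms(2) by (auto simp: decode_def a_def b_def less_2_cases_iff diff_divide_distrib algebra_simps)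
  then show ?thesis using Re_Im_bigo[OF assms(1)] by simp
qed

lemma stage_factor_nonzero:
  assumes "\<xi> \<in> {0..<1}" "\<omega> > 0" "g > 0" "h \<ge> 0"
  shows "1 - of_real h * of_real g * eig \<xi> \<omega> \<noteq> 0"
proof
  assume "1 - of_real h * of_real g * eig \<xi> \<omega> = 0"
  then have "Im (1 - of_real h * of_real g * eig \<xi> \<omega>) = 0" "Re (1 - of_real h * of_real g * eig \<xi> \<omega>) = 0" by simp_all
  then show False using assms eig_props(2)[OF assms(1,2)] by auto
qed

text \<open>
  The entries of a matrix \<open>real_mat \<mu> R\<close> and of a vector \<open>decode \<mu> w\<close> are real-linear in \<open>R\<close> and \<open>w\<close> with
  coefficients depending on \<open>\<mu>\<close> only, so the complex error bounds carry over entrywise.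
\<close>

lemma order5_conditions_accurate:
  fixes g :: real
  assumes cond: "order5_conditions \<alpha> \<gamma>" and \<gamma>: "\<gamma> 0 = 0" "\<gamma> 5 = 1"
    and g: "g > 0" and diag: "\<And>i. i \<in> {1..5} \<Longrightarrow> \<alpha> i i = g"
  shows "accurate_of_order 5 5 \<alpha> \<gamma>"
  unfolding accurate_of_order_def
proof (intro allI ballI impI)
  fix \<omega> \<xi> :: real assume \<omega>: "\<omega> > 0" and \<xi>: "\<xi> \<in> {0..<1}"
  define \<mu> where "\<mu> = eig \<xi> \<omega>"
  have "Im \<mu> \<noteq> 0" using eig_props(2)[OF \<xi> \<omega>] by (simp add: \<mu>_def)
  then have "\<mu> \<noteq> 1" by auto
  have inv: "1 - of_real h * of_real (\<alpha> i i) * \<mu> \<noteq> 0" if "i \<in> {1..5}" "h \<ge> 0" for i h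
    using stage_factor_nonzero[OF \<xi> \<omega> g that(2)] diag[OF that(1)] by (simp add: \<mu>_def)
  define W where "W \<kappa> h = (SOME w. w 0 = 1 \<and> complex_stages 5 \<alpha> \<mu> h (\<lambda>j. (\<kappa> - \<mu>) * exp (\<kappa> * of_real (\<gamma> j * h))) w)" for \<kappa> h
  have W: "W \<kappa> h 0 = 1 \<and> complex_stages 5 \<alpha> \<mu> h (\<lambda>j. (\<kappa> - \<mu>) * exp (\<kappa> * of_real (\<gamma> j * h))) (W \<kappa> h)" if "h \<ge> 0" for \<kappa> h
    unfolding W_def
    by (rule someI_ex[where P = "\<lambda>w. w 0 = 1 \<and> complex_stages 5 \<alpha> \<mu> h _ w"], rule complex_stages_exist)
      (rule inv[OF _ that])
  have pos: "\<forall>\<^sub>F h::real in at_right 0. h > 0" by (simp add: eventually_at_right_less)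
  have acc: "(\<lambda>h. W \<kappa> h 5 - exp (\<kappa> * of_real h)) \<in> O[at_right 0](hpow 6)" for \<kappa>
    by (rule scheme_accuracy[OF cond \<gamma>, where \<mu> = \<mu>]) (use pos in \<open>eventually_elim, use W in auto\<close>)
  show "(\<forall>i<2. \<forall>j<2. (\<lambda>\<Delta>t. D_num 5 \<alpha> \<gamma> \<xi> \<omega> \<Delta>t $$ (i, j) - D_exa \<xi> \<omega> \<Delta>t $$ (i, j))
                       \<in> O[at_right 0](\<lambda>\<Delta>t. \<Delta>t ^ (5 + 1))) \<and>
        (\<forall>i<2. (\<lambda>\<Delta>t. vec_index (L_num 5 \<alpha> \<gamma> \<xi> \<omega> \<Delta>t exp 0) i - vec_index (L_exa \<xi> \<omega> \<Delta>t) i)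
                 \<in> O[at_right 0](\<lambda>\<Delta>t. \<Delta>t ^ (5 + 1)))"
  proof (intro conjI allI impI)
    fix i j :: nat assume ij: "i < 2" "j < 2"
    have "\<forall>\<^sub>F h in at_right 0. D_num 5 \<alpha> \<gamma> \<xi> \<omega> h $$ (i, j) - D_exa \<xi> \<omega> h $$ (i, j)
        = real_mat \<mu> (W \<mu> h 5) $$ (i, j) - real_mat \<mu> (exp (\<mu> * of_real h)) $$ (i, j)"
      using pos
    proof eventually_elim
      case (elim h)
      have "D_num 5 \<alpha> \<gamma> \<xi> \<omega> h = real_mat \<mu> (W \<mu> h 5)"
        unfolding \<mu>_def by (rule D_num_eq[where \<gamma> = \<gamma>, OF \<xi> \<omega> \<gamma>(1)])
          (use inv W[of h \<mu>] elim in \<open>auto simp: \<mu>_def\<close>)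
      then show ?case by (simp add: D_exa_eq[OF \<xi> \<omega>] \<mu>_def)
    qed
    moreover have "(\<lambda>h. real_mat \<mu> (W \<mu> h 5) $$ (i, j) - real_mat \<mu> (exp (\<mu> * of_real h)) $$ (i, j)) \<in> O[at_right 0](\<lambda>h. h ^ (5 + 1))"
      using real_mat_bigo[OF acc ij] by simp
    ultimately show "(\<lambda>h. D_num 5 \<alpha> \<gamma> \<xi> \<omega> h $$ (i, j) - D_exa \<xi> \<omega> h $$ (i, j)) \<in> O[at_right 0](\<lambda>h. h ^ (5 + 1))"
      by (simp add: landau_o.big.in_cong)
  next
    fix i :: nat assume i: "i < 2"
    \<comment> \<open>By superposition the forced solution is the difference of two exponential ones.\<close>
    define p where "p h j = 1 / (1 - \<mu>) * W 1 h j + (- 1 / (1 - \<mu>)) * W \<mu> h j" for h j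
    define y where "y h = (exp (of_real h) - exp (\<mu> * of_real h)) * (1 / (1 - \<mu>))" for h
    have "\<forall>\<^sub>F h in at_right 0. vec_index (L_num 5 \<alpha> \<gamma> \<xi> \<omega> h exp 0) i - vec_index (L_exa \<xi> \<omega> h) i
        = vec_index (decode \<mu> (p h 5)) i - vec_index (decode \<mu> (y h)) i"
      using pos
    proof eventually_elim
      case (elim h)
      have F: "(\<lambda>j. 1 / (1 - \<mu>) * ((1 - \<mu>) * exp (1 * of_real (\<gamma> j * h))) + (- 1 / (1 - \<mu>)) * ((\<mu> - \<mu>) * exp (\<mu> * of_real (\<gamma> j * h))))
          = (\<lambda>j. of_real (exp (0 + \<gamma> j * h)))"
        using \<open>\<mu> \<noteq> 1\<close> by (simp flip: exp_of_real)
      have "complex_stages 5 \<alpha> \<mu> h (\<lambda>j. of_real (exp (0 + \<gamma> j * h))) (p h)"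
        using complex_stages_combine[OF conjunct2[OF W[of h 1]] conjunct2[OF W[of h \<mu>]], of "1 / (1 - \<mu>)" "- 1 / (1 - \<mu>)"] elim
        unfolding F p_def[abs_def] by simp
      moreover have "p h 0 = 0" using W[of h] elim by (simp add: p_def)
      ultimately have "L_num 5 \<alpha> \<gamma> \<xi> \<omega> h exp 0 = decode \<mu> (p h 5)"
        unfolding \<mu>_def using inv[of _ h] elim
        by (intro L_num_eq[where \<gamma> = \<gamma>, OF \<xi> \<omega> \<gamma>(1)]) (auto simp: \<mu>_def)
      then show ?case by (simp add: L_exa_eq[OF \<xi> \<omega>] \<mu>_def y_def)
    qed
    moreover have "(\<lambda>h. p h 5 - y h) \<in> O[at_right 0](hpow 6)"
    proof -
      have "(\<lambda>h. 1 / (1 - \<mu>) * (W 1 h 5 - exp (1 * of_real h)) + (- 1 / (1 - \<mu>)) * (W \<mu> h 5 - exp (\<mu> * of_real h))) \<in> O[at_right 0](hpow 6)"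
        by (intro sum_in_bigo cmult_in_hpow acc)
      also have "(\<lambda>h. 1 / (1 - \<mu>) * (W 1 h 5 - exp (1 * of_real h)) + (- 1 / (1 - \<mu>)) * (W \<mu> h 5 - exp (\<mu> * of_real h)))
          = (\<lambda>h. p h 5 - y h)"
        by (rule ext) (simp add: p_def y_def algebra_simps diff_divide_distrib)
      finally show ?thesis .
    qed
    from decode_bigo[OF this i] have "(\<lambda>h. vec_index (decode \<mu> (p h 5)) i - vec_index (decode \<mu> (y h)) i) \<in> O[at_right 0](\<lambda>h. h ^ (5 + 1))"
      by simp
    ultimately show "(\<lambda>h. vec_index (L_num 5 \<alpha> \<gamma> \<xi> \<omega> h exp 0) i - vec_index (L_exa \<xi> \<omega> h) i) \<in> O[at_right 0](\<lambda>h. h ^ (5 + 1))"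
      by (simp add: landau_o.big.in_cong)
  qed
qed

lemma D_num_stability_function:
  fixes x :: real
  assumes cond: "order5_conditions \<alpha> \<gamma>" and \<gamma>: "\<gamma> 0 = 0" "\<gamma> 5 = 1"
    and x: "x > 0" and diag: "\<And>i. i \<in> {1..5} \<Longrightarrow> \<alpha> i i = x / 2"
    and \<xi>: "\<xi> \<in> {0..<1}" "\<omega> > 0" and h: "h \<ge> 0"
  obtains R where "D_num 5 \<alpha> \<gamma> \<xi> \<omega> h = real_mat (eig \<xi> \<omega>) R"
    "(1 - of_real (x / 2) * (of_real h * eig \<xi> \<omega>)) ^ 5 * R = poly (num_poly (x / 2)) (of_real h * eig \<xi> \<omega>)"
proof -
  have inv: "1 - of_real h * of_real (\<alpha> i i) * eig \<xi> \<omega> \<noteq> 0" if "i \<in> {1..5}" for i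
    unfolding diag[OF that] by (rule stage_factor_nonzero[OF \<xi> _ h]) (use x in simp)
  obtain W where W: "W 0 = 1" "complex_stages 5 \<alpha> (eig \<xi> \<omega>) h (\<lambda>_. 0) W"
    using complex_stages_exist[of 5 h \<alpha> "eig \<xi> \<omega>" 1 "\<lambda>_. 0", OF inv] by blast
  show ?thesis
    using that D_num_eq[where \<gamma> = \<gamma>, OF \<xi> \<gamma>(1) inv W(2,1)] stability_function[OF cond \<gamma> diag W(2,1)] by blast
qed

text \<open>
  For \<open>\<xi> = 0\<close> the eigenvalue is \<open>i \<omega>\<close>, and the products \<open>\<omega> \<Delta>t\<close> run through the whole half-line.
\<close>

lemma unconditionally_stable_iff_gap_nonneg:
  fixes x :: real
  assumes cond: "order5_conditions \<alpha> \<gamma>" and \<gamma>: "\<gamma> 0 = 0" "\<gamma> 5 = 1"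
    and x: "x > 0" and diag: "\<And>i. i \<in> {1..5} \<Longrightarrow> \<alpha> i i = x / 2"
  shows "unconditionally_stable 5 \<alpha> \<gamma> \<longleftrightarrow> gap_nonneg x"
proof -
  have sr: "spectral_radius (map_mat complex_of_real (D_num 5 \<alpha> \<gamma> 0 \<omega> h)) \<le> 1 \<longleftrightarrow> 0 \<le> (\<omega> * h) ^ 6 * gap x ((\<omega> * h)^2)"
    if pos: "\<omega> > 0" "h \<ge> 0" for \<omega> h
  proof -
    obtain R where R: "D_num 5 \<alpha> \<gamma> 0 \<omega> h = real_mat (eig 0 \<omega>) R"
      "(1 - of_real (x / 2) * (of_real h * eig 0 \<omega>)) ^ 5 * R = poly (num_poly (x / 2)) (of_real h * eig 0 \<omega>)"
      by (rule D_num_stability_function[OF cond \<gamma> x diag _ pos, of 0]) auto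
    have z: "of_real h * eig 0 \<omega> = \<i> * of_real (\<omega> * h)"
      by (simp add: eig_def complex_eq_iff)
    have "Im (eig 0 \<omega>) \<noteq> 0" using pos by (simp add: eig_def)
    then show ?thesis
      using norm_stability_function_imaginary[OF R(2)[unfolded z]] by (simp add: R(1) spectral_radius_real_mat)
  qed
  show ?thesis
  proof
    assume st: "unconditionally_stable 5 \<alpha> \<gamma>"
    show "gap_nonneg x"
      unfolding gap_nonneg_def
    proof (intro allI impI)
      fix Y :: real assume Y: "Y > 0"
      have "0 \<le> (sqrt Y * 1) ^ 6 * gap x ((sqrt Y * 1)^2)"
        using st sr[of "sqrt Y" 1] Y unfolding unconditionally_stable_def by auto
      then show "0 \<le> gap x Y" using Y by (simp add: zero_le_mult_iff)
    qed
  next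
    assume gap: "gap_nonneg x"
    have "0 \<le> (\<omega> * h) ^ 6 * gap x ((\<omega> * h)^2)" for \<omega> h :: real
    proof (cases "\<omega> * h = 0")
      case False
      then have "(\<omega> * h)^2 > 0" by (simp only: zero_less_power2) simp
      then have "gap x ((\<omega> * h)^2) \<ge> 0" using gap unfolding gap_nonneg_def by blast
      then show ?thesis by (intro mult_nonneg_nonneg zero_le_even_power) auto
    qed auto
    then show "unconditionally_stable 5 \<alpha> \<gamma>"
      unfolding unconditionally_stable_def using sr by blast
  qed
qed

text \<open>
  As \<open>|\<mu>| = \<omega>\<close>, the argument \<open>\<mu> \<Delta>t\<close> of the stability function tends to infinity. The limit \<open>R_inf\<close> is real,
  so both eigenvalues tend to it.
\<close>

lemma char_poly_tendsto:
  fixes x :: real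
  assumes cond: "order5_conditions \<alpha> \<gamma>" and \<gamma>: "\<gamma> 0 = 0" "\<gamma> 5 = 1"
    and x: "x > 0" and diag: "\<And>i. i \<in> {1..5} \<Longrightarrow> \<alpha> i i = x / 2"
    and h: "h > 0" and \<xi>: "\<xi> \<in> {0..<1}"
  shows "((\<lambda>\<omega>. coeff (char_poly (D_num 5 \<alpha> \<gamma> \<xi> \<omega> h)) k) \<longlongrightarrow> coeff ([:- R_inf x, 1:]^2) k) at_top"
proof -
  define R where "R \<omega> = poly (num_poly (x / 2)) (of_real h * eig \<xi> \<omega>) / (1 - of_real (x / 2) * (of_real h * eig \<xi> \<omega>)) ^ 5" for \<omega>
  have pos: "\<forall>\<^sub>F \<omega>::real in at_top. \<omega> > 0" by (rule eventually_gt_at_top)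
  have R: "D_num 5 \<alpha> \<gamma> \<xi> \<omega> h = real_mat (eig \<xi> \<omega>) (R \<omega>)"
    "(1 - of_real (x / 2) * (of_real h * eig \<xi> \<omega>)) ^ 5 * R \<omega> = poly (num_poly (x / 2)) (of_real h * eig \<xi> \<omega>)" if w: "\<omega> > 0" for \<omega>
  proof -
    have nz: "1 - of_real (x / 2) * (of_real h * eig \<xi> \<omega>) \<noteq> 0"
      using stage_factor_nonzero[OF \<xi> w, of "x / 2" h] x h by (simp add: mult_ac)
    then show "(1 - of_real (x / 2) * (of_real h * eig \<xi> \<omega>)) ^ 5 * R \<omega> = poly (num_poly (x / 2)) (of_real h * eig \<xi> \<omega>)"
      by (simp add: R_def)
    obtain R' where R': "D_num 5 \<alpha> \<gamma> \<xi> \<omega> h = real_mat (eig \<xi> \<omega>) R'"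
      "(1 - of_real (x / 2) * (of_real h * eig \<xi> \<omega>)) ^ 5 * R' = poly (num_poly (x / 2)) (of_real h * eig \<xi> \<omega>)"
      by (rule D_num_stability_function[OF cond \<gamma> x diag \<xi> w less_imp_le[OF h]])
    have "R' = R \<omega>" unfolding R_def R'(2)[symmetric] using nz by simp
    with R'(1) show "D_num 5 \<alpha> \<gamma> \<xi> \<omega> h = real_mat (eig \<xi> \<omega>) (R \<omega>)" by simp
  qed
  have "filterlim (\<lambda>\<omega>. norm (of_real h * eig \<xi> \<omega>)) at_top at_top"
  proof (rule filterlim_cong[THEN iffD1])
    show "filterlim (\<lambda>\<omega>. h * \<omega>) at_top at_top"
      using h by (intro filterlim_tendsto_pos_mult_at_top[OF tendsto_const] filterlim_ident)
    show "\<forall>\<^sub>F \<omega> in at_top. h * \<omega> = norm (of_real h * eig \<xi> \<omega>)"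
      using pos by eventually_elim (use h \<xi> in \<open>simp add: norm_mult eig_props(4)\<close>)
  qed simp_all
  then have z: "filterlim (\<lambda>\<omega>. of_real h * eig \<xi> \<omega>) at_infinity at_top"
    by (rule filterlim_norm_at_top_imp_at_infinity)
  have lim: "(R \<longlongrightarrow> of_real (R_inf x)) at_top"
    by (rule stability_function_tendsto[OF x eventually_mono[OF pos R(2)] z])
  have "((\<lambda>\<omega>. coeff [:(norm (R \<omega>))^2, - 2 * Re (R \<omega>), 1:] k) \<longlongrightarrow> coeff [:(norm (complex_of_real (R_inf x)))^2, - 2 * Re (of_real (R_inf x)), 1:] k) at_top"
  proof -
    have n: "((\<lambda>\<omega>. (norm (R \<omega>))^2) \<longlongrightarrow> (norm (complex_of_real (R_inf x)))^2) at_top"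
      and r: "((\<lambda>\<omega>. - 2 * Re (R \<omega>)) \<longlongrightarrow> - 2 * Re (of_real (R_inf x))) at_top"
      by (intro tendsto_intros lim)+
    consider "k = 0" | "k = 1" | j where "k = Suc (Suc j)" by (metis One_nat_def old.nat.exhaust)
    then show ?thesis using n r by cases simp_all
  qed
  also have "[:(norm (complex_of_real (R_inf x)))^2, - 2 * Re (of_real (R_inf x)), 1:] = [:- R_inf x, 1:]^2"
    by (simp add: power2_eq_square)
  finally have "((\<lambda>\<omega>. coeff [:(norm (R \<omega>))^2, - 2 * Re (R \<omega>), 1:] k) \<longlongrightarrow> coeff ([:- R_inf x, 1:]^2) k) at_top" .
  moreover have "\<forall>\<^sub>F \<omega> in at_top. coeff [:(norm (R \<omega>))^2, - 2 * Re (R \<omega>), 1:] k = coeff (char_poly (D_num 5 \<alpha> \<gamma> \<xi> \<omega> h)) k"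
    using pos
  proof eventually_elim
    case (elim \<omega>)
    have "Im (eig \<xi> \<omega>) \<noteq> 0" using eig_props(2)[OF \<xi> elim] by simp
    then show ?case unfolding R(1)[OF elim] by (simp add: char_poly_real_mat)
  qed
  ultimately show ?thesis by (rule Lim_transform_eventually)
qed

theorem mainTheorem4:
  shows "\<exists>a1 b1 a2 b2 :: real.
    a1 < b1 \<and> b1 < a2 \<and> a2 < b2 \<and>
    \<bar>a1 - 0.4930103863\<bar> \<le> 1 / 10^8 \<and> \<bar>b1 - 0.7236067977\<bar> \<le> 1 / 10^8 \<and>
    \<bar>a2 - 0.8415650255\<bar> \<le> 1 / 10^8 \<and> \<bar>b2 - 0.9465367825\<bar> \<le> 1 / 10^8 \<and>
    (\<forall>\<alpha> \<gamma>. SUCI5 \<alpha> \<gamma> \<longrightarrow>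
       accurate_of_order 5 5 \<alpha> \<gamma> \<and>
       (unconditionally_stable 5 \<alpha> \<gamma> \<longleftrightarrow> \<gamma> 1 \<in> {a1..b1} \<union> {a2..b2}) \<and>
       (\<forall>\<Delta>t>0. \<forall>\<xi>\<in>{0..<1}. \<forall>k.
          ((\<lambda>\<omega>. coeff (char_poly (D_num 5 \<alpha> \<gamma> \<xi> \<omega> \<Delta>t)) k)
             \<longlongrightarrow> coeff ([:- R_inf (\<gamma> 1), 1:]^2) k) at_top)) \<and>
    (\<forall>\<rho>\<in>{-1..1}. \<exists>\<gamma>1 \<in> {a1..b1} \<union> {a2..b2}. R_inf \<gamma>1 = \<rho>)"
proof -
  obtain a1 b1 a2 b2 :: real where close:
    "\<bar>a1 - 0.4930103863\<bar> \<le> 1 / 10^8" "\<bar>b1 - 0.7236067977\<bar> \<le> 1 / 10^8"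
    "\<bar>a2 - 0.8415650255\<bar> \<le> 1 / 10^8" "\<bar>b2 - 0.9465367825\<bar> \<le> 1 / 10^8"
    and roots: "R_plus a1 = 0" "gap6 b2 = 0" "5 * b1^2 - 5 * b1 + 1 = 0" "30 * a2^2 - 30 * a2 + 4 = 0"
    by (rule stability_interval_endpoints)
  have order: "0 < a1" "a1 < b1" "b1 < a2" "a2 < b2"
    using close by (simp_all only: abs_le_iff) simp_all
  have attain: "\<exists>\<gamma>1 \<in> {a1..b1} \<union> {a2..b2}. R_inf \<gamma>1 = \<rho>" if "\<rho> \<in> {-1..1}" for \<rho>
    using R_inf_attains[of a1 b1 \<rho>] order roots that R_minus_factor[of b1] by auto
  have scheme: "accurate_of_order 5 5 \<alpha> \<gamma> \<and>
       (unconditionally_stable 5 \<alpha> \<gamma> \<longleftrightarrow> \<gamma> 1 \<in> {a1..b1} \<union> {a2..b2}) \<and>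
       (\<forall>\<Delta>t>0. \<forall>\<xi>\<in>{0..<1}. \<forall>k.
          ((\<lambda>\<omega>. coeff (char_poly (D_num 5 \<alpha> \<gamma> \<xi> \<omega> \<Delta>t)) k)
             \<longlongrightarrow> coeff ([:- R_inf (\<gamma> 1), 1:]^2) k) at_top)" if S: "SUCI5 \<alpha> \<gamma>" for \<alpha> \<gamma>
  proof -
    have cond: "order5_conditions \<alpha> \<gamma>" by (rule SUCI5_order5_conditions[OF S])
    have \<gamma>: "\<gamma> 0 = 0" "\<gamma> 5 = 1" "\<gamma> 1 > 0" and diag: "\<And>i. i \<in> {1..5} \<Longrightarrow> \<alpha> i i = \<gamma> 1 / 2"
      using S unfolding SUCI5_def Let_def by blast+
    have g: "\<gamma> 1 / 2 > 0" using \<gamma>(3) by simp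
    show ?thesis
      using order5_conditions_accurate[OF cond \<gamma>(1,2) g diag]
        unconditionally_stable_iff_gap_nonneg[OF cond \<gamma> diag] gap_nonneg_iff[OF close roots \<gamma>(3)]
        char_poly_tendsto[OF cond \<gamma> diag]
      by blast
  qed
  show ?thesis
    by (intro exI[of _ a1] exI[of _ b1] exI[of _ a2] exI[of _ b2] conjI allI impI ballI close order scheme attain)
qed

end
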